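(* Let $n\ge 2$, let $R_1>0$, and let $\Omega_0\subset\mathbb{R}^n$ be an open, bounded and convex set such that $\overline{B_{R_1}}\subset\Omega_0\subseteq B_{\bar R}$, where $B_R$ denotes the open ball of radius $R$ centered at the origin and $$\bar R=\begin{cases} R_1 e^{\sqrt 2} & \text{if } n=2,\\[4pt] R_1\left[\dfrac{(n-1)+(n-2)\sqrt{2(n-1)}}{n-1}\right]^{\frac{1}{n-2}} & \text{if } n\ge 3.\end{cases}$$ Let $\Omega=\Omega_0\setminus\overline{B_{R_1}}$. Let $R_2>R_1$ be such that the spherical shell $A_{R_1,R_2}=\{x\in\mathbb{R}^n: R_1<|x|<R_2\}$ has the same volume (Lebesgue measure) as $\Omega$. Then $$\sigma_1(\Omega)\le\sigma_1(A_{R_1,R_2}),$$ where $\sigma_1$ denotes the first Steklov-Dirichlet eigenvalue.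
   Context: For an open, bounded, connected set $\Omega_0\subset\mathbb{R}^n$ with Lipschitz boundary such that $\overline{B_{R_1}}\subset\Omega_0$, and $\Omega=\Omega_0\setminus\overline{B_{R_1}}$, let $H^1_{\partial B_{R_1}}(\Omega)$ be the closure in $H^1(\Omega)$ of the set $\{u|_{\Omega} : u\in C_0^\infty(\mathbb{R}^n),\ \operatorname{spt}(u)\cap\partial B_{R_1}=\emptyset\}$. The first Steklov-Dirichlet eigenvalue of $\Omega$ is $$\sigma_1(\Omega)=\min_{v\in H^1_{\partial B_{R_1}}(\Omega),\ v\not\equiv 0}\ \frac{\int_\Omega|\nabla v|^2\,dx}{\int_{\partial\Omega_0}v^2\,d\mathcal{H}^{n-1}},$$ where $v$ on $\partial\Omega_0$ is understood in the sense of traces, $\mathcal{H}^{n-1}$ is the $(n-1)$-dimensional Hausdorff measure, and the quotient is regarded as $+\infty$ when the denominator vanishes. For $\Omega=A_{R_1,R_2}$ one takes $\Omega_0=B_{R_2}$. *)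

theory Defs
  imports "HOL-Analysis.Analysis"
begin

section \<open>Hausdorff measure\<close>

(* Covering sets are required to be bounded because diameter takes an arbitrary value on
   unbounded sets.  The factor unit_ball_vol s / 2 powr s is the usual normalisation, for which
   the measure of dimension DIM('a) is Lebesgue measure.  Meant for s > 0: the convention
   0 powr 0 = 0 makes the case s = 0 differ from counting measure. *)
definition hausdorff_content :: "real \<Rightarrow> real \<Rightarrow> 'a::metric_space set \<Rightarrow> ennreal" where
  "hausdorff_content s \<delta> A =
     (INF C \<in> {C :: nat \<Rightarrow> 'a set. A \<subseteq> (\<Union>i. C i) \<and> (\<forall>i. bounded (C i) \<and> diameter (C i) \<le> \<delta>)}.
        (\<Sum>i. ennreal (unit_ball_vol s / 2 powr s * diameter (C i) powr s)))"

definition hausdorff_outer :: "real \<Rightarrow> 'a::metric_space set \<Rightarrow> ennreal" where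
  "hausdorff_outer s A = (SUP \<delta> \<in> {0<..}. hausdorff_content s \<delta> A)"

definition hausdorff_measure :: "real \<Rightarrow> 'a::metric_space measure" where
  "hausdorff_measure s = measure_of UNIV (sets borel) (hausdorff_outer s)"

(* (n-1)-dimensional Hausdorff measure on a subset of R^n *)
definition surface_measure :: "(real^'n) set \<Rightarrow> (real^'n) measure" where
  "surface_measure \<Gamma> = restrict_space (hausdorff_measure (real CARD('n) - 1)) \<Gamma>"


section \<open>Smooth functions of compact support\<close>

definition partial_deriv :: "'n::finite \<Rightarrow> (real^'n \<Rightarrow> real) \<Rightarrow> real^'n \<Rightarrow> real" where
  "partial_deriv i f x = frechet_derivative f (at x) (axis i 1)"

definition gradient :: "(real^'n \<Rightarrow> real) \<Rightarrow> real^'n \<Rightarrow> real^'n" where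
  "gradient f x = (\<chi> i. partial_deriv i f x)"

primrec C_k :: "nat \<Rightarrow> (real^'n \<Rightarrow> real) \<Rightarrow> bool" where
  "C_k 0 f \<longleftrightarrow> continuous_on UNIV f"
| "C_k (Suc k) f \<longleftrightarrow> (\<forall>x. f differentiable (at x)) \<and> (\<forall>i. C_k k (partial_deriv i f))"

definition spt :: "(real^'n \<Rightarrow> real) \<Rightarrow> (real^'n) set" where
  "spt f = closure {x. f x \<noteq> 0}"

definition smooth_compact :: "(real^'n) set \<Rightarrow> (real^'n \<Rightarrow> real) set" where
  "smooth_compact U = {f. (\<forall>k. C_k k f) \<and> compact (spt f) \<and> spt f \<subseteq> U}"


section \<open>Sobolev spaces and traces\<close>

(* Elements of L2 and H1 are represented by functions, not by classes modulo null sets; for a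
   function in H1 \<Omega> only the values on \<Omega> (up to a null set) are relevant. *)
definition L2 :: "'a measure \<Rightarrow> ('a \<Rightarrow> 'b::{real_normed_vector, second_countable_topology}) set" where
  "L2 M = {f \<in> borel_measurable M. integrable M (\<lambda>x. (norm (f x))\<^sup>2)}"

definition has_weak_gradient ::
    "(real^'n) set \<Rightarrow> (real^'n \<Rightarrow> real) \<Rightarrow> (real^'n \<Rightarrow> real^'n) \<Rightarrow> bool" where
  "has_weak_gradient \<Omega> u g \<longleftrightarrow>
     (\<forall>\<phi> \<in> smooth_compact \<Omega>. \<forall>i.
        (LINT x|lebesgue_on \<Omega>. u x * partial_deriv i \<phi> x) =
        - (LINT x|lebesgue_on \<Omega>. g x $ i * \<phi> x))"

definition H1 :: "(real^'n) set \<Rightarrow> (real^'n \<Rightarrow> real) set" where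
  "H1 \<Omega> = {u \<in> L2 (lebesgue_on \<Omega>). \<exists>g \<in> L2 (lebesgue_on \<Omega>). has_weak_gradient \<Omega> u g}"

(* For u in H1 \<Omega> the gradient is determined up to a null subset of \<Omega>. *)
definition weak_gradient :: "(real^'n) set \<Rightarrow> (real^'n \<Rightarrow> real) \<Rightarrow> real^'n \<Rightarrow> real^'n" where
  "weak_gradient \<Omega> u = (SOME g. g \<in> L2 (lebesgue_on \<Omega>) \<and> has_weak_gradient \<Omega> u g)"

definition dirichlet_energy :: "(real^'n) set \<Rightarrow> (real^'n \<Rightarrow> real) \<Rightarrow> real" where
  "dirichlet_energy \<Omega> u = (LINT x|lebesgue_on \<Omega>. (norm (weak_gradient \<Omega> u x))\<^sup>2)"

definition H1_norm :: "(real^'n) set \<Rightarrow> (real^'n \<Rightarrow> real) \<Rightarrow> real" where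
  "H1_norm \<Omega> u = sqrt ((LINT x|lebesgue_on \<Omega>. (u x)\<^sup>2) + dirichlet_energy \<Omega> u)"

(* The closure in H1 \<Omega> of the restrictions to \<Omega> of the functions in
   smooth_compact UNIV whose support does not meet K. *)
definition H1_vanishing :: "(real^'n) set \<Rightarrow> (real^'n) set \<Rightarrow> (real^'n \<Rightarrow> real) set" where
  "H1_vanishing \<Omega> K =
     {v \<in> H1 \<Omega>. \<forall>\<epsilon>>0. \<exists>\<phi> \<in> smooth_compact UNIV.
        spt \<phi> \<inter> K = {} \<and> H1_norm \<Omega> (\<lambda>x. v x - \<phi> x) < \<epsilon>}"

(* t is the trace of v on the part \<Gamma> of the boundary of \<Omega>: the trace operator is the continuous
   extension of the restriction map from smooth functions on the closure of \<Omega>.  On a Lipschitz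
   domain every v in H1 \<Omega> has a trace, unique up to a null set of the surface measure. *)
definition has_trace ::
    "(real^'n) set \<Rightarrow> (real^'n) set \<Rightarrow> (real^'n \<Rightarrow> real) \<Rightarrow> (real^'n \<Rightarrow> real) \<Rightarrow> bool" where
  "has_trace \<Omega> \<Gamma> v t \<longleftrightarrow>
     t \<in> L2 (surface_measure \<Gamma>) \<and>
     (\<exists>\<phi> :: nat \<Rightarrow> real^'n \<Rightarrow> real. (\<forall>k. \<phi> k \<in> smooth_compact UNIV) \<and>
        (\<lambda>k. H1_norm \<Omega> (\<lambda>x. v x - \<phi> k x)) \<longlonglongrightarrow> 0 \<and>
        (\<lambda>k. \<integral>\<^sup>+x. ennreal ((t x - \<phi> k x)\<^sup>2) \<partial>surface_measure \<Gamma>) \<longlonglongrightarrow> 0)"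


section \<open>The first Steklov-Dirichlet eigenvalue\<close>

definition steklov_dirichlet_quotient ::
    "(real^'n) set \<Rightarrow> (real^'n) set \<Rightarrow> (real^'n \<Rightarrow> real) \<Rightarrow> (real^'n \<Rightarrow> real) \<Rightarrow> ennreal" where
  "steklov_dirichlet_quotient \<Omega> \<Gamma> v t =
     (let d = (LINT x|surface_measure \<Gamma>. (t x)\<^sup>2)
      in if d = 0 then \<infinity> else ennreal (dirichlet_energy \<Omega> v / d))"

(* The eigenvalue of \<Omega>0 - cball 0 R1, the infimum ranging over the functions v that do not vanish
   almost everywhere, together with their trace t on the outer boundary. *)
definition steklov_dirichlet_eigenvalue :: "real \<Rightarrow> (real^'n) set \<Rightarrow> ennreal" where
  "steklov_dirichlet_eigenvalue R1 \<Omega>0 =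
     (let \<Omega> = \<Omega>0 - cball 0 R1; \<Gamma> = frontier \<Omega>0 in
      INF (v, t) \<in> {(v, t). v \<in> H1_vanishing \<Omega> (sphere 0 R1)
                          \<and> \<not> (AE x in lebesgue_on \<Omega>. v x = 0) \<and> has_trace \<Omega> \<Gamma> v t}.
        steklov_dirichlet_quotient \<Omega> \<Gamma> v t)"


section \<open>Spherical shells and the critical radius\<close>

definition shell :: "real \<Rightarrow> real \<Rightarrow> (real^'n) set" where
  "shell R1 R2 = {x. R1 < norm x \<and> norm x < R2}"

lemma shell_eq_ball_diff_cball: "shell R1 R2 = ball 0 R2 - cball 0 R1"
  by (auto simp: shell_def)

definition critical_radius :: "nat \<Rightarrow> real \<Rightarrow> real" where
  "critical_radius n R1 =
     (if n = 2 then R1 * exp (sqrt 2)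
      else R1 * (((real n - 1) + (real n - 2) * sqrt (2 * (real n - 1))) / (real n - 1))
                 powr (1 / (real n - 2)))"

end

theory Submission
  imports Defs
begin

text \<open>
  Write \<open>W\<close> for the radial profile with \<open>W R1 = 0\<close> and \<open>W' r = r\<^sup>1\<^sup>-\<^sup>n\<close>; then \<open>W (norm x)\<close> is the first eigenfunction
  of the shell, and it serves as test function on \<open>\<Omega>0 - cball 0 R1\<close>.  Its energy density decreases in
  \<open>norm x\<close>, so at fixed volume the shell has the largest energy.  The denominator is bounded below
  by that of the shell: radial projection onto the sphere of radius \<open>R2\<close> is \<open>R2 / r\<close>-Lipschitz outside the ball of
  radius \<open>r\<close>, so the integral of \<open>W\<^sup>2\<close> over \<open>frontier \<Omega>0\<close> dominates the integral over the sphere of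
  \<open>W (\<rho> \<xi>)\<^sup>2 (\<rho> \<xi> / R2)\<^sup>n\<^sup>-\<^sup>1\<close>, where \<open>\<rho>\<close> is the radial function of \<open>\<Omega>0\<close>.  Below the critical radius the integrand is a
  convex function of \<open>(\<rho> \<xi>)\<^sup>n\<close>, whose mean is fixed by the volume, and Jensen's inequality applies.

  Only the proportionality of Hausdorff and polar measure on a sphere matters, since the constant cancels;
  it follows from the uniqueness of uniformly distributed measures, so that
  the isodiametric inequality is not needed.
\<close>

section \<open>Smooth functions\<close>

text \<open>Both eigenvalues are compared with one number,
  \<open>n * unit_ball_vol n / (m * W R2)\<close>, where \<open>m\<close> is the unknown Hausdorff
  mass of the sphere of radius \<open>R2\<close>. It bounds the eigenvalue of the shell from below
  and that of the convex domain from above; attainment of the infima is never discussed. The sharp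
  inequality on the shell is needed for every admissible pair of function and trace. Membership in
  the space and the trace are witnessed by unrelated smooth approximations, and a second, crude
  trace inequality ties them together. On the convex side the profile does not vanish near the inner
  sphere and has no compact support, so it is lowered, truncated and cut off at a cost that tends to
  zero. A further obstacle is that \<open>hausdorff_measure\<close> is made by
  \<open>measure_of\<close>, so its values are those of \<open>hausdorff_outer\<close> only if the
  latter is a measure on the Borel sets. This is inferred from \<open>m\<close> being nonzero, and
  the case \<open>m = 0\<close> is treated apart.\<close>

primrec C_k_on :: "nat \<Rightarrow> (real^'n) set \<Rightarrow> (real^'n \<Rightarrow> real) \<Rightarrow> bool" where
  "C_k_on 0 U f \<longleftrightarrow> continuous_on U f"
| "C_k_on (Suc k) U f \<longleftrightarrow> (\<forall>x\<in>U. f differentiable (at x)) \<and> (\<forall>i. C_k_on k U (partial_deriv i f))"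

text \<open>Smoothness is localised because the test function is glued from pieces on two open sets,
  and the formula on the outer piece is singular at the origin.\<close>

definition smooth_on :: "(real^'n) set \<Rightarrow> (real^'n \<Rightarrow> real) \<Rightarrow> bool" where
  "smooth_on U f \<longleftrightarrow> (\<forall>k. C_k_on k U f)"

lemma C_k_iff_C_k_on: "C_k k f \<longleftrightarrow> C_k_on k UNIV f"
  by (induction k arbitrary: f) auto

lemma partial_derivI: "(f has_derivative f') (at x) \<Longrightarrow> partial_deriv i f x = f' (axis i 1)"
  unfolding partial_deriv_def by (metis frechet_derivative_at)

lemma has_derivative_cong_open:
  assumes "open U" "x \<in> U" "\<And>y. y \<in> U \<Longrightarrow> f y = g y"
  shows "(f has_derivative f') (at x) \<longleftrightarrow> (g has_derivative f') (at x)"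
  using assms has_derivative_transform_within_open[of _ _ x UNIV U] by metis

lemma differentiable_cong_open:
  assumes "open U" "x \<in> U" "\<And>y. y \<in> U \<Longrightarrow> f y = g y"
  shows "f differentiable (at x) \<longleftrightarrow> g differentiable (at x)"
  unfolding differentiable_def using has_derivative_cong_open[OF assms] by simp

lemma partial_deriv_cong_open:
  assumes "open U" "x \<in> U" "\<And>y. y \<in> U \<Longrightarrow> f y = g y"
  shows "partial_deriv i f x = partial_deriv i g x"
  unfolding partial_deriv_def frechet_derivative_def using has_derivative_cong_open[OF assms] by simp

lemma C_k_on_cong:
  assumes "open U" "\<And>y. y \<in> U \<Longrightarrow> f y = g y"
  shows "C_k_on k U f \<longleftrightarrow> C_k_on k U g"
  using assms(2)
proof (induction k arbitrary: f g)
  case 0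
  then show ?case by (simp cong: continuous_on_cong)
next
  case (Suc k)
  have "C_k_on k U (partial_deriv i f) \<longleftrightarrow> C_k_on k U (partial_deriv i g)" for i
    by (rule Suc.IH) (use Suc.prems assms(1) partial_deriv_cong_open in blast)
  moreover have "(\<forall>x\<in>U. f differentiable (at x)) \<longleftrightarrow> (\<forall>x\<in>U. g differentiable (at x))"
    using Suc.prems assms(1) differentiable_cong_open by blast
  ultimately show ?case by simp
qed

lemma C_k_on_continuous: "C_k_on k U f \<Longrightarrow> continuous_on U f"
proof (cases k)
  case (Suc m)
  assume "C_k_on k U f"
  with Suc have "isCont f x" if "x \<in> U" for x
    using that differentiable_imp_continuous_within[of f x UNIV] by simp
  then show ?thesis by (simp add: continuous_at_imp_continuous_on)
qed simp

lemma C_k_on_SucD: "C_k_on (Suc k) U f \<Longrightarrow> C_k_on k U f"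
proof (induction k arbitrary: f)
  case 0
  then show ?case using C_k_on_continuous by (metis C_k_on.simps(1))
qed simp

lemma C_k_on_Un:
  assumes "open U" "open V"
  shows "C_k_on k U f \<Longrightarrow> C_k_on k V f \<Longrightarrow> C_k_on k (U \<union> V) f"
  by (induction k arbitrary: f) (auto intro: continuous_on_open_Un assms)

lemma C_k_on_const: "C_k_on k (U :: (real^'n) set) (\<lambda>x. c)"
proof (induction k arbitrary: c)
  case (Suc k)
  have "partial_deriv i (\<lambda>x::real^'n. c) = (\<lambda>x. 0)" for i
    by (rule ext, subst partial_derivI[OF has_derivative_const]) simp
  with Suc show ?case by simp
qed simp

lemma C_k_on_component: "C_k_on k (U :: (real^'n) set) (\<lambda>x. x $ j)"
proof (cases k)
  case (Suc m)
  have d: "((\<lambda>x. x $ j) has_derivative (\<lambda>h. h $ j)) (at x)" for x :: "real^'n"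
    by (rule bounded_linear_imp_has_derivative) (rule bounded_linear_vec_nth)
  have "partial_deriv i (\<lambda>x. x $ j) = (\<lambda>x::real^'n. axis i 1 $ j)" for i
    by (rule ext, subst partial_derivI[OF d]) simp
  with Suc d show ?thesis by (auto simp: C_k_on_const differentiable_def)
qed (auto intro: continuous_intros)

lemma C_k_on_add:
  assumes "open U"
  shows "C_k_on k U f \<Longrightarrow> C_k_on k U g \<Longrightarrow> C_k_on k U (\<lambda>x. f x + g x)"
proof (induction k arbitrary: f g)
  case (Suc k)
  have "C_k_on k U (partial_deriv i (\<lambda>x. f x + g x))" for i
  proof (subst C_k_on_cong[OF assms])
    show "partial_deriv i (\<lambda>x. f x + g x) x = partial_deriv i f x + partial_deriv i g x"
      if "x \<in> U" for x
      using Suc.prems that has_derivative_add[of f _ "at x" g]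
      by (auto simp: partial_deriv_def frechet_derivative_works intro!: partial_derivI[unfolded partial_deriv_def])
    show "C_k_on k U (\<lambda>x. partial_deriv i f x + partial_deriv i g x)"
      using Suc by simp
  qed
  with Suc.prems show ?case by simp
qed (auto intro: continuous_intros)

lemma C_k_on_mult:
  assumes "open U"
  shows "C_k_on k U f \<Longrightarrow> C_k_on k U g \<Longrightarrow> C_k_on k U (\<lambda>x. f x * g x)"
proof (induction k arbitrary: f g)
  case (Suc k)
  have "C_k_on k U (partial_deriv i (\<lambda>x. f x * g x))" for i
  proof (subst C_k_on_cong[OF assms])
    show "partial_deriv i (\<lambda>x. f x * g x) x = f x * partial_deriv i g x + partial_deriv i f x * g x"
      if "x \<in> U" for x
      using Suc.prems that has_derivative_mult[of f _ x UNIV g]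
      by (auto simp: partial_deriv_def frechet_derivative_works intro!: partial_derivI[unfolded partial_deriv_def])
    show "C_k_on k U (\<lambda>x. f x * partial_deriv i g x + partial_deriv i f x * g x)"
      using Suc.prems by (intro C_k_on_add[OF assms] Suc.IH) (auto intro: C_k_on_SucD)
  qed
  with Suc.prems show ?case by simp
qed (auto intro: continuous_intros)

lemma smooth_on_const: "smooth_on U (\<lambda>x. c)"
  by (simp add: smooth_on_def C_k_on_const)

lemma smooth_on_add: "open U \<Longrightarrow> smooth_on U f \<Longrightarrow> smooth_on U g \<Longrightarrow> smooth_on U (\<lambda>x. f x + g x)"
  by (simp add: smooth_on_def C_k_on_add)

lemma smooth_on_mult: "open U \<Longrightarrow> smooth_on U f \<Longrightarrow> smooth_on U g \<Longrightarrow> smooth_on U (\<lambda>x. f x * g x)"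
  by (simp add: smooth_on_def C_k_on_mult)

lemma smooth_on_diff:
  assumes "open U" "smooth_on U f" "smooth_on U g"
  shows "smooth_on U (\<lambda>x. f x - g x)"
  using smooth_on_add[OF assms(1,2) smooth_on_mult[OF assms(1) smooth_on_const assms(3)], of "-1"] by simp

lemma smooth_on_component: "smooth_on U (\<lambda>x. x $ i)"
  by (simp add: smooth_on_def C_k_on_component)

lemma smooth_on_sum:
  assumes "open U" "finite I" "\<And>i. i \<in> I \<Longrightarrow> smooth_on U (f i)"
  shows "smooth_on U (\<lambda>x. \<Sum>i\<in>I. f i x)"
  using assms(2,3) by (induction I) (auto simp: smooth_on_const intro!: smooth_on_add assms(1))

lemma smooth_on_prod:
  assumes "open U" "finite I" "\<And>i. i \<in> I \<Longrightarrow> smooth_on U (f i)"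
  shows "smooth_on U (\<lambda>x. \<Prod>i\<in>I. f i x)"
  using assms(2,3) by (induction I) (auto simp: smooth_on_const intro!: smooth_on_mult assms(1))

lemma smooth_on_norm_square: "open U \<Longrightarrow> smooth_on U (\<lambda>x. (norm x)\<^sup>2)"
  unfolding power2_norm_eq_inner inner_vec_def inner_real_def
  by (intro smooth_on_sum smooth_on_mult smooth_on_component) auto

lemma smooth_on_Un: "open U \<Longrightarrow> open V \<Longrightarrow> smooth_on U f \<Longrightarrow> smooth_on V f \<Longrightarrow> smooth_on (U \<union> V) f"
  by (simp add: smooth_on_def C_k_on_Un)

lemma smooth_on_cong:
  "open U \<Longrightarrow> (\<And>y. y \<in> U \<Longrightarrow> f y = g y) \<Longrightarrow> smooth_on U f \<longleftrightarrow> smooth_on U g"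
  unfolding smooth_on_def using C_k_on_cong by blast

lemma smooth_on_partial_deriv: "smooth_on U f \<Longrightarrow> smooth_on U (partial_deriv i f)"
  unfolding smooth_on_def by (metis C_k_on.simps(2))

lemma smooth_on_continuous: "smooth_on U f \<Longrightarrow> continuous_on U f"
  unfolding smooth_on_def using C_k_on.simps(1) by blast

lemma has_derivative_gradient:
  assumes "f differentiable (at x)"
  shows "(f has_derivative (\<lambda>h. gradient f x \<bullet> h)) (at x)"
proof -
  have *: "(f has_derivative frechet_derivative f (at x)) (at x)"
    using assms frechet_derivative_works by blast
  then have lin: "linear (frechet_derivative f (at x))"
    using has_derivative_linear by blast
  have "frechet_derivative f (at x) h = gradient f x \<bullet> h" for h
  proof -
    have "frechet_derivative f (at x) h = frechet_derivative f (at x) (\<Sum>i\<in>UNIV. h $ i *\<^sub>R axis i 1)"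
      using basis_expansion[of h] by (simp add: scalar_mult_eq_scaleR)
    also have "\<dots> = (\<Sum>i\<in>UNIV. h $ i *\<^sub>R frechet_derivative f (at x) (axis i 1))"
      using lin by (simp add: linear_sum linear_scale)
    finally show ?thesis
      by (simp add: gradient_def partial_deriv_def inner_vec_def mult.commute)
  qed
  then have "frechet_derivative f (at x) = (\<lambda>h. gradient f x \<bullet> h)" by auto
  with * show ?thesis by simp
qed

lemma smooth_on_has_derivative:
  "smooth_on U f \<Longrightarrow> x \<in> U \<Longrightarrow> (f has_derivative (\<lambda>h. gradient f x \<bullet> h)) (at x)"
  unfolding smooth_on_def by (metis C_k_on.simps(2) has_derivative_gradient)

lemma smooth_on_continuous_gradient: "smooth_on U f \<Longrightarrow> continuous_on U (gradient f)"
  unfolding gradient_def by (auto intro!: continuous_intros smooth_on_continuous smooth_on_partial_deriv)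

text \<open>All derivatives are carried along as a tower \<open>D\<close>: the derivative of
  \<open>G\<close> is smooth by shifting the tower, an antiderivative by extending it.\<close>

definition smooth_real_on :: "real set \<Rightarrow> (real \<Rightarrow> real) \<Rightarrow> bool" where
  "smooth_real_on V G \<longleftrightarrow>
     (\<exists>D. D 0 = G \<and> (\<forall>k. \<forall>y\<in>V. (D k has_real_derivative D (Suc k) y) (at y)))"

text \<open>The induction runs over all \<open>G\<close> at once, since the chain rule trades
  \<open>G\<close> for its derivative, to which the induction hypothesis is applied.\<close>

lemma C_k_on_compose:
  assumes "open U" "\<And>x. x \<in> U \<Longrightarrow> f x \<in> V"
  shows "smooth_real_on V G \<Longrightarrow> C_k_on k U f \<Longrightarrow> C_k_on k U (\<lambda>x. G (f x))"
proof (induction k arbitrary: G)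
  case 0
  then have "continuous_on V G"
    unfolding smooth_real_on_def using DERIV_isCont by (metis continuous_at_imp_continuous_on)
  with 0 assms(2) show ?case
    by (auto intro: continuous_on_compose2)
next
  case (Suc k)
  from Suc.prems(1) obtain D where D: "D 0 = G"
    "\<And>k y. y \<in> V \<Longrightarrow> (D k has_real_derivative D (Suc k) y) (at y)"
    unfolding smooth_real_on_def by metis
  have sm: "smooth_real_on V (D 1)"
    unfolding smooth_real_on_def by (rule exI[of _ "\<lambda>k. D (Suc k)"]) (simp add: D)
  have der: "((\<lambda>x. G (f x)) has_derivative (\<lambda>h. D 1 (f x) * frechet_derivative f (at x) h)) (at x)"
    if "x \<in> U" for x
  proof -
    have "(f has_derivative frechet_derivative f (at x)) (at x)"
      using Suc.prems(2) that by (simp add: frechet_derivative_works)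
    moreover have "(G has_derivative (*) (D 1 (f x))) (at (f x))"
      using D(2)[of "f x" 0] assms(2)[OF that] D(1) by (simp add: has_field_derivative_def)
    ultimately show ?thesis by (rule has_derivative_compose)
  qed
  have "C_k_on k U (partial_deriv i (\<lambda>x. G (f x)))" for i
  proof (subst C_k_on_cong[OF assms(1)])
    show "partial_deriv i (\<lambda>x. G (f x)) x = D 1 (f x) * partial_deriv i f x" if "x \<in> U" for x
      using partial_derivI[OF der[OF that]] by (simp add: partial_deriv_def)
    show "C_k_on k U (\<lambda>x. D 1 (f x) * partial_deriv i f x)"
      using Suc.prems by (intro C_k_on_mult[OF assms(1)] Suc.IH[OF sm]) (auto intro: C_k_on_SucD)
  qed
  with der show ?case by (auto simp: differentiable_def)
qed

lemma smooth_on_compose: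
  "open U \<Longrightarrow> smooth_real_on V G \<Longrightarrow> smooth_on U f \<Longrightarrow> (\<And>x. x \<in> U \<Longrightarrow> f x \<in> V)
     \<Longrightarrow> smooth_on U (\<lambda>x. G (f x))"
  unfolding smooth_on_def using C_k_on_compose by blast

lemma smooth_real_on_antiderivative:
  assumes "\<And>y. y \<in> V \<Longrightarrow> (F has_real_derivative G y) (at y)" "smooth_real_on V G"
  shows "smooth_real_on V F"
proof -
  obtain D where D: "D 0 = G" "\<And>k y. y \<in> V \<Longrightarrow> (D k has_real_derivative D (Suc k) y) (at y)"
    using assms(2) unfolding smooth_real_on_def by metis
  show ?thesis
    unfolding smooth_real_on_def
    by (rule exI[of _ "case_nat F D"]) (auto simp: D assms(1) split: nat.split)
qed

lemma smooth_real_on_powr: "smooth_real_on {0<..} (\<lambda>s. c * s powr a)"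
  unfolding smooth_real_on_def
proof (intro exI[of _ "\<lambda>k s. c * (\<Prod>i<k. a - real i) * s powr (a - real k)"] conjI allI ballI)
  fix k and y :: real assume "y \<in> {0<..}"
  then show "((\<lambda>s. c * (\<Prod>i<k. a - real i) * s powr (a - real k)) has_real_derivative
      c * (\<Prod>i<Suc k. a - real i) * y powr (a - real (Suc k))) (at y)"
    by (auto intro!: derivative_eq_intros simp: algebra_simps)
qed simp

section \<open>Flat functions and smooth cutoffs\<close>

definition flat :: "real \<Rightarrow> real" where
  "flat t = (if t \<le> 0 then 0 else exp (- (1 / t)))"

lemma poly_exp_tendsto_0: "((\<lambda>y::real. poly p y * exp (- y)) \<longlongrightarrow> 0) at_top"
proof -
  have "((\<lambda>y::real. y ^ j * poly p y * exp (- y)) \<longlongrightarrow> 0) at_top" for j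
  proof (induction p arbitrary: j)
    case (pCons a p)
    have "((\<lambda>y::real. a * (y ^ j / exp y) + y ^ Suc j * poly p y * exp (- y)) \<longlongrightarrow> a * 0 + 0) at_top"
      by (intro tendsto_intros tendsto_power_div_exp_0 pCons.IH)
    then show ?case
      by (simp add: algebra_simps exp_minus divide_inverse)
  qed simp
  from this[of 0] show ?thesis by simp
qed

lemma smooth_flat: "smooth_real_on UNIV flat"
proof -
  \<comment> \<open>With \<open>y = 1 / t\<close>, differentiation in \<open>t\<close> turns
    \<open>p y * exp (- y)\<close> into \<open>y\<^sup>2 * (p y - p' y) * exp (- y)\<close>; this is
    the recursion.\<close>
  define p :: "nat \<Rightarrow> real poly" where
    "p = rec_nat 1 (\<lambda>_ q. [:0, 0, 1:] * (q - pderiv q))"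
  define D where "D k t = (if t \<le> 0 then 0 else poly (p k) (1 / t) * exp (- (1 / t)))" for k t
  have p0: "p 0 = 1" and pS: "p (Suc k) = [:0, 0, 1:] * (p k - pderiv (p k))" for k
    by (simp_all add: p_def)
  have "(D k has_real_derivative D (Suc k) t) (at t)" for k t
  proof -
    consider "t < 0" | "t = 0" | "t > 0" by linarith
    then show ?thesis
    proof cases
      case 1
      have "((\<lambda>t. 0) has_real_derivative 0) (at t)" by simp
      then have "(D k has_real_derivative 0) (at t)"
        by (rule has_field_derivative_transform_within_open[of _ _ _ "{..<0}"]) (use 1 in \<open>auto simp: D_def\<close>)
      with 1 show ?thesis by (simp add: D_def)
    next
      case 2
      \<comment> \<open>Under \<open>h = 1 / y\<close> the right difference quotient at zero is a
        polynomial in \<open>y\<close> times \<open>exp (- y)\<close>.\<close>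
      have "((\<lambda>h. (D k (0 + h) - D k 0) / h) \<longlongrightarrow> 0) (at_right 0)"
        unfolding filterlim_at_right_to_top
      proof (rule Lim_transform_eventually)
        show "((\<lambda>y. poly ([:0, 1:] * p k) y * exp (- y)) \<longlongrightarrow> 0) at_top"
          by (rule poly_exp_tendsto_0)
        show "\<forall>\<^sub>F y in at_top. poly ([:0, 1:] * p k) y * exp (- y) =
            (D k (0 + inverse y) - D k 0) / inverse y"
          using eventually_gt_at_top[of 0] by eventually_elim (auto simp: D_def field_simps)
      qed
      moreover have "((\<lambda>h. (D k (0 + h) - D k 0) / h) \<longlongrightarrow> 0) (at_left 0)"
        by (rule Lim_transform_eventually[OF tendsto_const])
          (auto simp: D_def eventually_at_filter)
      ultimately show ?thesis
        using 2 by (auto simp: D_def has_field_derivative_iff filterlim_split_at)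
    next
      case 3
      have "((\<lambda>t. poly (p k) (1 / t) * exp (- (1 / t))) has_real_derivative D (Suc k) t) (at t)"
        using 3 by (auto intro!: derivative_eq_intros simp: D_def pS power2_eq_square field_simps)
      then show ?thesis
        by (rule has_field_derivative_transform_within_open[of _ _ _ "{0<..}"]) (use 3 in \<open>auto simp: D_def\<close>)
    qed
  qed
  moreover have "D 0 = flat" by (auto simp: D_def flat_def p0)
  ultimately show ?thesis unfolding smooth_real_on_def by blast
qed

lemma flat_nonneg: "0 \<le> flat t" and flat_le_1: "flat t \<le> 1"
  by (auto simp: flat_def)

lemma flat_eq_0_iff: "flat t = 0 \<longleftrightarrow> t \<le> 0"
  by (simp add: flat_def)

lemma flat_scale_tendsto: "(\<lambda>k. flat (real (Suc k) * t)) \<longlonglongrightarrow> (if t > 0 then 1 else 0)"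
proof (cases "t > 0")
  case True
  have "(\<lambda>k. exp (- (inverse (real (Suc k)) * (1 / t)))) \<longlonglongrightarrow> exp (- (0 * (1 / t)))"
    by (intro tendsto_intros LIMSEQ_inverse_real_of_nat)
  moreover have "flat (real (Suc k) * t) = exp (- (inverse (real (Suc k)) * (1 / t)))" for k
    using True by (simp add: flat_def mult_le_0_iff divide_inverse)
  ultimately show ?thesis using True by simp
next
  case False
  then show ?thesis by (simp add: flat_def mult_le_0_iff zero_le_mult_iff)
qed

text \<open>Composing \<open>flat\<close> with itself avoids a quotient. For
  \<open>t \<le> 0\<close> the term \<open>exp 1 * flat (1 - t)\<close> is at least one, so the
  outer argument is not positive; for \<open>t \<ge> 1\<close> it is zero, and the factor
  \<open>exp 1\<close> normalises the outer value to one.\<close>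

definition smooth_step :: "real \<Rightarrow> real" where
  "smooth_step t = exp 1 * flat (1 - exp 1 * flat (1 - t))"

lemma smooth_step_eq_1: "t \<ge> 1 \<Longrightarrow> smooth_step t = 1"
  by (simp add: smooth_step_def flat_def exp_minus)

lemma smooth_step_eq_0:
  assumes "t \<le> 0"
  shows "smooth_step t = 0"
proof -
  have "1 / (1 - t) \<le> 1" using assms by (simp add: field_simps)
  then have "exp (- 1) \<le> flat (1 - t)" using assms by (simp add: flat_def)
  then have "exp 1 * exp (- 1) \<le> exp 1 * flat (1 - t)" by (intro mult_left_mono) auto
  then show ?thesis by (simp add: smooth_step_def flat_eq_0_iff exp_minus)
qed

lemma smooth_on_smooth_step:
  assumes "open U" "smooth_on U f"
  shows "smooth_on U (\<lambda>x. smooth_step (f x))"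
  unfolding smooth_step_def
  by (intro smooth_on_mult smooth_on_const smooth_on_diff smooth_on_compose[OF _ smooth_flat] assms UNIV_I)

section \<open>Weak gradients\<close>

lemma smooth_compactD:
  assumes "\<phi> \<in> smooth_compact U"
  shows "smooth_on V \<phi>" "compact (spt \<phi>)" "spt \<phi> \<subseteq> U"
proof -
  have "C_k_on k V \<phi>" if "C_k_on k UNIV \<phi>" for k
    using that
  proof (induction k arbitrary: \<phi>)
    case 0
    then show ?case using continuous_on_subset by auto
  qed auto
  then show "smooth_on V \<phi>" "compact (spt \<phi>)" "spt \<phi> \<subseteq> U"
    using assms by (auto simp: smooth_compact_def C_k_iff_C_k_on smooth_on_def)
qed

lemma smooth_compactI:
  assumes "smooth_on UNIV \<phi>" "compact K" "\<And>x. \<phi> x \<noteq> 0 \<Longrightarrow> x \<in> K" "K \<subseteq> U"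
  shows "\<phi> \<in> smooth_compact U"
proof -
  have "spt \<phi> \<subseteq> K"
    unfolding spt_def using assms(2,3) by (intro closure_minimal) (auto simp: compact_imp_closed)
  moreover have "compact (spt \<phi>)"
    using \<open>spt \<phi> \<subseteq> K\<close> assms(2) by (metis compact_Int_closed closed_closure inf.absorb_iff2 spt_def)
  ultimately show ?thesis
    using assms by (auto simp: smooth_compact_def C_k_iff_C_k_on smooth_on_def)
qed

lemma smooth_compact_mono: "\<phi> \<in> smooth_compact U \<Longrightarrow> U \<subseteq> V \<Longrightarrow> \<phi> \<in> smooth_compact V"
  by (auto simp: smooth_compact_def)

lemma eq_0_outside_spt: "x \<notin> spt f \<Longrightarrow> f x = 0"
  using closure_subset[of "{x. f x \<noteq> 0}"] by (auto simp: spt_def)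

lemma partial_deriv_eq_0_outside_spt:
  assumes "x \<notin> spt f"
  shows "partial_deriv i f x = 0"
proof -
  have "partial_deriv i f x = partial_deriv i (\<lambda>x. 0) x"
  proof (rule partial_deriv_cong_open)
    show "open (- spt f)" by (simp add: open_Compl spt_def)
  qed (use assms in \<open>simp_all add: eq_0_outside_spt[of _ f]\<close>)
  also have "\<dots> = 0"
    by (subst partial_derivI[OF has_derivative_const]) simp
  finally show ?thesis .
qed

lemma smooth_compact_diff:
  assumes "\<phi> \<in> smooth_compact U" "\<psi> \<in> smooth_compact U"
  shows "(\<lambda>x. \<phi> x - \<psi> x) \<in> smooth_compact U"
proof (rule smooth_compactI)
  show "smooth_on UNIV (\<lambda>x. \<phi> x - \<psi> x)"
    by (intro smooth_on_diff smooth_compactD(1)[OF assms(1)] smooth_compactD(1)[OF assms(2)]) auto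
  show "compact (spt \<phi> \<union> spt \<psi>)" "spt \<phi> \<union> spt \<psi> \<subseteq> U"
    using smooth_compactD[OF assms(1)] smooth_compactD[OF assms(2)] by auto
  show "x \<in> spt \<phi> \<union> spt \<psi>" if "\<phi> x - \<psi> x \<noteq> 0" for x
    using that eq_0_outside_spt[of x \<phi>] eq_0_outside_spt[of x \<psi>]
    by (cases "x \<in> spt \<phi>"; cases "x \<in> spt \<psi>") auto
qed

lemma smooth_compact_mult:
  assumes "smooth_on UNIV \<psi>" "\<phi> \<in> smooth_compact U"
  shows "(\<lambda>x. \<psi> x * \<phi> x) \<in> smooth_compact U"
proof (rule smooth_compactI)
  show "smooth_on UNIV (\<lambda>x. \<psi> x * \<phi> x)"
    using assms by (intro smooth_on_mult smooth_compactD(1)[OF assms(2)]) auto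
  show "x \<in> spt \<phi>" if "\<psi> x * \<phi> x \<noteq> 0" for x
    using that eq_0_outside_spt[of x \<phi>] by auto
qed (use smooth_compactD[OF assms(2)] in auto)

lemma partial_deriv_diff:
  assumes "f differentiable (at x)" "g differentiable (at x)"
  shows "partial_deriv i (\<lambda>x. f x - g x) x = partial_deriv i f x - partial_deriv i g x"
  using assms has_derivative_diff[of f _ "at x" g]
  by (auto simp: partial_deriv_def frechet_derivative_works intro!: partial_derivI[unfolded partial_deriv_def])

lemma partial_deriv_mult:
  assumes "f differentiable (at x)" "g differentiable (at x)"
  shows "partial_deriv i (\<lambda>x. f x * g x) x = f x * partial_deriv i g x + partial_deriv i f x * g x"
  using assms has_derivative_mult[of f _ x UNIV g]
  by (auto simp: partial_deriv_def frechet_derivative_works intro!: partial_derivI[unfolded partial_deriv_def])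

lemma smooth_compact_differentiable: "\<phi> \<in> smooth_compact U \<Longrightarrow> \<phi> differentiable (at x)"
  using smooth_compactD(1)[of \<phi> U UNIV] unfolding smooth_on_def by (metis C_k_on.simps(2) UNIV_I)

lemma integrable_continuous_compact_support:
  fixes g :: "'a::euclidean_space \<Rightarrow> real"
  assumes "continuous_on UNIV g" "compact K" "\<And>x. x \<notin> K \<Longrightarrow> g x = 0"
  shows "integrable lborel g"
proof -
  have "integrable lborel (\<lambda>x. indicator K x *\<^sub>R g x)"
    using assms by (intro borel_integrable_compact) (auto intro: continuous_on_subset)
  moreover have "(\<lambda>x. indicator K x *\<^sub>R g x) = g"
    by (rule ext) (use assms(3) in \<open>auto simp: indicator_def\<close>)
  ultimately show ?thesis by simp
qed

lemma bounded_continuous_compact_support: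
  fixes g :: "'a::euclidean_space \<Rightarrow> real"
  assumes "continuous_on UNIV g" "compact K" "\<And>x. x \<notin> K \<Longrightarrow> g x = 0"
  obtains B where "0 \<le> B" "\<And>x. \<bar>g x\<bar> \<le> B"
proof -
  have "bounded (g ` K)"
    using assms by (intro compact_imp_bounded compact_continuous_image) (auto intro: continuous_on_subset)
  then obtain B where B: "\<And>x. x \<in> K \<Longrightarrow> \<bar>g x\<bar> \<le> B"
    unfolding bounded_iff by auto
  have "\<bar>g x\<bar> \<le> \<bar>B\<bar>" for x
    using B[of x] assms(3)[of x] by (cases "x \<in> K") auto
  then show thesis using that[of "\<bar>B\<bar>"] by auto
qed

text \<open>By translation invariance the integral of every difference quotient vanishes.\<close>

lemma integral_partial_deriv_eq_0:
  fixes \<phi> :: "real^'n \<Rightarrow> real" and i :: 'n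
  assumes "\<phi> \<in> smooth_compact UNIV"
  shows "(LINT x|lborel. partial_deriv i \<phi> x) = 0"
proof -
  define e :: "real^'n" where "e = axis i 1"
  have ne: "norm e = 1" by (simp add: e_def)
  define K where "K = spt \<phi>"
  have K: "compact K" using assms smooth_compactD by (auto simp: K_def)
  then obtain r where "\<forall>x\<in>K. norm x \<le> r"
    using compact_imp_bounded bounded_iff by blast
  then have r: "K \<subseteq> cball 0 r" by auto
  have sm: "smooth_on UNIV \<phi>" using assms by (rule smooth_compactD)
  have cont: "continuous_on UNIV \<phi>" "continuous_on UNIV (partial_deriv i \<phi>)"
    using sm by (auto intro: smooth_on_continuous smooth_on_partial_deriv)
  have z: "\<phi> x = 0" "partial_deriv i \<phi> x = 0" if "x \<notin> K" for x
    using that using eq_0_outside_spt[of x \<phi>] by (auto simp: K_def partial_deriv_eq_0_outside_spt)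
  obtain B where B: "0 \<le> B" "\<And>x. \<bar>partial_deriv i \<phi> x\<bar> \<le> B"
    using bounded_continuous_compact_support[OF cont(2) K z(2)] by metis
  have int: "integrable lborel \<phi>"
    by (rule integrable_continuous_compact_support[OF cont(1) K z(1)])
  have [measurable]: "\<phi> \<in> borel_measurable borel" "partial_deriv i \<phi> \<in> borel_measurable borel"
    using cont by (auto intro: borel_measurable_continuous_onI)
  define h where "h k = inverse (real (Suc k))" for k
  have h: "0 < h k" "h k \<le> 1" for k by (auto simp: h_def field_simps)
  define s where "s k x = (\<phi> (h k *\<^sub>R e + x) - \<phi> x) / h k" for k x
  have der: "((\<lambda>t. \<phi> (t *\<^sub>R e + x)) has_real_derivative partial_deriv i \<phi> (t *\<^sub>R e + x)) (at t)" for t x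
  proof -
    have "((\<lambda>t. t *\<^sub>R e + x) has_derivative (\<lambda>t. t *\<^sub>R e)) (at t)"
      by (auto intro!: derivative_eq_intros)
    moreover have "(\<phi> has_derivative (\<lambda>h. gradient \<phi> (t *\<^sub>R e + x) \<bullet> h)) (at (t *\<^sub>R e + x))"
      using sm smooth_on_has_derivative by blast
    ultimately have "((\<lambda>t. \<phi> (t *\<^sub>R e + x)) has_derivative (\<lambda>s. gradient \<phi> (t *\<^sub>R e + x) \<bullet> (s *\<^sub>R e))) (at t)"
      by (rule has_derivative_compose)
    moreover have "(\<lambda>s. gradient \<phi> (t *\<^sub>R e + x) \<bullet> (s *\<^sub>R e)) = (*) (partial_deriv i \<phi> (t *\<^sub>R e + x))"
      by (rule ext) (simp add: e_def inner_axis gradient_def)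
    ultimately show ?thesis
      by (simp only: has_field_derivative_def)
  qed
  have "(\<lambda>k. LINT x|lborel. s k x) \<longlonglongrightarrow> (LINT x|lborel. partial_deriv i \<phi> x)"
  proof (rule integral_dominated_convergence)
    \<comment> \<open>The mean value theorem bounds every quotient by \<open>B\<close>, and steps of
      length at most one keep the supports in the ball of radius \<open>r + 1\<close>.\<close>
    show "integrable lborel (\<lambda>x. B * indicat_real (cball 0 (r + 1)) x :: real)"
      by (intro integrable_mult_right integrable_real_indicator) (auto simp: emeasure_lborel_cball_finite[unfolded infinity_ennreal_def])
    show "AE x in lborel. (\<lambda>k. s k x) \<longlonglongrightarrow> partial_deriv i \<phi> x"
    proof (rule AE_I2)
      fix x
      have "((\<lambda>t. (\<phi> (t *\<^sub>R e + x) - \<phi> (0 *\<^sub>R e + x)) / (t - 0)) \<longlongrightarrow> partial_deriv i \<phi> (0 *\<^sub>R e + x)) (at 0)"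
        using der[of x 0] by (simp only: has_field_derivative_iff)
      moreover have "filterlim h (at 0) sequentially"
      proof (rule filterlim_atI)
        show "h \<longlonglongrightarrow> 0"
          using LIMSEQ_inverse_real_of_nat by (simp add: h_def[abs_def])
        show "\<forall>\<^sub>F k in sequentially. h k \<noteq> 0"
          using h(1) by (intro always_eventually allI) (metis less_irrefl)
      qed
      ultimately have "(\<lambda>k. (\<phi> (h k *\<^sub>R e + x) - \<phi> (0 *\<^sub>R e + x)) / (h k - 0)) \<longlonglongrightarrow> partial_deriv i \<phi> (0 *\<^sub>R e + x)"
        by (rule filterlim_compose)
      then show "(\<lambda>k. s k x) \<longlonglongrightarrow> partial_deriv i \<phi> x"
        by (simp add: s_def)
    qed
    fix k
    show "AE x in lborel. norm (s k x) \<le> B * indicat_real (cball 0 (r + 1)) x"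
    proof (rule AE_I2)
      fix x
      show "norm (s k x) \<le> B * indicat_real (cball 0 (r + 1)) x"
      proof (cases "x \<in> cball 0 (r + 1)")
        case True
        obtain t where "\<phi> (h k *\<^sub>R e + x) - \<phi> (0 *\<^sub>R e + x) = (h k - 0) * partial_deriv i \<phi> (t *\<^sub>R e + x)"
          using MVT2[of 0 "h k" "\<lambda>t. \<phi> (t *\<^sub>R e + x)" "\<lambda>t. partial_deriv i \<phi> (t *\<^sub>R e + x)"] der h by blast
        then have "s k x = partial_deriv i \<phi> (t *\<^sub>R e + x)"
          using h[of k] by (simp add: s_def)
        then show ?thesis using True B by simp
      next
        case False
        have "norm x \<le> norm (h k *\<^sub>R e + x) + norm (h k *\<^sub>R e)"
          using norm_triangle_ineq4[of "h k *\<^sub>R e + x" "h k *\<^sub>R e"] by simp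
        then have "h k *\<^sub>R e + x \<notin> K" "x \<notin> K"
          using False r h[of k] ne by auto
        then show ?thesis using False z by (simp add: s_def)
      qed
    qed
  qed (simp_all add: s_def)
  moreover have "(LINT x|lborel. s k x) = 0" for k
  proof -
    have tr: "integrable lborel (\<lambda>x. \<phi> (h k *\<^sub>R e + x))" "(LINT x|lborel. \<phi> (h k *\<^sub>R e + x)) = (LINT x|lborel. \<phi> x)"
      using integrable_distr_eq[of "(+) (h k *\<^sub>R e)" lborel borel \<phi>] int
        integral_distr[of "(+) (h k *\<^sub>R e)" lborel borel \<phi>]
      by (simp_all add: lborel_distr_plus)
    then show ?thesis using int by (simp add: s_def)
  qed
  ultimately show ?thesis by (simp add: LIMSEQ_const_iff)
qed

section \<open>The fundamental lemma of the calculus of variations\<close>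

definition box_bump :: "nat \<Rightarrow> real^'n \<Rightarrow> real^'n \<Rightarrow> real^'n \<Rightarrow> real" where
  "box_bump k a b x = (\<Prod>i\<in>UNIV. flat (real (Suc k) * (x $ i - a $ i)) * flat (real (Suc k) * (b $ i - x $ i)))"

lemma box_bump_eq_0: "x \<notin> box a b \<Longrightarrow> box_bump k a b x = 0"
  by (auto simp: box_bump_def mem_box_cart flat_eq_0_iff mult_le_0_iff not_less)

lemma box_bump_nonneg: "0 \<le> box_bump k a b x"
  unfolding box_bump_def by (intro prod_nonneg mult_nonneg_nonneg flat_nonneg ballI)

lemma box_bump_le_1: "box_bump k a b x \<le> 1"
  unfolding box_bump_def by (intro prod_le_1 conjI mult_nonneg_nonneg mult_le_one flat_nonneg flat_le_1)

lemma box_bump_smooth_compact: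
  assumes "cbox a b \<subseteq> \<Omega>"
  shows "box_bump k a b \<in> smooth_compact \<Omega>"
proof (rule smooth_compactI[OF _ compact_cbox[of a b]])
  show "smooth_on UNIV (box_bump k a b)"
    unfolding box_bump_def
    by (intro smooth_on_prod smooth_on_mult smooth_on_compose[OF _ smooth_flat] smooth_on_const
        smooth_on_diff smooth_on_component) auto
  show "x \<in> cbox a b" if "box_bump k a b x \<noteq> 0" for x
    using that box_bump_eq_0[of x a b k] box_subset_cbox by blast
qed (fact assms)

lemma box_bump_tendsto: "(\<lambda>k. box_bump k a b x) \<longlonglongrightarrow> indicator (box a b) x"
proof -
  have "(\<lambda>k. box_bump k a b x) \<longlonglongrightarrow>
      (\<Prod>i\<in>UNIV. (if x $ i - a $ i > 0 then 1 else 0) * (if b $ i - x $ i > 0 then 1 else 0))"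
    unfolding box_bump_def by (intro tendsto_intros flat_scale_tendsto)
  moreover have "(\<Prod>i\<in>UNIV. (if x $ i - a $ i > 0 then 1 else 0) * (if b $ i - x $ i > 0 then 1 else 0))
      = indicat_real (box a b) x"
  proof (cases "x \<in> box a b")
    case True
    then show ?thesis by (auto simp: mem_box_cart intro!: prod.neutral)
  next
    case False
    then obtain i where "\<not> (a $ i < x $ i \<and> x $ i < b $ i)" by (auto simp: mem_box_cart)
    then show ?thesis using False by (auto intro!: prod_zero)
  qed
  ultimately show ?thesis by simp
qed

text \<open>The positive and the negative part of \<open>G\<close> are densities of measures that
  agree on open boxes, an intersection-stable generator. So the two parts agree almost everywhere,
  which leaves only the value zero.\<close>

lemma AE_eq_0_if_box_integrals_eq_0:
  fixes G :: "'a::euclidean_space \<Rightarrow> real"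
  assumes G: "integrable lborel G"
    and eq0: "\<And>a b. (LINT x|lborel. indicator (box a b) x * G x) = 0"
  shows "AE x in lborel. G x = 0"
proof -
  have [measurable]: "G \<in> borel_measurable borel" using G by auto
  have "density lborel (\<lambda>x. ennreal (G x)) = density lborel (\<lambda>x. ennreal (- G x))" (is "?M = ?N")
  proof (rule measure_eqI_generator_eq)
    let ?E = "range (\<lambda>(a, b). box a b) :: 'a set set"
    show "Int_stable ?E"
      by (auto simp: Int_stable_def box_Int_box)
    show "sets ?M = sigma_sets UNIV ?E" "sets ?N = sigma_sets UNIV ?E"
      by (simp_all add: borel_eq_box)
    show "emeasure ?M X = emeasure ?N X" if X: "X \<in> ?E" for X
    proof -
      from X obtain a b where ab: "X = box a b" by auto
      have int: "integrable lborel (\<lambda>x. indicator X x * G x)"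
        using integrable_mult_indicator[of "box a b" lborel G] G by (simp add: ab)
      define p where "p = (\<integral>\<^sup>+x. ennreal (indicator X x * G x) \<partial>lborel)"
      define n where "n = (\<integral>\<^sup>+x. ennreal (- (indicator X x * G x)) \<partial>lborel)"
      have "p \<noteq> \<infinity>" "n \<noteq> \<infinity>"
        using int by (simp_all add: real_integrable_def p_def n_def)
      moreover have "enn2real p - enn2real n = 0"
        using eq0[of a b] real_lebesgue_integral_def[OF int] by (simp add: p_def n_def ab)
      ultimately have "p = n"
        by (metis ennreal_enn2real_if eq_iff_diff_eq_0 infinity_ennreal_def)
      moreover have "ennreal (indicator X x * G x) = ennreal (G x) * indicator X x"
        "ennreal (- (indicator X x * G x)) = ennreal (- G x) * indicator X x" for x
        by (auto simp: indicator_def)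
      ultimately show ?thesis
        by (simp add: emeasure_density ab p_def n_def)
    qed
    show "range (\<lambda>i::nat. box (- real i *\<^sub>R One) (real i *\<^sub>R One :: 'a)) \<subseteq> ?E" by auto
    show "(\<Union>i::nat. box (- real i *\<^sub>R One) (real i *\<^sub>R One :: 'a)) = UNIV" 
      using UN_box_eq_UNIV by simp
    show "emeasure ?M (box (- real i *\<^sub>R One) (real i *\<^sub>R One)) \<noteq> \<infinity>" for i :: nat
    proof -
      have "emeasure ?M (box (- real i *\<^sub>R One) (real i *\<^sub>R One)) \<le> (\<integral>\<^sup>+x. ennreal (G x) \<partial>lborel)"
        by (auto simp: emeasure_density indicator_def intro!: nn_integral_mono)
      also have "\<dots> < \<infinity>" using G by (simp add: real_integrable_def less_top)
      finally show ?thesis by simp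
    qed
  qed auto
  then have "AE x in lborel. ennreal (G x) = ennreal (- G x)"
    by (intro sigma_finite_measure.density_unique[OF sigma_finite_lborel]) auto
  then show ?thesis
  proof eventually_elim
    case (elim x)
    then show ?case
      by (cases "G x \<ge> 0") (auto simp: ennreal_neg ennreal_eq_0_iff)
  qed
qed

text \<open>Bumps converge boundedly to indicators of boxes, so the integral of \<open>f\<close>
  over every box with closure in \<open>\<Omega>\<close> vanishes, and countably many closed boxes
  cover \<open>\<Omega>\<close>. The argument is run on a Borel representative \<open>G\<close>,
  since \<open>f\<close> is only Lebesgue measurable.\<close>

lemma AE_eq_0_if_orthogonal_to_smooth:
  fixes f :: "real^'n \<Rightarrow> real"
  assumes "open \<Omega>" and f: "integrable (lebesgue_on \<Omega>) f"
    and eq0: "\<And>\<phi>. \<phi> \<in> smooth_compact \<Omega> \<Longrightarrow> (LINT x|lebesgue_on \<Omega>. f x * \<phi> x) = 0"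
  shows "AE x in lebesgue_on \<Omega>. f x = 0"
proof -
  have \<Omega>: "\<Omega> \<in> sets lebesgue" "\<Omega> \<inter> space lebesgue \<in> sets lebesgue" using assms(1) by auto
  define F where "F x = indicator \<Omega> x * f x" for x
  have F: "integrable lebesgue F"
    using f \<Omega> unfolding F_def by (simp add: integrable_restrict_space)
  then obtain G where G[measurable]: "G \<in> borel_measurable lborel" and FG: "AE x in lborel. F x = G x"
    using completion_ex_borel_measurable_real[of F lborel] by auto
  have FG': "AE x in lebesgue. F x = G x" using FG by (rule AE_completion)
  have "integrable lebesgue G"
    using F FG' by (subst integrable_cong_AE[of _ _ F]) (auto intro: measurable_completion)
  then have Gi: "integrable lborel G" by (simp add: integrable_completion)
  have box0: "(LINT x|lborel. indicator (box a b) x * G x) = 0" if ab: "cbox a b \<subseteq> \<Omega>" for a b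
  proof -
    have meas[measurable]: "box_bump k a b \<in> borel_measurable borel" for k
      using smooth_on_continuous[OF smooth_compactD(1)[OF box_bump_smooth_compact[OF ab]]]
      by (rule borel_measurable_continuous_onI)
    have "(\<lambda>k. LINT x|lborel. box_bump k a b x * G x) \<longlonglongrightarrow> (LINT x|lborel. indicator (box a b) x * G x)"
    proof (rule integral_dominated_convergence)
      show "integrable lborel (\<lambda>x. \<bar>G x\<bar>)" using Gi by simp
      show "AE x in lborel. (\<lambda>k. box_bump k a b x * G x) \<longlonglongrightarrow> indicator (box a b) x * G x"
        by (intro AE_I2 tendsto_intros box_bump_tendsto)
      show "AE x in lborel. norm (box_bump k a b x * G x) \<le> \<bar>G x\<bar>" for k
        by (auto simp: abs_mult box_bump_nonneg box_bump_le_1 intro!: AE_I2 mult_left_le_one_le)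
    qed auto
    moreover have "(LINT x|lborel. box_bump k a b x * G x) = 0" for k
    proof -
      have "0 = (LINT x|lebesgue_on \<Omega>. f x * box_bump k a b x)"
        using eq0[OF box_bump_smooth_compact[OF ab]] by simp
      also have "\<dots> = (LINT x|lebesgue. F x * box_bump k a b x)"
        using \<Omega> by (simp add: integral_restrict_space F_def mult.assoc)
      also have "\<dots> = (LINT x|lebesgue. box_bump k a b x * G x)"
      proof (rule integral_cong_AE)
        show "(\<lambda>x. F x * box_bump k a b x) \<in> borel_measurable lebesgue"
          using borel_measurable_integrable[OF F]
          by (rule borel_measurable_times) (simp add: measurable_completion)
        show "(\<lambda>x. box_bump k a b x * G x) \<in> borel_measurable lebesgue"
          by (simp add: measurable_completion)
        show "AE x in lebesgue. F x * box_bump k a b x = box_bump k a b x * G x"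
          using FG' by eventually_elim simp
      qed
      also have "\<dots> = (LINT x|lborel. box_bump k a b x * G x)"
        by (rule integral_completion) measurable
      finally show ?thesis by simp
    qed
    ultimately show ?thesis by (simp add: LIMSEQ_const_iff)
  qed
  \<comment> \<open>Multiplying by the indicator of one box inside \<open>\<Omega>\<close> makes the
    integrals over all boxes of the space vanish, because two boxes meet in a box.\<close>
  have local0: "AE x in lborel. x \<in> cbox p q \<longrightarrow> G x = 0" if pq: "cbox p q \<subseteq> \<Omega>" for p q
  proof -
    have "AE x in lborel. indicator (box p q) x * G x = 0"
    proof (rule AE_eq_0_if_box_integrals_eq_0)
      show "integrable lborel (\<lambda>x. indicator (box p q) x * G x)"
        using integrable_mult_indicator[of "box p q" lborel G] Gi by simp
      fix a b
      obtain c d where cd: "box a b \<inter> box p q = box c d" "cbox a b \<inter> cbox p q = cbox c d"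
        by (rule that[OF box_Int_box Int_interval])
      then have "(LINT x|lborel. indicator (box c d) x * G x) = 0"
        using pq by (intro box0) blast
      then show "(LINT x|lborel. indicator (box a b) x * (indicator (box p q) x * G x)) = 0"
        by (simp add: indicator_inter_arith mult.assoc flip: cd(1))
    qed
    moreover have "AE x in lborel. x \<notin> cbox p q - box p q"
      by (intro AE_not_in) (simp add: null_sets_def emeasure_Diff emeasure_lborel_cbox_eq
         emeasure_lborel_box_eq box_subset_cbox)
    ultimately show ?thesis
      by eventually_elim (auto simp: indicator_def)
  qed
  obtain D where D: "countable D" "D \<subseteq> Pow \<Omega>" "\<And>X. X \<in> D \<Longrightarrow> \<exists>a b. X = cbox a b" "\<Union>D = \<Omega>"
    using open_countable_Union_open_cbox[OF assms(1)] by metis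
  have "AE x in lborel. \<forall>X\<in>D. x \<in> X \<longrightarrow> G x = 0"
    unfolding AE_ball_countable[OF D(1)]
  proof
    fix X assume X: "X \<in> D"
    then obtain a b where "X = cbox a b" using D(3) by blast
    then show "AE x in lborel. x \<in> X \<longrightarrow> G x = 0"
      using local0[of a b] X D(2) by auto
  qed
  then have "AE x in lborel. x \<in> \<Omega> \<longrightarrow> G x = 0"
    by eventually_elim (use D(4) in auto)
  with FG have "AE x in lborel. x \<in> \<Omega> \<longrightarrow> f x = 0"
    by eventually_elim (auto simp: F_def)
  then have "AE x in lebesgue. x \<in> \<Omega> \<longrightarrow> f x = 0"
    by (rule AE_completion)
  then show ?thesis using \<Omega> by (simp add: AE_restrict_space_iff)
qed

section \<open>Square integrable functions\<close>

lemma L2_integrable: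
  fixes f :: "'a \<Rightarrow> 'b::{banach, second_countable_topology}"
  assumes "finite_measure M" "f \<in> L2 M"
  shows "integrable M f"
proof (rule Bochner_Integration.integrable_bound)
  show "integrable M (\<lambda>x. 1 + (norm (f x))\<^sup>2)"
    using assms finite_measure.integrable_const[OF assms(1), of "1::real"]
    by (intro Bochner_Integration.integrable_add) (auto simp: L2_def)
  have "norm (f x) \<le> norm (1 + (norm (f x))\<^sup>2)" for x
    using sum_power2_ge_zero[of "norm (f x) - 1" 0] norm_ge_zero[of "f x"]
    by (simp add: power2_eq_square algebra_simps) (smt (verit) zero_le_square)
  then show "AE x in M. norm (f x) \<le> norm (1 + (norm (f x))\<^sup>2)" by simp
qed (use assms in \<open>simp add: L2_def\<close>)

lemma L2_mult_integrable:
  fixes f g :: "'a \<Rightarrow> real"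
  assumes "f \<in> L2 M" "g \<in> L2 M"
  shows "integrable M (\<lambda>x. f x * g x)"
proof (rule Bochner_Integration.integrable_bound)
  show "integrable M (\<lambda>x. (norm (f x))\<^sup>2 + (norm (g x))\<^sup>2)"
    using assms by (auto simp: L2_def)
  have "norm (f x * g x) \<le> norm ((norm (f x))\<^sup>2 + (norm (g x))\<^sup>2)" for x
  proof -
    have "2 * (\<bar>f x\<bar> * \<bar>g x\<bar>) \<le> (f x)\<^sup>2 + (g x)\<^sup>2"
      using sum_squares_bound[of "\<bar>f x\<bar>" "\<bar>g x\<bar>"] by simp
    moreover have "0 \<le> \<bar>f x\<bar> * \<bar>g x\<bar>" by simp
    ultimately have "\<bar>f x\<bar> * \<bar>g x\<bar> \<le> (f x)\<^sup>2 + (g x)\<^sup>2" by linarith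
    then show ?thesis by (simp add: abs_mult)
  qed
  then show "AE x in M. norm (f x * g x) \<le> norm ((norm (f x))\<^sup>2 + (norm (g x))\<^sup>2)" by simp
  show "(\<lambda>x. f x * g x) \<in> borel_measurable M"
    using assms by (auto simp: L2_def)
qed

text \<open>Young's inequality, from the square of the norm of
  \<open>\<delta> *\<^sub>R a - b\<close>. A small \<open>\<delta>\<close> keeps the first factor
  near one, which preserves sharp constants in the limit; \<open>\<delta> = 1\<close> serves for
  crude bounds.\<close>

lemma norm_square_add_le:
  fixes a b :: "'a::real_inner"
  assumes "\<delta> > 0"
  shows "(norm (a + b))\<^sup>2 \<le> (1 + \<delta>) * (norm a)\<^sup>2 + (1 + 1 / \<delta>) * (norm b)\<^sup>2"
proof -
  have "0 \<le> (norm (\<delta> *\<^sub>R a - b))\<^sup>2 / \<delta>" using assms by simp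
  also have "(norm (\<delta> *\<^sub>R a - b))\<^sup>2 = \<delta>\<^sup>2 * (norm a)\<^sup>2 - 2 * \<delta> * (a \<bullet> b) + (norm b)\<^sup>2"
    by (simp add: power2_norm_eq_inner inner_diff_left inner_diff_right inner_commute
        power2_eq_square[of \<delta>] algebra_simps)
  also have "\<dots> / \<delta> = \<delta> * (norm a)\<^sup>2 - 2 * (a \<bullet> b) + (norm b)\<^sup>2 / \<delta>"
    using assms by (simp add: power2_eq_square[of \<delta>] field_simps)
  finally show ?thesis
    by (simp add: power2_norm_eq_inner inner_add_left inner_add_right inner_commute algebra_simps)
qed

lemma L2_add:
  fixes f g :: "'a \<Rightarrow> 'b::{real_inner, second_countable_topology}"
  assumes "f \<in> L2 M" "g \<in> L2 M"
  shows "(\<lambda>x. f x + g x) \<in> L2 M"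
    and "\<delta> > 0 \<Longrightarrow> (LINT x|M. (norm (f x + g x))\<^sup>2)
      \<le> (1 + \<delta>) * (LINT x|M. (norm (f x))\<^sup>2) + (1 + 1 / \<delta>) * (LINT x|M. (norm (g x))\<^sup>2)"
proof -
  have [measurable]: "f \<in> borel_measurable M" "g \<in> borel_measurable M"
    and int: "integrable M (\<lambda>x. (norm (f x))\<^sup>2)" "integrable M (\<lambda>x. (norm (g x))\<^sup>2)"
    using assms by (auto simp: L2_def)
  have int': "integrable M (\<lambda>x. (norm (f x + g x))\<^sup>2)"
  proof (rule Bochner_Integration.integrable_bound)
    show "integrable M (\<lambda>x. (1 + 1) * (norm (f x))\<^sup>2 + (1 + 1 / 1) * (norm (g x))\<^sup>2)"
      using int by simp
    show "AE x in M. norm ((norm (f x + g x))\<^sup>2)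
        \<le> norm ((1 + 1) * (norm (f x))\<^sup>2 + (1 + 1 / 1) * (norm (g x))\<^sup>2)"
      using norm_square_add_le[of 1] by (intro AE_I2) simp
  qed simp
  then show "(\<lambda>x. f x + g x) \<in> L2 M" by (simp add: L2_def)
  assume "\<delta> > 0"
  have "(LINT x|M. (norm (f x + g x))\<^sup>2)
      \<le> (LINT x|M. (1 + \<delta>) * (norm (f x))\<^sup>2 + (1 + 1 / \<delta>) * (norm (g x))\<^sup>2)"
    using int int' norm_square_add_le[OF \<open>\<delta> > 0\<close>] by (intro integral_mono) auto
  also have "\<dots> = (1 + \<delta>) * (LINT x|M. (norm (f x))\<^sup>2) + (1 + 1 / \<delta>) * (LINT x|M. (norm (g x))\<^sup>2)"
    using int by simp
  finally show "(LINT x|M. (norm (f x + g x))\<^sup>2)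
      \<le> (1 + \<delta>) * (LINT x|M. (norm (f x))\<^sup>2) + (1 + 1 / \<delta>) * (LINT x|M. (norm (g x))\<^sup>2)" .
qed

lemma L2_diff:
  fixes f g :: "'a \<Rightarrow> 'b::{real_inner, second_countable_topology}"
  assumes "f \<in> L2 M" "g \<in> L2 M"
  shows "(\<lambda>x. f x - g x) \<in> L2 M"
proof -
  have "(\<lambda>x. - g x) \<in> L2 M" using assms(2) by (simp add: L2_def)
  from L2_add(1)[OF assms(1) this] show ?thesis by simp
qed

lemma L2_component:
  fixes g :: "'a \<Rightarrow> real^'n" and i :: 'n
  assumes "g \<in> L2 M"
  shows "(\<lambda>x. g x $ i) \<in> L2 M"
proof -
  have [measurable]: "(\<lambda>x. g x $ i) \<in> borel_measurable M"
    using assms by (auto simp: L2_def intro!: borel_measurable_continuous_on[of "\<lambda>v. v $ i"] continuous_intros)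
  have "integrable M (\<lambda>x. (norm (g x $ i))\<^sup>2)"
  proof (rule Bochner_Integration.integrable_bound)
    show "integrable M (\<lambda>x. (norm (g x))\<^sup>2)" using assms by (simp add: L2_def)
    show "AE x in M. norm ((norm (g x $ i))\<^sup>2) \<le> norm ((norm (g x))\<^sup>2)"
      using power_mono[OF component_le_norm_cart[of "g _" i] abs_ge_zero, where n = 2] by (intro AE_I2) auto
  qed measurable
  then show ?thesis by (simp add: L2_def)
qed

lemma finite_measure_lebesgue_on_bounded:
  fixes \<Omega> :: "'a::euclidean_space set"
  shows "open \<Omega> \<Longrightarrow> bounded \<Omega> \<Longrightarrow> finite_measure (lebesgue_on \<Omega>)"
  by (intro finite_measure_lebesgue_on lmeasurable_open)

lemma L2_lebesgue_on_continuous_compact_support: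
  fixes g :: "'a::euclidean_space \<Rightarrow> 'b::euclidean_space"
  assumes "continuous_on UNIV g" "compact K" "\<And>x. x \<notin> K \<Longrightarrow> g x = 0" "open \<Omega>"
  shows "g \<in> L2 (lebesgue_on \<Omega>)"
proof -
  have meas: "g \<in> borel_measurable lborel"
    using assms(1) by (simp add: borel_measurable_continuous_onI)
  have "integrable lborel (\<lambda>x. (norm (g x))\<^sup>2)"
    using assms by (intro integrable_continuous_compact_support[of _ K]) (auto intro!: continuous_intros)
  then have "integrable lebesgue (\<lambda>x. (norm (g x))\<^sup>2)"
    by (subst integrable_completion) auto
  then have "integrable (lebesgue_on \<Omega>) (\<lambda>x. (norm (g x))\<^sup>2)"
    using assms(4) integrable_mult_indicator[of \<Omega> lebesgue "\<lambda>x. (norm (g x))\<^sup>2"]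
    by (simp add: integrable_restrict_space)
  then show ?thesis
    using meas by (auto simp: L2_def intro!: measurable_restrict_space1 measurable_completion)
qed

lemma smooth_compact_L2:
  assumes "\<phi> \<in> smooth_compact U" "open \<Omega>"
  shows "\<phi> \<in> L2 (lebesgue_on \<Omega>)" "partial_deriv i \<phi> \<in> L2 (lebesgue_on \<Omega>)"
    "gradient \<phi> \<in> L2 (lebesgue_on \<Omega>)"
proof -
  note sm = smooth_compactD(1)[OF assms(1), of UNIV]
  note K = smooth_compactD(2)[OF assms(1)]
  show "\<phi> \<in> L2 (lebesgue_on \<Omega>)"
    using eq_0_outside_spt
    by (rule L2_lebesgue_on_continuous_compact_support[OF smooth_on_continuous[OF sm] K _ assms(2)])
  show "partial_deriv i \<phi> \<in> L2 (lebesgue_on \<Omega>)"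
    using partial_deriv_eq_0_outside_spt
    by (rule L2_lebesgue_on_continuous_compact_support[OF
          smooth_on_continuous[OF smooth_on_partial_deriv[OF sm]] K _ assms(2)])
  show "gradient \<phi> \<in> L2 (lebesgue_on \<Omega>)"
    by (rule L2_lebesgue_on_continuous_compact_support[OF smooth_on_continuous_gradient[OF sm] K _ assms(2)])
      (simp add: gradient_def partial_deriv_eq_0_outside_spt vec_eq_iff)
qed

text \<open>Integration by parts: the product with a test function is smooth with compact support,
  so the integral of its derivative vanishes.\<close>

lemma has_weak_gradient_smooth:
  assumes \<psi>: "smooth_on UNIV \<psi>" and "open \<Omega>"
  shows "has_weak_gradient \<Omega> \<psi> (gradient \<psi>)"
  unfolding has_weak_gradient_def
proof (intro ballI allI)
  fix \<phi> i assume \<phi>: "\<phi> \<in> smooth_compact \<Omega>"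
  note sm = smooth_compactD(1)[OF \<phi>, of UNIV]
  note K = smooth_compactD(2)[OF \<phi>]
  have \<Omega>: "\<Omega> \<inter> space lebesgue \<in> sets lebesgue" using assms(2) by auto
  have eq: "(LINT x|lebesgue_on \<Omega>. h x) = (LINT x|lborel. h x)"
    if "continuous_on UNIV h" "\<And>x. x \<notin> spt \<phi> \<Longrightarrow> h x = 0" for h :: "real^'a \<Rightarrow> real"
  proof -
    have "(\<lambda>x. indicator \<Omega> x *\<^sub>R h x) = h"
      by (rule ext) (use that(2) smooth_compactD(3)[OF \<phi>] in \<open>auto simp: indicator_def\<close>)
    then have "(LINT x|lebesgue_on \<Omega>. h x) = (LINT x|lebesgue. h x)"
      using integral_restrict_space[OF \<Omega>, of h] by simp
    also have "\<dots> = (LINT x|lborel. h x)"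
      using that(1) by (intro integral_completion) (simp add: borel_measurable_continuous_onI)
    finally show ?thesis .
  qed
  have cont: "continuous_on UNIV (\<lambda>x. \<psi> x * partial_deriv i \<phi> x)"
    "continuous_on UNIV (\<lambda>x. partial_deriv i \<psi> x * \<phi> x)"
    using \<psi> sm by (simp_all add: continuous_on_mult smooth_on_continuous smooth_on_partial_deriv)
  have z: "\<psi> x * partial_deriv i \<phi> x = 0" "partial_deriv i \<psi> x * \<phi> x = 0" if "x \<notin> spt \<phi>" for x
    using that eq_0_outside_spt[of x \<phi>] by (simp_all add: partial_deriv_eq_0_outside_spt)
  have diff: "\<psi> differentiable (at x)" "\<phi> differentiable (at x)" for x
    using \<psi> sm unfolding smooth_on_def by (metis C_k_on.simps(2) UNIV_I)+
  have "(\<lambda>x. \<psi> x * \<phi> x) \<in> smooth_compact UNIV"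
    using smooth_compact_mult[OF \<psi> \<phi>] smooth_compact_mono by blast
  then have "0 = (LINT x|lborel. partial_deriv i (\<lambda>x. \<psi> x * \<phi> x) x)"
    using integral_partial_deriv_eq_0 by metis
  also have "\<dots> = (LINT x|lborel. \<psi> x * partial_deriv i \<phi> x + partial_deriv i \<psi> x * \<phi> x)"
    using diff by (simp add: partial_deriv_mult)
  also have "\<dots> = (LINT x|lborel. \<psi> x * partial_deriv i \<phi> x) + (LINT x|lborel. partial_deriv i \<psi> x * \<phi> x)"
    using integrable_continuous_compact_support[OF cont(1) K z(1)]
      integrable_continuous_compact_support[OF cont(2) K z(2)] by simp
  also have "\<dots> = (LINT x|lebesgue_on \<Omega>. \<psi> x * partial_deriv i \<phi> x) +
      (LINT x|lebesgue_on \<Omega>. partial_deriv i \<psi> x * \<phi> x)"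
    using eq[OF cont(1) z(1)] eq[OF cont(2) z(2)] by simp
  finally show "(LINT x|lebesgue_on \<Omega>. \<psi> x * partial_deriv i \<phi> x) =
      - (LINT x|lebesgue_on \<Omega>. gradient \<psi> x $ i * \<phi> x)"
    by (simp add: gradient_def)
qed

section \<open>Uniqueness of weak gradients and the Dirichlet energy\<close>

lemma weak_gradient_unique:
  assumes "open \<Omega>" "bounded \<Omega>"
    and "g \<in> L2 (lebesgue_on \<Omega>)" "h \<in> L2 (lebesgue_on \<Omega>)"
    and "has_weak_gradient \<Omega> u g" "has_weak_gradient \<Omega> u h"
  shows "AE x in lebesgue_on \<Omega>. g x = h x"
proof -
  have "AE x in lebesgue_on \<Omega>. g x $ i - h x $ i = 0" for i
  proof (rule AE_eq_0_if_orthogonal_to_smooth[OF assms(1)])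
    show "integrable (lebesgue_on \<Omega>) (\<lambda>x. g x $ i - h x $ i)"
      by (intro L2_integrable L2_diff L2_component finite_measure_lebesgue_on_bounded assms)
    fix \<phi> :: "real^'a \<Rightarrow> real" assume \<phi>: "\<phi> \<in> smooth_compact \<Omega>"
    then have "integrable (lebesgue_on \<Omega>) (\<lambda>x. g x $ i * \<phi> x)" "integrable (lebesgue_on \<Omega>) (\<lambda>x. h x $ i * \<phi> x)"
      using assms by (auto intro!: L2_mult_integrable L2_component smooth_compact_L2)
    moreover have "(LINT x|lebesgue_on \<Omega>. g x $ i * \<phi> x) = (LINT x|lebesgue_on \<Omega>. h x $ i * \<phi> x)"
      using assms(5,6) \<phi> unfolding has_weak_gradient_def by fastforce
    ultimately show "(LINT x|lebesgue_on \<Omega>. (g x $ i - h x $ i) * \<phi> x) = 0"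
      by (simp add: left_diff_distrib)
  qed
  then have "AE x in lebesgue_on \<Omega>. \<forall>i. g x $ i - h x $ i = 0"
    by (rule eventually_all_finite)
  then show ?thesis by eventually_elim (simp add: vec_eq_iff)
qed

text \<open>\<open>weak_gradient\<close> is a mere choice; uniqueness makes the energy computable
  from any admissible gradient.\<close>

lemma dirichlet_energy_eq:
  assumes "open \<Omega>" "bounded \<Omega>" "g \<in> L2 (lebesgue_on \<Omega>)" "has_weak_gradient \<Omega> u g"
  shows "dirichlet_energy \<Omega> u = (LINT x|lebesgue_on \<Omega>. (norm (g x))\<^sup>2)"
proof -
  have w: "weak_gradient \<Omega> u \<in> L2 (lebesgue_on \<Omega>) \<and> has_weak_gradient \<Omega> u (weak_gradient \<Omega> u)"
    unfolding weak_gradient_def by (rule someI[of _ g]) (use assms in auto)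
  then have "AE x in lebesgue_on \<Omega>. weak_gradient \<Omega> u x = g x"
    using assms by (intro weak_gradient_unique[of \<Omega>]) auto
  moreover have "weak_gradient \<Omega> u \<in> borel_measurable (lebesgue_on \<Omega>)" "g \<in> borel_measurable (lebesgue_on \<Omega>)"
    using w assms by (auto simp: L2_def)
  ultimately show ?thesis
    unfolding dirichlet_energy_def by (intro integral_cong_AE) auto
qed

lemma H1_weak_gradient:
  assumes "u \<in> H1 \<Omega>"
  shows "u \<in> L2 (lebesgue_on \<Omega>)" "weak_gradient \<Omega> u \<in> L2 (lebesgue_on \<Omega>)"
    "has_weak_gradient \<Omega> u (weak_gradient \<Omega> u)"
proof -
  obtain g where g: "g \<in> L2 (lebesgue_on \<Omega>) \<and> has_weak_gradient \<Omega> u g"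
    using assms by (auto simp: H1_def)
  show "weak_gradient \<Omega> u \<in> L2 (lebesgue_on \<Omega>)" "has_weak_gradient \<Omega> u (weak_gradient \<Omega> u)"
    using someI[of "\<lambda>g. g \<in> L2 (lebesgue_on \<Omega>) \<and> has_weak_gradient \<Omega> u g", OF g]
    by (auto simp: weak_gradient_def)
qed (use assms in \<open>simp add: H1_def\<close>)

lemma has_weak_gradient_diff:
  assumes "open \<Omega>"
    and "u \<in> L2 (lebesgue_on \<Omega>)" "v \<in> L2 (lebesgue_on \<Omega>)"
    and "g \<in> L2 (lebesgue_on \<Omega>)" "h \<in> L2 (lebesgue_on \<Omega>)"
    and "has_weak_gradient \<Omega> u g" "has_weak_gradient \<Omega> v h"
  shows "has_weak_gradient \<Omega> (\<lambda>x. u x - v x) (\<lambda>x. g x - h x)"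
  unfolding has_weak_gradient_def
proof (intro ballI allI)
  fix \<phi> :: "real^'a \<Rightarrow> real" and i assume \<phi>: "\<phi> \<in> smooth_compact \<Omega>"
  have "integrable (lebesgue_on \<Omega>) (\<lambda>x. u x * partial_deriv i \<phi> x)"
    "integrable (lebesgue_on \<Omega>) (\<lambda>x. v x * partial_deriv i \<phi> x)"
    "integrable (lebesgue_on \<Omega>) (\<lambda>x. g x $ i * \<phi> x)" "integrable (lebesgue_on \<Omega>) (\<lambda>x. h x $ i * \<phi> x)"
    using assms \<phi> by (auto intro!: L2_mult_integrable L2_component smooth_compact_L2)
  moreover have "(LINT x|lebesgue_on \<Omega>. u x * partial_deriv i \<phi> x) = - (LINT x|lebesgue_on \<Omega>. g x $ i * \<phi> x)"
    "(LINT x|lebesgue_on \<Omega>. v x * partial_deriv i \<phi> x) = - (LINT x|lebesgue_on \<Omega>. h x $ i * \<phi> x)"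
    using assms(6,7) \<phi> unfolding has_weak_gradient_def by blast+
  ultimately show "(LINT x|lebesgue_on \<Omega>. (u x - v x) * partial_deriv i \<phi> x) =
      - (LINT x|lebesgue_on \<Omega>. (g x - h x) $ i * \<phi> x)"
    by (simp add: left_diff_distrib)
qed

section \<open>Smooth approximation in the Sobolev norm\<close>

lemma smooth_compact_H1:
  assumes "open \<Omega>" "bounded \<Omega>" "\<phi> \<in> smooth_compact U"
  shows "\<phi> \<in> H1 \<Omega>"
    "dirichlet_energy \<Omega> \<phi> = (LINT x|lebesgue_on \<Omega>. (norm (gradient \<phi> x))\<^sup>2)"
proof -
  have "has_weak_gradient \<Omega> \<phi> (gradient \<phi>)"
    by (rule has_weak_gradient_smooth[OF smooth_compactD(1)[OF assms(3)] assms(1)])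
  then show "\<phi> \<in> H1 \<Omega>"
    "dirichlet_energy \<Omega> \<phi> = (LINT x|lebesgue_on \<Omega>. (norm (gradient \<phi> x))\<^sup>2)"
    using smooth_compact_L2[OF assms(3,1)] dirichlet_energy_eq[OF assms(1,2)] by (auto simp: H1_def)
qed

lemma H1_norm_nonneg: "0 \<le> H1_norm \<Omega> u"
  by (simp add: H1_norm_def dirichlet_energy_def)

lemma H1_norm_diff_smooth:
  assumes "open \<Omega>" "bounded \<Omega>" "v \<in> H1 \<Omega>" "\<phi> \<in> smooth_compact U"
  shows "dirichlet_energy \<Omega> (\<lambda>x. v x - \<phi> x) =
      (LINT x|lebesgue_on \<Omega>. (norm (weak_gradient \<Omega> v x - gradient \<phi> x))\<^sup>2)"
    and "(H1_norm \<Omega> (\<lambda>x. v x - \<phi> x))\<^sup>2 = (LINT x|lebesgue_on \<Omega>. (norm (v x - \<phi> x))\<^sup>2) +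
      (LINT x|lebesgue_on \<Omega>. (norm (weak_gradient \<Omega> v x - gradient \<phi> x))\<^sup>2)"
proof -
  note \<phi> = smooth_compact_L2[OF assms(4,1)] has_weak_gradient_smooth[OF smooth_compactD(1)[OF assms(4)] assms(1)]
  show *: "dirichlet_energy \<Omega> (\<lambda>x. v x - \<phi> x) =
      (LINT x|lebesgue_on \<Omega>. (norm (weak_gradient \<Omega> v x - gradient \<phi> x))\<^sup>2)"
    using assms \<phi> H1_weak_gradient[OF assms(3)]
    by (intro dirichlet_energy_eq has_weak_gradient_diff L2_diff) auto
  show "(H1_norm \<Omega> (\<lambda>x. v x - \<phi> x))\<^sup>2 = (LINT x|lebesgue_on \<Omega>. (norm (v x - \<phi> x))\<^sup>2) +
      (LINT x|lebesgue_on \<Omega>. (norm (weak_gradient \<Omega> v x - gradient \<phi> x))\<^sup>2)"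
    unfolding H1_norm_def * by simp
qed

text \<open>As \<open>\<delta>\<close> may be arbitrarily small, passing from \<open>v\<close> to an
  approximation does not spoil a sharp constant.\<close>

lemma dirichlet_energy_smooth_le:
  assumes "open \<Omega>" "bounded \<Omega>" "v \<in> H1 \<Omega>" "\<phi> \<in> smooth_compact U" "\<delta> > 0"
  shows "dirichlet_energy \<Omega> \<phi>
      \<le> (1 + \<delta>) * dirichlet_energy \<Omega> v + (1 + 1 / \<delta>) * (H1_norm \<Omega> (\<lambda>x. v x - \<phi> x))\<^sup>2"
proof -
  let ?D = "\<lambda>x. gradient \<phi> x - weak_gradient \<Omega> v x"
  have L: "weak_gradient \<Omega> v \<in> L2 (lebesgue_on \<Omega>)" "gradient \<phi> \<in> L2 (lebesgue_on \<Omega>)"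
    using H1_weak_gradient[OF assms(3)] smooth_compact_L2[OF assms(4,1)] by auto
  have "dirichlet_energy \<Omega> \<phi> = (LINT x|lebesgue_on \<Omega>. (norm (weak_gradient \<Omega> v x + ?D x))\<^sup>2)"
    using smooth_compact_H1[OF assms(1,2,4)] by simp
  also have "\<dots> \<le> (1 + \<delta>) * (LINT x|lebesgue_on \<Omega>. (norm (weak_gradient \<Omega> v x))\<^sup>2)
      + (1 + 1 / \<delta>) * (LINT x|lebesgue_on \<Omega>. (norm (?D x))\<^sup>2)"
    using L assms(5) by (intro L2_add(2) L2_diff)
  also have "(LINT x|lebesgue_on \<Omega>. (norm (?D x))\<^sup>2) \<le> (H1_norm \<Omega> (\<lambda>x. v x - \<phi> x))\<^sup>2"
    using H1_norm_diff_smooth(2)[OF assms(1-4)] by (simp add: norm_minus_commute)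
  finally show ?thesis
    using assms(5) by (simp add: dirichlet_energy_def mult_left_mono)
qed

text \<open>Two approximations of the same \<open>v\<close> are close to each other. The left side
  involves smooth functions only, so that a trace inequality for smooth functions can be applied to
  their difference.\<close>

lemma H1_norm_smooth_diff_le:
  assumes "open \<Omega>" "bounded \<Omega>" "v \<in> H1 \<Omega>" "\<phi> \<in> smooth_compact UNIV" "\<psi> \<in> smooth_compact UNIV"
  shows "(LINT x|lebesgue_on \<Omega>. (\<phi> x - \<psi> x)\<^sup>2) +
      (LINT x|lebesgue_on \<Omega>. (norm (gradient (\<lambda>x. \<phi> x - \<psi> x) x))\<^sup>2)
    \<le> 2 * (H1_norm \<Omega> (\<lambda>x. v x - \<phi> x))\<^sup>2 + 2 * (H1_norm \<Omega> (\<lambda>x. v x - \<psi> x))\<^sup>2"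
proof -
  note \<phi> = smooth_compact_L2[OF assms(4,1)]
  note \<psi> = smooth_compact_L2[OF assms(5,1)]
  note v = H1_weak_gradient[OF assms(3)]
  have grad: "gradient (\<lambda>x. \<phi> x - \<psi> x) x = gradient \<phi> x - gradient \<psi> x" for x
    using smooth_compact_differentiable[OF assms(4)] smooth_compact_differentiable[OF assms(5)]
    by (simp add: gradient_def vec_eq_iff partial_deriv_diff)
  have "(LINT x|lebesgue_on \<Omega>. (norm ((v x - \<psi> x) + (\<phi> x - v x)))\<^sup>2)
      \<le> (1 + 1) * (LINT x|lebesgue_on \<Omega>. (norm (v x - \<psi> x))\<^sup>2) + (1 + 1 / 1) * (LINT x|lebesgue_on \<Omega>. (norm (\<phi> x - v x))\<^sup>2)"
    using \<phi> \<psi> v by (intro L2_add(2) L2_diff) auto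
  moreover have "(LINT x|lebesgue_on \<Omega>. (norm ((weak_gradient \<Omega> v x - gradient \<psi> x) + (gradient \<phi> x - weak_gradient \<Omega> v x)))\<^sup>2)
      \<le> (1 + 1) * (LINT x|lebesgue_on \<Omega>. (norm (weak_gradient \<Omega> v x - gradient \<psi> x))\<^sup>2)
       + (1 + 1 / 1) * (LINT x|lebesgue_on \<Omega>. (norm (gradient \<phi> x - weak_gradient \<Omega> v x))\<^sup>2)"
    using \<phi> \<psi> v by (intro L2_add(2) L2_diff) auto
  ultimately show ?thesis
    unfolding H1_norm_diff_smooth(2)[OF assms(1-4)] H1_norm_diff_smooth(2)[OF assms(1-3,5)] grad
    by (simp add: norm_minus_commute abs_minus_commute)
qed

section \<open>Hausdorff measure of hypersurfaces\<close>

lemma hausdorff_content_le_cover: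
  assumes "A \<subseteq> (\<Union>i. C i)" "\<And>i::nat. bounded (C i)" "\<And>i. diameter (C i) \<le> \<delta>"
  shows "hausdorff_content s \<delta> A \<le> (\<Sum>i. ennreal (unit_ball_vol s / 2 powr s * diameter (C i) powr s))"
  unfolding hausdorff_content_def by (rule INF_lower) (use assms in auto)

lemma hausdorff_content_mono: "A \<subseteq> B \<Longrightarrow> hausdorff_content s \<delta> A \<le> hausdorff_content s \<delta> B"
  unfolding hausdorff_content_def by (rule INF_superset_mono) auto

lemma hausdorff_outer_mono: "A \<subseteq> B \<Longrightarrow> hausdorff_outer s A \<le> hausdorff_outer s B"
  unfolding hausdorff_outer_def by (intro SUP_mono) (auto intro: hausdorff_content_mono)

lemma diameter_lipschitz_image_le:
  fixes f :: "'a::metric_space \<Rightarrow> 'b::real_normed_vector"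
  assumes lip: "\<And>x y. x \<in> A \<Longrightarrow> y \<in> A \<Longrightarrow> dist (f x) (f y) \<le> L * dist x y"
    and "0 \<le> L" "bounded C"
  shows "bounded (f ` (C \<inter> A))" "diameter (f ` (C \<inter> A)) \<le> L * diameter C"
proof -
  have d: "dist (f x) (f y) \<le> L * diameter C" if "x \<in> C \<inter> A" "y \<in> C \<inter> A" for x y
    using that lip[of x y] diameter_bounded_bound[OF assms(3), of x y] assms(2)
    by (meson IntD1 IntD2 mult_left_mono order_trans)
  then show "diameter (f ` (C \<inter> A)) \<le> L * diameter C"
    using diameter_ge_0[OF assms(3)] assms(2) by (intro diameter_le) (auto simp: dist_norm)
  show "bounded (f ` (C \<inter> A))"
  proof (cases "C \<inter> A = {}")
    case False
    then obtain z where "z \<in> C \<inter> A" by blast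
    with d show ?thesis unfolding bounded_def by blast
  qed simp
qed

text \<open>The images of a cover at scale \<open>\<delta> / L\<close> form a cover at scale
  \<open>\<delta>\<close>. Covering sets are first cut down to \<open>A\<close>, because the
  Lipschitz bound holds only there.\<close>

lemma hausdorff_outer_lipschitz_image:
  fixes f :: "'a::metric_space \<Rightarrow> 'b::real_normed_vector"
  assumes lip: "\<And>x y. x \<in> A \<Longrightarrow> y \<in> A \<Longrightarrow> dist (f x) (f y) \<le> L * dist x y"
    and "0 < L" "0 \<le> s"
  shows "hausdorff_outer s (f ` A) \<le> ennreal (L powr s) * hausdorff_outer s A"
  unfolding hausdorff_outer_def[of s "f ` A"]
proof (rule SUP_least)
  fix \<delta> :: real assume "\<delta> \<in> {0<..}"
  then have \<delta>: "\<delta> > 0" by simp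
  let ?c = "unit_ball_vol s / 2 powr s"
  have c: "0 \<le> ?c" using assms(3) by simp
  \<comment> \<open>The factor is moved to the left so that the infimum over covers stands alone on
    the right.\<close>
  have "ennreal (1 / L powr s) * hausdorff_content s \<delta> (f ` A) \<le> hausdorff_content s (\<delta> / L) A"
    unfolding hausdorff_content_def[of s "\<delta> / L"]
  proof (rule INF_greatest)
    fix C :: "nat \<Rightarrow> 'a set"
    assume "C \<in> {C. A \<subseteq> (\<Union>i. C i) \<and> (\<forall>i. bounded (C i) \<and> diameter (C i) \<le> \<delta> / L)}"
    then have C: "A \<subseteq> (\<Union>i. C i)" "\<And>i. bounded (C i)" "\<And>i. diameter (C i) \<le> \<delta> / L" by auto
    define D where "D i = f ` (C i \<inter> A)" for i
    have D: "bounded (D i)" "diameter (D i) \<le> L * diameter (C i)" for i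
      unfolding D_def using assms(2) by (auto intro!: diameter_lipschitz_image_le lip C(2))
    have "hausdorff_content s \<delta> (f ` A) \<le> (\<Sum>i. ennreal (?c * diameter (D i) powr s))"
    proof (rule hausdorff_content_le_cover)
      show "f ` A \<subseteq> (\<Union>i. D i)" using C(1) unfolding D_def by blast
      have "L * diameter (C i) \<le> \<delta>" for i using C(3)[of i] assms(2) by (simp add: field_simps)
      then show "diameter (D i) \<le> \<delta>" for i using D(2)[of i] order_trans by blast
    qed (fact D(1))
    also have "\<dots> \<le> (\<Sum>i. ennreal (L powr s) * ennreal (?c * diameter (C i) powr s))"
    proof (intro suminf_le allI)
      fix i
      have "diameter (D i) powr s \<le> (L * diameter (C i)) powr s"
        using D[of i] diameter_ge_0 assms(3) by (intro powr_mono2) auto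
      also have "\<dots> = L powr s * diameter (C i) powr s"
        using assms(2) diameter_ge_0[OF C(2)] by (simp add: powr_mult)
      finally have "?c * diameter (D i) powr s \<le> L powr s * (?c * diameter (C i) powr s)"
        using c mult_left_mono by (fastforce simp: mult_ac)
      then show "ennreal (?c * diameter (D i) powr s) \<le> ennreal (L powr s) * ennreal (?c * diameter (C i) powr s)"
        using c by (simp add: ennreal_leI flip: ennreal_mult')
    qed auto
    also have "\<dots> = ennreal (L powr s) * (\<Sum>i. ennreal (?c * diameter (C i) powr s))" by simp
    finally have "ennreal (1 / L powr s) * hausdorff_content s \<delta> (f ` A)
        \<le> ennreal (1 / L powr s) * (ennreal (L powr s) * (\<Sum>i. ennreal (?c * diameter (C i) powr s)))"
      by (rule mult_left_mono) simp
    also have "\<dots> = (\<Sum>i. ennreal (?c * diameter (C i) powr s))"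
      using assms(2) by (simp flip: mult.assoc ennreal_mult'' del: ennreal_suminf_cmult)
    finally show "ennreal (1 / L powr s) * hausdorff_content s \<delta> (f ` A)
        \<le> (\<Sum>i. ennreal (?c * diameter (C i) powr s))" .
  qed
  also have "\<dots> \<le> hausdorff_outer s A"
    unfolding hausdorff_outer_def using \<delta> assms(2) by (intro SUP_upper) simp
  finally have "ennreal (L powr s) * (ennreal (1 / L powr s) * hausdorff_content s \<delta> (f ` A))
      \<le> ennreal (L powr s) * hausdorff_outer s A"
    by (rule mult_left_mono) simp
  then show "hausdorff_content s \<delta> (f ` A) \<le> ennreal (L powr s) * hausdorff_outer s A"
    using assms(2) by (simp flip: mult.assoc ennreal_mult'')
qed

section \<open>Finite Hausdorff measure of spheres and convex boundaries\<close>

lemma power_diff_le: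
  fixes x y :: real
  assumes "0 \<le> y" "y \<le> x"
  shows "x ^ n - y ^ n \<le> real n * x ^ (n - 1) * (x - y)"
proof (cases n)
  case (Suc m)
  have "x ^ n - y ^ n = (x - y) * (\<Sum>p<Suc m. x ^ p * y ^ (m - p))"
    using power_diff_sumr2[of x n y] Suc by (simp add: mult.commute)
  also have "\<dots> \<le> (x - y) * (\<Sum>p<Suc m. x ^ m)"
  proof (intro mult_left_mono sum_mono)
    fix p assume "p \<in> {..<Suc m}"
    then have "x ^ p * y ^ (m - p) \<le> x ^ p * x ^ (m - p)"
      using assms by (intro mult_left_mono power_mono) auto
    also have "\<dots> = x ^ m" using \<open>p \<in> {..<Suc m}\<close> by (simp flip: power_add)
    finally show "x ^ p * y ^ (m - p) \<le> x ^ m" .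
  qed (use assms in auto)
  finally show ?thesis
    using Suc by (simp add: mult_ac)
qed simp

lemma emeasure_lborel_ball_neq_top: "emeasure lborel (ball c r) \<noteq> top"
  using emeasure_lborel_ball_finite[of c r] by auto

text \<open>The balls of radius \<open>\<delta> / 2\<close> about a \<open>\<delta>\<close>-separated subset of the sphere are disjoint and lie in a
  shell of width \<open>\<delta>\<close>.\<close>

lemma card_separated_subset_sphere_le:
  fixes F :: "'a::euclidean_space set"
  assumes F: "finite F" "F \<subseteq> sphere 0 R" and sep: "\<And>x y. x \<in> F \<Longrightarrow> y \<in> F \<Longrightarrow> x \<noteq> y \<Longrightarrow> \<delta> \<le> dist x y"
    and "0 < \<delta>" "\<delta> \<le> R"
  shows "real (card F) * \<delta> ^ (DIM('a) - 1) \<le> real DIM('a) * 2 ^ DIM('a) * (2 * R) ^ (DIM('a) - 1)"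
proof -
  let ?n = "DIM('a)" and ?b = "unit_ball_vol (real DIM('a))"
  have n: "\<delta> ^ ?n = \<delta> ^ (?n - 1) * \<delta>" by (metis DIM_positive Suc_diff_1 power_Suc2)
  let ?B = "\<lambda>x::'a. ball x (\<delta> / 2)"
  have disj: "disjoint_family_on ?B F"
    unfolding disjoint_family_on_def
  proof (intro ballI impI)
    fix x y assume "x \<in> F" "y \<in> F" "x \<noteq> y"
    show "?B x \<inter> ?B y = {}"
    proof (rule equals0I)
      fix z assume "z \<in> ?B x \<inter> ?B y"
      then have "dist x y < \<delta> / 2 + \<delta> / 2"
        using dist_triangle_less_add[of x z "\<delta> / 2" y "\<delta> / 2"] by (simp add: dist_commute)
      with sep[OF \<open>x \<in> F\<close> \<open>y \<in> F\<close> \<open>x \<noteq> y\<close>] show False by simp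
    qed
  qed
  have "real (card F) * (?b * (\<delta> / 2) ^ ?n) = (\<Sum>x\<in>F. measure lborel (?B x))"
    using assms by (simp add: content_ball)
  also have "\<dots> = measure lborel (\<Union>x\<in>F. ?B x)"
    using F disj by (intro measure_finite_Union[symmetric]) (auto simp: emeasure_lborel_ball_neq_top)
  also have "\<dots> \<le> measure lborel (ball 0 (R + \<delta> / 2) - ball 0 (R - \<delta> / 2) :: 'a set)"
  proof (rule measure_mono_fmeasurable)
    show "(\<Union>x\<in>F. ?B x) \<subseteq> ball 0 (R + \<delta> / 2) - ball 0 (R - \<delta> / 2)"
    proof (intro subsetI)
      fix z assume "z \<in> (\<Union>x\<in>F. ?B x)"
      then obtain x where "x \<in> F" "norm (x - z) < \<delta> / 2" by (auto simp: dist_norm)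
      moreover have "norm x = R" using F \<open>x \<in> F\<close> by auto
      ultimately show "z \<in> ball 0 (R + \<delta> / 2) - ball 0 (R - \<delta> / 2)"
        using norm_triangle_ineq2[of x z] norm_triangle_ineq3[of x z] by auto
    qed
    show "ball 0 (R + \<delta> / 2) - ball 0 (R - \<delta> / 2) \<in> fmeasurable (lborel :: 'a measure)"
      by (intro fmeasurable_Diff fmeasurableI) (auto simp: emeasure_ball emeasure_lborel_ball_finite[unfolded infinity_ennreal_def])
    show "(\<Union>x\<in>F. ?B x) \<in> sets lborel"
      using F(1) by (intro sets.finite_UN) auto
  qed
  also have "\<dots> = measure lborel (ball 0 (R + \<delta> / 2) :: 'a set) - measure lborel (ball 0 (R - \<delta> / 2) :: 'a set)"
    using assms by (intro measure_Diff) (auto simp: emeasure_lborel_ball_neq_top)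
  also have "\<dots> = ?b * ((R + \<delta> / 2) ^ ?n - (R - \<delta> / 2) ^ ?n)"
    using assms by (simp add: content_ball algebra_simps)
  also have "\<dots> \<le> ?b * (real ?n * (2 * R) ^ (?n - 1) * \<delta>)"
  proof (rule mult_left_mono)
    have "(R + \<delta> / 2) ^ ?n - (R - \<delta> / 2) ^ ?n \<le> real ?n * (R + \<delta> / 2) ^ (?n - 1) * ((R + \<delta> / 2) - (R - \<delta> / 2))"
      using assms by (intro power_diff_le) auto
    also have "\<dots> = real ?n * (R + \<delta> / 2) ^ (?n - 1) * \<delta>" by simp
    also have "\<dots> \<le> real ?n * (2 * R) ^ (?n - 1) * \<delta>"
      using assms by (intro mult_right_mono mult_left_mono power_mono) auto
    finally show "(R + \<delta> / 2) ^ ?n - (R - \<delta> / 2) ^ ?n \<le> real ?n * (2 * R) ^ (?n - 1) * \<delta>" .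
  qed simp
  finally have "?b * (real (card F) * (\<delta> / 2) ^ ?n) \<le> ?b * (real ?n * (2 * R) ^ (?n - 1) * \<delta>)"
    by (simp add: mult_ac)
  then have "real (card F) * (\<delta> / 2) ^ ?n \<le> real ?n * (2 * R) ^ (?n - 1) * \<delta>"
    by (subst (asm) mult_le_cancel_left_pos) auto
  then have "(real (card F) * \<delta> ^ (?n - 1)) * \<delta> \<le> (real ?n * 2 ^ ?n * (2 * R) ^ (?n - 1)) * \<delta>"
    by (simp add: power_divide n divide_le_eq mult_ac)
  then show ?thesis using assms(4) by (subst (asm) mult_le_cancel_right_pos) auto
qed

text \<open>A separated set of greatest cardinality is a net, since a point farther than
  \<open>\<delta>\<close> from all its elements could be added. The packing bound ensures that such
  a set exists.\<close>

lemma sphere_finite_net: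
  fixes R :: real
  assumes "0 < \<delta>" "\<delta> \<le> R"
  obtains F :: "'a::euclidean_space set" where "finite F" "sphere 0 R \<subseteq> (\<Union>x\<in>F. cball x \<delta>)"
    "real (card F) * \<delta> ^ (DIM('a) - 1) \<le> real DIM('a) * 2 ^ DIM('a) * (2 * R) ^ (DIM('a) - 1)"
proof -
  define P where "P F \<longleftrightarrow> finite F \<and> F \<subseteq> sphere (0::'a) R \<and> (\<forall>x\<in>F. \<forall>y\<in>F. x \<noteq> y \<longrightarrow> \<delta> \<le> dist x y)" for F
  define B where "B = real DIM('a) * 2 ^ DIM('a) * (2 * R) ^ (DIM('a) - 1)"
  have bound: "real (card F) * \<delta> ^ (DIM('a) - 1) \<le> B" if "P F" for F
    using that assms unfolding B_def by (intro card_separated_subset_sphere_le) (auto simp: P_def)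
  have ub: "card F \<le> nat \<lceil>B / \<delta> ^ (DIM('a) - 1)\<rceil>" if "P F" for F
  proof -
    have "real (card F) \<le> B / \<delta> ^ (DIM('a) - 1)"
      using bound[OF that] assms by (simp add: pos_le_divide_eq)
    from order_trans[OF this of_nat_ceiling] show ?thesis by (simp only: of_nat_le_iff)
  qed
  have "P {}" by (simp add: P_def)
  then have "\<exists>F. P F \<and> (\<forall>G. P G \<longrightarrow> card G \<le> card F)"
    using ub by (intro Lattices_Big.ex_has_greatest_nat[where b = "Suc (nat \<lceil>B / \<delta> ^ (DIM('a) - 1)\<rceil>)"])
      (auto simp: less_Suc_eq_le)
  then obtain F where F: "P F" "\<And>G. P G \<Longrightarrow> card G \<le> card F" by auto
  have "sphere 0 R \<subseteq> (\<Union>x\<in>F. cball x \<delta>)"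
  proof
    fix z :: 'a assume z: "z \<in> sphere 0 R"
    show "z \<in> (\<Union>x\<in>F. cball x \<delta>)"
    proof (rule ccontr)
      assume "z \<notin> (\<Union>x\<in>F. cball x \<delta>)"
      then have far: "\<And>x. x \<in> F \<Longrightarrow> \<delta> < dist x z" by auto
      then have "z \<notin> F" using assms by fastforce
      moreover have "P (insert z F)"
        unfolding P_def
      proof (intro conjI ballI impI)
        fix x y assume "x \<in> insert z F" "y \<in> insert z F" "x \<noteq> y"
        then consider "x \<in> F" "y \<in> F" | "x = z" "y \<in> F" | "x \<in> F" "y = z" by blast
        then show "\<delta> \<le> dist x y"
          using F(1) far[of x] far[of y] \<open>x \<noteq> y\<close> by cases (auto simp: P_def dist_commute)
      qed (use F(1) z in \<open>auto simp: P_def\<close>)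
      ultimately show False using F(2)[of "insert z F"] F(1) by (simp add: P_def)
    qed
  qed
  then show thesis using that F(1) bound[OF F(1)] by (auto simp: P_def B_def)
qed

lemma hausdorff_outer_sphere_finite:
  assumes "R > 0"
  shows "hausdorff_outer (real CARD('n) - 1) (sphere 0 R :: (real^'n) set) < \<infinity>"
proof -
  let ?n = "CARD('n)" and ?s = "real CARD('n) - 1"
  have n: "?n \<ge> 1" by (simp add: Suc_leI)
  then have s: "0 \<le> ?s" "?s = real (?n - 1)" by auto
  define c where "c = unit_ball_vol ?s / 2 powr ?s"
  define B where "B = real ?n * 2 ^ ?n * (2 * R) ^ (?n - 1)"
  have c: "0 \<le> c" using s(1) by (simp add: c_def)
  have "hausdorff_outer ?s (sphere 0 R :: (real^'n) set) \<le> ennreal (c * 2 powr ?s * B)"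
    unfolding hausdorff_outer_def
  proof (rule SUP_least)
    fix \<epsilon> :: real assume "\<epsilon> \<in> {0<..}"
    \<comment> \<open>A ball of radius \<open>\<delta>\<close> has diameter
      \<open>2 * \<delta>\<close>, which must not exceed \<open>\<epsilon>\<close>; the packing
      bound requires \<open>\<delta> \<le> R\<close>.\<close>
    define \<delta> where "\<delta> = min (\<epsilon> / 2) R"
    have \<delta>: "0 < \<delta>" "\<delta> \<le> R" "2 * \<delta> \<le> \<epsilon>" using \<open>\<epsilon> \<in> {0<..}\<close> assms by (auto simp: \<delta>_def)
    obtain F :: "(real^'n) set" where F: "finite F" "sphere 0 R \<subseteq> (\<Union>x\<in>F. cball x \<delta>)"
      "real (card F) * \<delta> ^ (?n - 1) \<le> B"
      using sphere_finite_net[OF \<delta>(1,2), where ?'a = "real^'n"] by (auto simp: B_def)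
    obtain h where h: "bij_betw h {0..<card F} F"
      using ex_bij_betw_nat_finite[OF F(1)] by blast
    \<comment> \<open>The finite cover is padded with empty sets, whose diameter zero contributes
      nothing to the sum.\<close>
    define C where "C i = (if i < card F then cball (h i) \<delta> else {})" for i
    have "hausdorff_content ?s \<epsilon> (sphere 0 R :: (real^'n) set) \<le> (\<Sum>i. ennreal (c * diameter (C i) powr ?s))"
      unfolding c_def
    proof (rule hausdorff_content_le_cover)
      have "(\<Union>x\<in>F. cball x \<delta>) \<subseteq> (\<Union>i. C i)"
      proof
        fix z assume "z \<in> (\<Union>x\<in>F. cball x \<delta>)"
        then obtain x where x: "x \<in> F" "z \<in> cball x \<delta>" by blast
        then obtain i where "i < card F" "h i = x"
          using h unfolding bij_betw_def by (metis atLeast0LessThan imageE lessThan_iff)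
        with x show "z \<in> (\<Union>i. C i)" by (auto simp: C_def)
      qed
      with F(2) show "sphere 0 R \<subseteq> (\<Union>i. C i)" by blast
    qed (use \<delta> in \<open>auto simp: C_def\<close>)
    also have "\<dots> = (\<Sum>i<card F. ennreal (c * diameter (C i) powr ?s))"
      by (rule suminf_finite) (auto simp: C_def)
    also have "\<dots> = ennreal (real (card F) * (c * (2 * \<delta>) powr ?s))"
      using \<delta> c by (simp add: C_def ennreal_mult ennreal_of_nat_eq_real_of_nat)
    \<comment> \<open>The number of balls is at most of the order of the inverse of
      \<open>\<delta> ^ (n - 1)\<close>, which cancels the power of the diameter.\<close>
    also have "real (card F) * (c * (2 * \<delta>) powr ?s) = c * 2 powr ?s * (real (card F) * \<delta> ^ (?n - 1))"
      using \<delta>(1) by (simp add: powr_mult mult_ac flip: powr_realpow[OF \<delta>(1)] s(2))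
    also have "\<dots> \<le> c * 2 powr ?s * B"
      using c F(3) by (intro mult_left_mono) auto
    finally show "hausdorff_content ?s \<epsilon> (sphere 0 R :: (real^'n) set) \<le> ennreal (c * 2 powr ?s * B)"
      by (simp add: ennreal_leI)
  qed
  then show ?thesis by (simp add: le_less_trans)
qed

text \<open>From a boundary point, move against the inward normal of a supporting hyperplane until
  the sphere is met: the point reached has the boundary point as its nearest point.\<close>

lemma frontier_subset_closest_point_sphere:
  fixes S :: "(real^'n) set"
  assumes "open S" "convex S" "S \<noteq> {}" "bounded S"
  obtains \<rho> where "\<rho> > 0" "frontier S \<subseteq> closest_point (closure S) ` sphere 0 \<rho>"
proof -
  obtain \<rho> where \<rho>: "\<rho> > 0" "closure S \<subseteq> cball 0 \<rho>"
    using bounded_closure[OF assms(4)] unfolding bounded_pos by (auto simp: subset_iff)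
  have "frontier S \<subseteq> closest_point (closure S) ` sphere 0 \<rho>"
  proof
    fix x assume x: "x \<in> frontier S"
    then have "x \<in> closure S" "x \<notin> S" using assms(1) by (auto simp: frontier_def interior_open)
    then obtain a where a: "a \<noteq> 0" "\<And>y. y \<in> closure S \<Longrightarrow> a \<bullet> x \<le> a \<bullet> y"
      using supporting_hyperplane_relative_frontier[OF assms(2), of x] assms(1,3)
      by (metis interior_open rel_interior_interior affine_hull_open)
    \<comment> \<open>At time \<open>T\<close> the norm is at least
      \<open>2 * \<rho> - norm x\<close>, hence at least \<open>\<rho>\<close>, while at time zero
      it is at most \<open>\<rho>\<close>.\<close>
    define T where "T = 2 * \<rho> / norm a"
    have "\<exists>t. 0 \<le> t \<and> t \<le> T \<and> norm (x - t *\<^sub>R a) = \<rho>"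
    proof (rule IVT')
      show "norm (x - 0 *\<^sub>R a) \<le> \<rho>" using \<rho>(2) \<open>x \<in> closure S\<close> by auto
      have "norm (T *\<^sub>R a) \<le> norm (x - T *\<^sub>R a) + norm x"
        by (metis norm_minus_commute norm_triangle_sub add.commute)
      moreover have "norm (T *\<^sub>R a) = 2 * \<rho>" using a(1) \<rho>(1) by (simp add: T_def)
      ultimately show "\<rho> \<le> norm (x - T *\<^sub>R a)" using \<rho>(2) \<open>x \<in> closure S\<close> by auto
      show "0 \<le> T" using \<rho> by (simp add: T_def)
    qed (intro continuous_intros)
    then obtain t where t: "0 \<le> t" "norm (x - t *\<^sub>R a) = \<rho>" by blast
    have "x = closest_point (closure S) (x - t *\<^sub>R a)"
    proof (rule closest_point_unique)
      show "\<forall>z\<in>closure S. dist (x - t *\<^sub>R a) x \<le> dist (x - t *\<^sub>R a) z"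
      proof
        fix z assume "z \<in> closure S"
        then have "0 \<le> t * (a \<bullet> (z - x))" using t(1) a(2) by (simp add: inner_diff_right)
        then have "0 \<le> (z - x) \<bullet> (t *\<^sub>R a)" by (simp add: inner_commute)
        then have "norm (t *\<^sub>R a) \<le> norm ((z - x) + t *\<^sub>R a)"
          unfolding norm_le inner_add_left inner_add_right
          using inner_ge_zero[of "z - x"] inner_commute[of "z - x" "t *\<^sub>R a"] by linarith
        then show "dist (x - t *\<^sub>R a) x \<le> dist (x - t *\<^sub>R a) z"
          by (simp add: dist_norm norm_minus_commute algebra_simps)
      qed
    qed (use assms \<open>x \<in> closure S\<close> in \<open>auto intro: convex_closure\<close>)
    with t(2) show "x \<in> closest_point (closure S) ` sphere 0 \<rho>" by auto
  qed
  with \<rho>(1) that show thesis by blast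
qed

text \<open>Projection to the nearest point of a closed convex set does not increase distances, so
  the boundary inherits finiteness from a sphere.\<close>

lemma hausdorff_outer_convex_frontier_finite:
  fixes S :: "(real^'n) set"
  assumes "open S" "convex S" "S \<noteq> {}" "bounded S"
  shows "hausdorff_outer (real CARD('n) - 1) (frontier S) < \<infinity>"
proof -
  let ?s = "real CARD('n) - 1"
  obtain \<rho> where \<rho>: "\<rho> > 0" "frontier S \<subseteq> closest_point (closure S) ` sphere 0 \<rho>"
    using frontier_subset_closest_point_sphere[OF assms] by blast
  have "hausdorff_outer ?s (frontier S) \<le> hausdorff_outer ?s (closest_point (closure S) ` sphere 0 \<rho>)"
    by (rule hausdorff_outer_mono[OF \<rho>(2)])
  also have "\<dots> \<le> ennreal (1 powr ?s) * hausdorff_outer ?s (sphere 0 \<rho> :: (real^'n) set)"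
    using assms closest_point_lipschitz[of "closure S"]
    by (intro hausdorff_outer_lipschitz_image) (auto intro: convex_closure simp: Suc_leI)
  also have "\<dots> < \<infinity>"
    using hausdorff_outer_sphere_finite[OF \<rho>(1), where ?'n = 'n] by simp
  finally show ?thesis .
qed

section \<open>Hausdorff measure on Borel sets\<close>

lemma sets_hausdorff_measure [simp, measurable_cong]: "sets (hausdorff_measure s) = sets borel"
  unfolding hausdorff_measure_def by (metis sets.sets_measure_of_eq space_borel)

lemma space_hausdorff_measure [simp]: "space (hausdorff_measure s) = UNIV"
  unfolding hausdorff_measure_def by (simp add: space_measure_of_conv)

lemma emeasure_hausdorff_measure_le: "emeasure (hausdorff_measure s) A \<le> hausdorff_outer s A"
  unfolding hausdorff_measure_def by (simp add: emeasure_measure_of_conv)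

text \<open>If \<^term>\<open>hausdorff_outer s\<close> were not countably additive on the Borel sets,
  \<^const>\<open>measure_of\<close> would return the zero measure.\<close>

lemma emeasure_hausdorff_measure:
  fixes A B :: "'a::metric_space set"
  assumes "emeasure (hausdorff_measure s) B \<noteq> 0" "A \<in> sets borel"
  shows "emeasure (hausdorff_measure s) A = hausdorff_outer s A"
proof -
  have "measure_space UNIV (sigma_sets UNIV (sets borel)) (hausdorff_outer s :: 'a set \<Rightarrow> _)"
    using assms(1) unfolding hausdorff_measure_def emeasure_measure_of_conv by metis
  then show ?thesis
    using assms(2) unfolding hausdorff_measure_def by (simp add: emeasure_measure_of_conv)
qed

section \<open>Uniformly distributed measures\<close>

text \<open>Christensen's argument: integrate the indicator of \<open>{(\<xi>, \<eta>). \<eta> \<in> K \<and> dist \<eta> \<xi> < \<epsilon>}\<close> in both orders.\<close>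

lemma uniform_measure_le:
  fixes M N :: "'a::{metric_space, second_countable_topology} measure"
  assumes "sigma_finite_measure M" "sigma_finite_measure N"
    and [measurable_cong]: "sets M = sets borel" "sets N = sets borel"
    and [measurable]: "K \<in> sets borel"
    and a: "\<And>\<eta>. \<eta> \<in> K \<Longrightarrow> a \<le> emeasure M (ball \<eta> \<epsilon>)"
    and b: "AE \<xi> in M. emeasure N (ball \<xi> \<epsilon>) \<le> b"
  shows "a * emeasure N K \<le> b * emeasure M (\<Union>\<eta>\<in>K. ball \<eta> \<epsilon>)"
proof -
  interpret M: sigma_finite_measure M by fact
  interpret N: sigma_finite_measure N by fact
  interpret pair_sigma_finite M N ..
  define f :: "'a \<Rightarrow> 'a \<Rightarrow> ennreal" where "f \<xi> \<eta> = (if dist \<eta> \<xi> < \<epsilon> \<and> \<eta> \<in> K then 1 else 0)" for \<xi> \<eta>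
  define U where "U = (\<Union>\<eta>\<in>K. ball \<eta> \<epsilon>)"
  have [measurable]: "U \<in> sets borel" by (auto simp: U_def intro!: borel_open)
  have "a * emeasure N K = (\<integral>\<^sup>+\<eta>. a * indicator K \<eta> \<partial>N)"
    by (simp add: nn_integral_cmult_indicator assms)
  also have "\<dots> \<le> (\<integral>\<^sup>+\<eta>. (\<integral>\<^sup>+\<xi>. f \<xi> \<eta> \<partial>M) \<partial>N)"
  proof (rule nn_integral_mono)
    fix \<eta>
    show "a * indicator K \<eta> \<le> (\<integral>\<^sup>+\<xi>. f \<xi> \<eta> \<partial>M)"
    proof (cases "\<eta> \<in> K")
      case True
      then have "(\<integral>\<^sup>+\<xi>. f \<xi> \<eta> \<partial>M) = (\<integral>\<^sup>+\<xi>. indicator (ball \<eta> \<epsilon>) \<xi> \<partial>M)"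
        by (intro nn_integral_cong) (auto simp: f_def indicator_def)
      also have "\<dots> = emeasure M (ball \<eta> \<epsilon>)" by (simp add: assms)
      finally show ?thesis using a[OF True] True by simp
    qed simp
  qed
  also have "\<dots> = (\<integral>\<^sup>+\<xi>. (\<integral>\<^sup>+\<eta>. f \<xi> \<eta> \<partial>N) \<partial>M)"
    unfolding f_def by (rule Fubini') measurable
  also have "\<dots> \<le> (\<integral>\<^sup>+\<xi>. b * indicator U \<xi> \<partial>M)"
  proof (rule nn_integral_mono_AE)
    show "AE \<xi> in M. (\<integral>\<^sup>+\<eta>. f \<xi> \<eta> \<partial>N) \<le> b * indicator U \<xi>"
      using b
    proof eventually_elim
      case (elim \<xi>)
      show ?case
      proof (cases "\<xi> \<in> U")
        case True
        have "(\<integral>\<^sup>+\<eta>. f \<xi> \<eta> \<partial>N) \<le> (\<integral>\<^sup>+\<eta>. indicator (ball \<xi> \<epsilon>) \<eta> \<partial>N)"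
          by (intro nn_integral_mono) (auto simp: f_def indicator_def dist_commute)
        also have "\<dots> = emeasure N (ball \<xi> \<epsilon>)" by (simp add: assms)
        finally show ?thesis using elim True by simp
      next
        case False
        then have "f \<xi> \<eta> = 0" for \<eta> by (auto simp: f_def U_def)
        then show ?thesis by simp
      qed
    qed
  qed
  also have "\<dots> = b * emeasure M U"
    by (simp add: nn_integral_cmult_indicator assms)
  finally show ?thesis by (simp add: U_def)
qed

lemma emeasure_neighbourhood_tendsto:
  fixes K :: "'a::metric_space set"
  assumes "sets M = sets borel" "closed K" "emeasure M (\<Union>\<eta>\<in>K. ball \<eta> 1) \<noteq> \<infinity>"
  shows "(\<lambda>k. emeasure M (\<Union>\<eta>\<in>K. ball \<eta> (inverse (real (Suc k))))) \<longlonglongrightarrow> emeasure M K"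
proof -
  let ?A = "\<lambda>k. \<Union>\<eta>\<in>K. ball \<eta> (inverse (real (Suc k)))"
  have op: "?A k \<in> sets M" for k using assms(1) by (auto intro!: borel_open)
  have dec: "decseq ?A"
    unfolding decseq_def by (intro allI impI UN_mono subset_ball le_imp_inverse_le) auto
  have "(\<lambda>k. emeasure M (?A k)) \<longlonglongrightarrow> emeasure M (\<Inter>k. ?A k)"
  proof (rule Lim_emeasure_decseq[OF _ dec])
    show "emeasure M (?A k) \<noteq> \<infinity>" for k
    proof -
      have "emeasure M (?A k) \<le> emeasure M (\<Union>\<eta>\<in>K. ball \<eta> 1)"
        using assms(1) by (intro emeasure_mono UN_mono subset_ball) (auto intro!: borel_open simp: field_simps)
      with assms(3) show ?thesis by (auto simp: top_unique)
    qed
  qed (use op in auto)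
  moreover have "(\<Inter>k. ?A k) = K"
  proof
    show "(\<Inter>k. ?A k) \<subseteq> K"
    proof
      fix x assume x: "x \<in> (\<Inter>k. ?A k)"
      have "\<exists>y\<in>K. dist y x < e" if e: "e > 0" for e
      proof -
        obtain k where k: "inverse (real (Suc k)) < e" using reals_Archimedean[OF e] by blast
        from x obtain y where "y \<in> K" "dist y x < inverse (real (Suc k))" by (auto simp del: of_nat_Suc)
        then show ?thesis using k by (meson less_trans)
      qed
      then have "x \<in> closure K" by (auto simp: closure_approachable)
      then show "x \<in> K" using assms(2) by simp
    qed
  qed (auto simp del: of_nat_Suc)
  ultimately show ?thesis by simp
qed

text \<open>Comparison by small balls, applied to \<open>S\<close> in both directions, shows that
  the masses of balls are in the ratio of the total masses. Applied to a closed \<open>K\<close> it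
  then gives the desired inequality up to a neighbourhood of \<open>K\<close>, which shrinks to
  \<open>K\<close>. Cross-multiplication by total masses keeps zero measures within the
  statement.\<close>

theorem uniformly_distributed_proportional:
  fixes M N :: "'a::{metric_space, second_countable_topology} measure"
  assumes fin: "finite_measure M" "finite_measure N"
    and sets: "sets M = sets borel" "sets N = sets borel"
    and S: "compact S" "AE x in M. x \<in> S" "AE x in N. x \<in> S"
    and uni: "\<And>x y \<epsilon>. x \<in> S \<Longrightarrow> y \<in> S \<Longrightarrow> 0 < \<epsilon> \<Longrightarrow> emeasure M (ball x \<epsilon>) = emeasure M (ball y \<epsilon>)"
      "\<And>x y \<epsilon>. x \<in> S \<Longrightarrow> y \<in> S \<Longrightarrow> 0 < \<epsilon> \<Longrightarrow> emeasure N (ball x \<epsilon>) = emeasure N (ball y \<epsilon>)"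
  shows "scale_measure (emeasure N UNIV) M = scale_measure (emeasure M UNIV) N"
proof -
  \<comment> \<open>Stated for an arbitrary pair of measures, to be used again with the roles
    exchanged.\<close>
  have le: "emeasure N K * emeasure M' UNIV \<le> emeasure M' K * emeasure N UNIV"
    if "closed K" "K \<subseteq> S" and fin: "finite_measure M'" "finite_measure N"
      and sets: "sets M' = sets borel" "sets N = sets borel"
      and S: "AE x in M'. x \<in> S" "AE x in N. x \<in> S"
      and uni: "\<And>x y \<epsilon>. x \<in> S \<Longrightarrow> y \<in> S \<Longrightarrow> 0 < \<epsilon> \<Longrightarrow> emeasure M' (ball x \<epsilon>) = emeasure M' (ball y \<epsilon>)"
        "\<And>x y \<epsilon>. x \<in> S \<Longrightarrow> y \<in> S \<Longrightarrow> 0 < \<epsilon> \<Longrightarrow> emeasure N (ball x \<epsilon>) = emeasure N (ball y \<epsilon>)"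
    for K and M' N :: "'a measure"
  proof (cases "emeasure N UNIV = 0 \<or> S = {}")
    case True
    have "emeasure N K \<le> emeasure N UNIV" using sets by (intro emeasure_mono) auto
    moreover have "K = {}" if "S = {}" using \<open>K \<subseteq> S\<close> that by auto
    ultimately show ?thesis using True by auto
  next
    case False
    interpret M': finite_measure M' by fact
    interpret N: finite_measure N by fact
    have space: "space M' = UNIV" "space N = UNIV"
      using sets sets_eq_imp_space_eq[of M' borel] sets_eq_imp_space_eq[of N borel] by auto
    obtain p where p: "p \<in> S" using False by auto
    have Sb: "S \<in> sets borel" "K \<in> sets borel"
      using assms(5) that(1) by (auto intro: borel_closed compact_imp_closed)
    have full: "emeasure M' S = emeasure M' UNIV" "emeasure N S = emeasure N UNIV"
      using S Sb sets space by (auto intro!: emeasure_eq_AE)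
    have key: "emeasure N K * emeasure M' UNIV \<le> emeasure M' (\<Union>\<eta>\<in>K. ball \<eta> \<epsilon>) * emeasure N UNIV"
      if \<epsilon>: "0 < \<epsilon>" for \<epsilon>
    proof -
      let ?a = "emeasure M' (ball p \<epsilon>)" and ?b = "emeasure N (ball p \<epsilon>)"
      have bounds: "?a * emeasure N A \<le> ?b * emeasure M' (\<Union>\<eta>\<in>A. ball \<eta> \<epsilon>)"
        "?b * emeasure M' A \<le> ?a * emeasure N (\<Union>\<eta>\<in>A. ball \<eta> \<epsilon>)"
        if "A \<in> sets borel" "A \<subseteq> S" for A
      proof -
        have "AE x in M'. emeasure N (ball x \<epsilon>) \<le> ?b"
          using S(1) by eventually_elim (simp add: uni(2)[OF _ p \<epsilon>])
        moreover have "AE x in N. emeasure M' (ball x \<epsilon>) \<le> ?a"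
          using S(2) by eventually_elim (simp add: uni(1)[OF _ p \<epsilon>])
        ultimately show "?a * emeasure N A \<le> ?b * emeasure M' (\<Union>\<eta>\<in>A. ball \<eta> \<epsilon>)"
          "?b * emeasure M' A \<le> ?a * emeasure N (\<Union>\<eta>\<in>A. ball \<eta> \<epsilon>)"
          using that sets uni(1)[OF p _ \<epsilon>] uni(2)[OF p _ \<epsilon>]
          by (auto intro!: uniform_measure_le M'.sigma_finite_measure_axioms N.sigma_finite_measure_axioms)
      qed
      have "?a * emeasure N UNIV \<le> ?b * emeasure M' UNIV"
        using order_trans[OF bounds(1)[OF Sb(1) order_refl] mult_left_mono[OF emeasure_mono[of _ UNIV M']]]
        using sets full by simp
      moreover have "?b * emeasure M' UNIV \<le> ?a * emeasure N UNIV"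
        using order_trans[OF bounds(2)[OF Sb(1) order_refl] mult_left_mono[OF emeasure_mono[of _ UNIV N]]]
        using sets full by simp
      ultimately have eq: "?a * emeasure N UNIV = ?b * emeasure M' UNIV" by (rule antisym)
      \<comment> \<open>Finitely many balls of equal mass cover the compact \<open>S\<close>, so
        null balls would make \<open>N\<close> vanish.\<close>
      have "?b \<noteq> 0"
      proof
        assume b: "?b = 0"
        obtain D where D: "D \<subseteq> S" "finite D" "S \<subseteq> (\<Union>x\<in>D. ball x \<epsilon>)"
          by (rule compactE_image[OF assms(5), of S "\<lambda>x. ball x \<epsilon>"]) (use \<epsilon> in auto)
        have "emeasure N S \<le> (\<Sum>x\<in>D. emeasure N (ball x \<epsilon>))"
          using D sets by (intro order_trans[OF emeasure_mono emeasure_subadditive_finite]) auto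
        also have "\<dots> = 0" using D(1) uni(2)[OF p _ \<epsilon>] b by (auto intro!: sum.neutral)
        finally show False using full False by simp
      qed
      have "?b * (emeasure N K * emeasure M' UNIV) = ?a * emeasure N K * emeasure N UNIV"
        using eq by (simp add: mult_ac)
      also have "\<dots> \<le> ?b * emeasure M' (\<Union>\<eta>\<in>K. ball \<eta> \<epsilon>) * emeasure N UNIV"
        using bounds(1)[OF Sb(2) \<open>K \<subseteq> S\<close>] by (rule mult_right_mono) simp
      finally have "?b * (emeasure N K * emeasure M' UNIV) \<le> ?b * (emeasure M' (\<Union>\<eta>\<in>K. ball \<eta> \<epsilon>) * emeasure N UNIV)"
        by (simp add: mult_ac)
      then show ?thesis
        using \<open>?b \<noteq> 0\<close> by (subst (asm) ennreal_mult_le_mult_iff) (auto simp: N.emeasure_eq_measure)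
    qed
    have "(\<lambda>k. emeasure N UNIV * emeasure M' (\<Union>\<eta>\<in>K. ball \<eta> (inverse (real (Suc k)))))
        \<longlonglongrightarrow> emeasure N UNIV * emeasure M' K"
      using sets that(1)
      by (intro ennreal_tendsto_cmult emeasure_neighbourhood_tendsto)
        (auto simp: N.emeasure_eq_measure M'.emeasure_eq_measure)
    then have "emeasure N K * emeasure M' UNIV \<le> emeasure N UNIV * emeasure M' K"
    proof (rule LIMSEQ_le_const)
      show "\<exists>n. \<forall>k\<ge>n. emeasure N K * emeasure M' UNIV
          \<le> emeasure N UNIV * emeasure M' (\<Union>\<eta>\<in>K. ball \<eta> (inverse (real (Suc k))))"
        using key by (auto simp: mult.commute[of "emeasure N UNIV"] simp del: of_nat_Suc)
    qed
    then show ?thesis by (simp add: mult.commute)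
  qed
  interpret M: finite_measure M by fact
  interpret N: finite_measure N by fact
  show ?thesis
  proof (rule measure_eqI_generator_eq)
    let ?E = "Collect closed :: 'a set set"
    show "Int_stable ?E" by (auto simp: Int_stable_def)
    show "sets (scale_measure (emeasure N UNIV) M) = sigma_sets UNIV ?E"
      "sets (scale_measure (emeasure M UNIV) N) = sigma_sets UNIV ?E"
      using sets by (simp_all add: borel_eq_closed)
    fix F assume "F \<in> ?E"
    then have F: "closed F" by simp
    have cl: "closed (F \<inter> S)" "F \<inter> S \<in> sets borel" "F \<in> sets borel"
      using F assms(5) by (auto intro: borel_closed compact_imp_closed closed_Int)
    have "emeasure M (F \<inter> S) = emeasure M F" "emeasure N (F \<inter> S) = emeasure N F"
    proof -
      have "AE x in M. x \<in> F \<inter> S \<longleftrightarrow> x \<in> F" "AE x in N. x \<in> F \<inter> S \<longleftrightarrow> x \<in> F"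
        using S(2,3) by auto
      then show "emeasure M (F \<inter> S) = emeasure M F" "emeasure N (F \<inter> S) = emeasure N F"
        using cl(2,3) sets by (auto intro: emeasure_eq_AE)
    qed
    moreover have "emeasure M (F \<inter> S) * emeasure N UNIV = emeasure N (F \<inter> S) * emeasure M UNIV"
      by (rule antisym[OF le[OF cl(1) Int_lower2 fin(2,1) sets(2,1) S(3,2) uni(2,1)]
            le[OF cl(1) Int_lower2 fin sets S(2,3) uni]])
    ultimately show "emeasure (scale_measure (emeasure N UNIV) M) F = emeasure (scale_measure (emeasure M UNIV) N) F"
      by (simp add: mult.commute)
  next
    show "range (\<lambda>i::nat. UNIV) \<subseteq> Collect (closed :: 'a set \<Rightarrow> bool)" by auto
  qed (auto simp: ennreal_mult_eq_top_iff M.emeasure_eq_measure N.emeasure_eq_measure)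
qed

section \<open>Polar coordinates\<close>

lemma sigma_sets_compact: "sigma_sets UNIV (Collect compact) = sets (borel :: 'a::euclidean_space measure)"
  unfolding borel_eq_closed
proof (subst sets_measure_of, simp, intro sigma_sets_eqI)
  fix F :: "'a set" assume F: "F \<in> Collect closed"
  have "F = (\<Union>k::nat. F \<inter> cball 0 (real k))"
    using real_arch_simple by auto
  moreover have "(\<Union>k::nat. F \<inter> cball 0 (real k)) \<in> sigma_sets UNIV (Collect compact)"
    using F by (intro sigma_sets.Union sigma_sets.Basic) (auto intro: closed_Int_compact)
  ultimately show "F \<in> sigma_sets UNIV (Collect compact)" by simp
qed (auto intro: sigma_sets.Basic compact_imp_closed)

lemma orthogonal_vimage_ball:
  fixes f :: "real^'n \<Rightarrow> real^'n"
  assumes f: "orthogonal_transformation f"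
  shows "f -` ball x \<epsilon> = ball (inv f x) \<epsilon>"
proof -
  have "dist x (f y) = dist (inv f x) y" for y
  proof -
    have "dist (f (inv f x)) (f y) = dist (inv f x) y"
      using f by (metis orthogonal_transformation_isometry)
    then show ?thesis using f by (simp add: orthogonal_transformation_surj surj_f_inv_f)
  qed
  then show ?thesis by auto
qed

lemma orthogonal_transformation_borel_measurable:
  "orthogonal_transformation (f :: real^'n \<Rightarrow> real^'n) \<Longrightarrow> f \<in> borel_measurable borel"
  by (intro borel_measurable_continuous_onI linear_continuous_on orthogonal_transformation_linear
      linear_conv_bounded_linear[THEN iffD1])

text \<open>Lebesgue measure and its image give the same mass to all balls of a given radius, so
  \<open>uniform_measure_le\<close> applies in both directions with equal factors, which
  cancel.\<close>

lemma distr_lborel_orthogonal: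
  fixes f :: "real^'n \<Rightarrow> real^'n"
  assumes f: "orthogonal_transformation f"
  shows "distr lborel borel f = lborel"
proof -
  let ?N = "distr lborel borel f"
  note [measurable] = orthogonal_transformation_borel_measurable[OF f]
  have ball: "emeasure ?N (ball x r) = emeasure lborel (ball (0::real^'n) r)"
    "emeasure lborel (ball x r) = emeasure lborel (ball (0::real^'n) r)" if "r > 0" for x r
    using that by (simp_all add: emeasure_distr orthogonal_vimage_ball[OF f] emeasure_ball)
  have sf: "sigma_finite_measure M"
    if "sets M = sets borel" "\<And>x r. r > 0 \<Longrightarrow> emeasure M (ball x r) = emeasure lborel (ball (0::real^'n) r)"
    for M :: "(real^'n) measure"
  proof
    let ?A = "range (\<lambda>n::nat. ball (0::real^'n) (real (Suc n)))"
    have "\<exists>n::nat. norm x < real (Suc n)" for x :: "real^'n"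
    proof -
      obtain n where "norm x < real n" using reals_Archimedean2 by blast
      then have "norm x < real (Suc n)" by simp
      then show ?thesis by blast
    qed
    then have "\<Union>?A = UNIV" by (auto simp del: of_nat_Suc)
    then show "\<exists>A. countable A \<and> A \<subseteq> sets M \<and> \<Union>A = space M \<and> (\<forall>a\<in>A. emeasure M a \<noteq> \<infinity>)"
      using that sets_eq_imp_space_eq[OF that(1)]
      by (intro exI[of _ ?A]) (auto simp: emeasure_lborel_ball_neq_top simp del: of_nat_Suc)
  qed
  have le: "emeasure N K \<le> emeasure M K"
    if "compact K" and sets: "sets M = sets borel" "sets N = sets borel"
      and b: "\<And>x r. r > 0 \<Longrightarrow> emeasure M (ball x r) = emeasure lborel (ball (0::real^'n) r)"
        "\<And>x r. r > 0 \<Longrightarrow> emeasure N (ball x r) = emeasure lborel (ball (0::real^'n) r)"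
    for K and M N :: "(real^'n) measure"
  proof -
    have "emeasure N K \<le> emeasure M (\<Union>\<eta>\<in>K. ball \<eta> \<epsilon>)" if \<epsilon>: "\<epsilon> > 0" for \<epsilon>
    proof -
      let ?v = "emeasure lborel (ball (0::real^'n) \<epsilon>)"
      have "?v * emeasure N K \<le> ?v * emeasure M (\<Union>\<eta>\<in>K. ball \<eta> \<epsilon>)"
        using sets b \<epsilon> \<open>compact K\<close> sf
        by (intro uniform_measure_le) (auto intro: borel_closed compact_imp_closed)
      moreover have "?v \<noteq> 0" "?v \<noteq> top"
        using \<epsilon> by (simp_all add: emeasure_ball less_imp_neq[OF unit_ball_vol_pos, symmetric])
      ultimately show ?thesis by (subst (asm) ennreal_mult_le_mult_iff) auto
    qed
    moreover have "(\<lambda>k. emeasure M (\<Union>\<eta>\<in>K. ball \<eta> (inverse (real (Suc k))))) \<longlonglongrightarrow> emeasure M K"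
    proof (rule emeasure_neighbourhood_tendsto[OF sets(1)])
      obtain r where r: "r > 0" "\<forall>x\<in>K. norm x \<le> r"
        using \<open>compact K\<close> compact_imp_bounded bounded_pos by metis
      have "(\<Union>\<eta>\<in>K. ball \<eta> 1) \<subseteq> ball 0 (r + 1)"
      proof
        fix x assume "x \<in> (\<Union>\<eta>\<in>K. ball \<eta> 1)"
        then obtain \<eta> where "\<eta> \<in> K" "norm (\<eta> - x) < 1" by (auto simp: dist_norm)
        then show "x \<in> ball 0 (r + 1)"
          using r(2) norm_triangle_sub[of x \<eta>] by (fastforce simp: norm_minus_commute)
      qed
      then have "emeasure M (\<Union>\<eta>\<in>K. ball \<eta> 1) \<le> emeasure M (ball 0 (r + 1))"
        using sets by (intro emeasure_mono) auto
      also have "\<dots> < \<infinity>" using r(1) by (simp add: b emeasure_ball)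
      finally show "emeasure M (\<Union>\<eta>\<in>K. ball \<eta> 1) \<noteq> \<infinity>" by simp
    qed (use \<open>compact K\<close> in \<open>auto intro: compact_imp_closed\<close>)
    ultimately show ?thesis
      by (intro LIMSEQ_le_const) (auto simp del: of_nat_Suc)
  qed
  show ?thesis
  proof (rule measure_eqI_generator_eq)
    let ?E = "Collect compact :: (real^'n) set set"
    show "Int_stable ?E" by (auto simp: Int_stable_def)
    show "sets ?N = sigma_sets UNIV ?E" "sets lborel = sigma_sets UNIV ?E"
      by (simp_all add: sigma_sets_compact)
    show "emeasure ?N K = emeasure lborel K" if "K \<in> ?E" for K
      using that by (intro antisym le ball) auto
    show "range (\<lambda>n::nat. cball (0::real^'n) (real n)) \<subseteq> ?E" by auto
    show "(\<Union>n::nat. cball (0::real^'n) (real n)) = UNIV"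
      using real_arch_simple by auto
    show "emeasure ?N (cball 0 (real n)) \<noteq> \<infinity>" for n
    proof -
      have "emeasure ?N (cball 0 (real n)) \<le> emeasure ?N (ball 0 (real n + 1))"
        by (intro emeasure_mono) auto
      also have "\<dots> < \<infinity>" using ball(1)[of "real n + 1" 0] by (simp add: emeasure_ball)
      finally show ?thesis by simp
    qed
  qed auto
qed

section \<open>Cone measure on the sphere\<close>

definition sphere_proj :: "real \<Rightarrow> 'a::real_normed_vector \<Rightarrow> 'a" where
  "sphere_proj R x = (R / norm x) *\<^sub>R x"

text \<open>The cone measure: a subset of the sphere gets the volume of the cone over it,
  classically surface area times \<open>R / n\<close>. The origin is removed because
  \<open>sphere_proj\<close> fixes it, off the sphere.\<close>

definition polar_measure :: "real \<Rightarrow> 'a::euclidean_space measure" where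
  "polar_measure R = distr (density lborel (indicator (cball 0 R - {0}))) borel (sphere_proj R)"

lemma norm_sphere_proj: "x \<noteq> 0 \<Longrightarrow> R \<ge> 0 \<Longrightarrow> norm (sphere_proj R x) = R"
  by (simp add: sphere_proj_def)

lemma measurable_sphere_proj [measurable]:
  "sphere_proj R \<in> borel_measurable (borel :: 'a::euclidean_space measure)"
  unfolding sphere_proj_def[abs_def] by measurable

lemma sets_polar_measure [simp, measurable_cong]: "sets (polar_measure R) = sets borel"
  by (simp add: polar_measure_def)

lemma space_polar_measure [simp]: "space (polar_measure R) = UNIV"
  by (simp add: polar_measure_def)

definition polar_cone :: "real \<Rightarrow> 'a::real_normed_vector set \<Rightarrow> real \<Rightarrow> 'a set" where
  "polar_cone R B a = {x. x \<noteq> 0 \<and> norm x \<le> a \<and> sphere_proj R x \<in> B}"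

lemma measurable_polar_cone [measurable]:
  fixes B :: "'a::euclidean_space set"
  assumes [measurable]: "B \<in> sets borel"
  shows "polar_cone R B a \<in> sets borel"
  unfolding polar_cone_def by measurable

lemma emeasure_polar_measure:
  assumes [measurable]: "B \<in> sets borel"
  shows "emeasure (polar_measure R) B = emeasure lborel (polar_cone R B R)"
proof -
  have "sphere_proj R -` B \<in> sets borel"
    by (rule measurable_sets_borel[OF measurable_sphere_proj assms])
  then have "emeasure (density lborel (indicator (cball 0 R - {0}))) (sphere_proj R -` B) =
      (\<integral>\<^sup>+x. indicator (cball 0 R - {0}) x * indicator (sphere_proj R -` B) x \<partial>lborel)"
    by (intro emeasure_density borel_measurable_indicator) auto
  then have "emeasure (polar_measure R) B = (\<integral>\<^sup>+x. indicator (cball 0 R - {0}) x * indicator (sphere_proj R -` B) x \<partial>lborel)"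
    unfolding polar_measure_def by (subst emeasure_distr) auto
  also have "\<dots> = (\<integral>\<^sup>+x. indicator (polar_cone R B R) x \<partial>lborel)"
    by (intro nn_integral_cong) (auto simp: indicator_def polar_cone_def)
  finally show ?thesis by simp
qed

lemma emeasure_polar_measure_UNIV:
  "R > 0 \<Longrightarrow> emeasure (polar_measure R :: 'a::euclidean_space measure) UNIV = ennreal (unit_ball_vol DIM('a) * R ^ DIM('a))"
proof -
  assume "R > 0"
  have "emeasure (polar_measure R :: 'a measure) UNIV = emeasure lborel (cball (0::'a) R - {0})"
    by (subst emeasure_polar_measure) (auto simp: polar_cone_def intro!: arg_cong[where f = "emeasure lborel"])
  also have "\<dots> = emeasure lborel (cball (0::'a) R)"
    by (rule emeasure_Diff_null_set) auto
  finally show ?thesis using \<open>R > 0\<close> by (simp add: emeasure_cball)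
qed

lemma finite_measure_polar_measure:
  assumes "R > 0"
  shows "finite_measure (polar_measure R :: 'a::euclidean_space measure)"
  using emeasure_polar_measure_UNIV[OF assms, where ?'a = 'a] by (intro finite_measureI) simp

lemma AE_polar_measure_sphere:
  assumes "R > 0"
  shows "AE x in (polar_measure R :: 'a::euclidean_space measure). x \<in> sphere 0 R"
proof -
  have "AE x in density lborel (indicator (cball (0::'a) R - {0})). sphere_proj R x \<in> sphere 0 R"
  proof (subst AE_density)
    show "AE x in lborel. (0::ennreal) < indicator (cball (0::'a) R - {0}) x \<longrightarrow> sphere_proj R x \<in> sphere 0 R"
    proof (intro AE_I2 impI)
      fix x :: 'a assume "0 < (indicator (cball 0 R - {0}) x :: ennreal)"
      then have "x \<noteq> 0" by (auto split: split_indicator_asm)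
      then show "sphere_proj R x \<in> sphere 0 R" using assms by (simp add: norm_sphere_proj)
    qed
  qed (auto intro!: borel_measurable_indicator)
  then show ?thesis
    unfolding polar_measure_def by (subst AE_distr_iff) auto
qed

lemma polar_cone_scale:
  assumes "R > 0" "a > 0"
  shows "polar_cone R B a = (\<lambda>x. (a / R) *\<^sub>R x + 0) ` polar_cone R B R"
proof (intro set_eqI iffI)
  have proj: "sphere_proj R (c *\<^sub>R x) = sphere_proj R x" if "c > 0" for c and x :: 'a
    using that by (simp add: sphere_proj_def)
  fix x assume x: "x \<in> polar_cone R B a"
  then have "(R / a) *\<^sub>R x \<in> polar_cone R B R"
    using assms proj[of "R / a" x] by (auto simp: polar_cone_def divide_le_eq mult_left_mono)
  then show "x \<in> (\<lambda>x. (a / R) *\<^sub>R x + 0) ` polar_cone R B R"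
    using assms by (intro image_eqI[where x = "(R / a) *\<^sub>R x"]) auto
next
  have proj: "sphere_proj R (c *\<^sub>R x) = sphere_proj R x" if "c > 0" for c and x :: 'a
    using that by (simp add: sphere_proj_def)
  fix x assume "x \<in> (\<lambda>x. (a / R) *\<^sub>R x + 0) ` polar_cone R B R"
  then show "x \<in> polar_cone R B a"
    using assms proj[of "a / R"] by (auto simp: polar_cone_def divide_le_eq mult_left_mono)
qed

lemma emeasure_polar_cone:
  fixes B :: "'a::euclidean_space set"
  assumes "R > 0" "a > 0" and [measurable]: "B \<in> sets borel"
  shows "emeasure lborel (polar_cone R B a) = ennreal ((a / R) ^ DIM('a)) * emeasure (polar_measure R) B"
proof -
  have "emeasure lborel (polar_cone R B a) = emeasure lebesgue (polar_cone R B a)"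
    by simp
  also have "\<dots> = ennreal (\<bar>a / R\<bar> ^ DIM('a)) * emeasure lebesgue (polar_cone R B R)"
    unfolding polar_cone_scale[OF assms(1,2)] by (subst emeasure_lebesgue_affine) (simp add: ennreal_power)
  finally show ?thesis using assms by (simp add: emeasure_polar_measure)
qed

text \<open>The derivative of \<open>(r / R) ^ n\<close>; the division by \<open>R ^ n\<close>
  compensates for the total mass of \<open>polar_measure R\<close>.\<close>

definition radial_density :: "nat \<Rightarrow> real \<Rightarrow> real \<Rightarrow> real" where
  "radial_density n R r = (if 0 < r then real n * r ^ (n - 1) / R ^ n else 0)"

lemma measurable_radial_density [measurable]: "radial_density n R \<in> borel_measurable borel"
  unfolding radial_density_def[abs_def] by measurable

lemma nn_integral_radial_density:
  assumes "R > 0" "a > 0" "n > 0"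
  shows "(\<integral>\<^sup>+r. ennreal (radial_density n R r) * indicator {..a} r \<partial>lborel) = ennreal ((a / R) ^ n)"
proof -
  have "(\<integral>\<^sup>+r. ennreal (radial_density n R r) * indicator {..a} r \<partial>lborel) =
      (\<integral>\<^sup>+r. ennreal (real n * r ^ (n - 1) / R ^ n) * indicator {0..a} r \<partial>lborel)"
  proof (rule nn_integral_cong_AE)
    show "AE r in lborel. ennreal (radial_density n R r) * indicator {..a} r =
        ennreal (real n * r ^ (n - 1) / R ^ n) * indicator {0..a} r"
      using AE_lborel_singleton[of "0::real"]
      by eventually_elim (auto simp: radial_density_def indicator_def)
  qed
  also have "\<dots> = ennreal ((a / R) ^ n - (0 / R) ^ n)"
    using assms by (intro nn_integral_FTC_Icc)
      (auto intro!: derivative_eq_intros simp: power_divide divide_simps zero_le_mult_iff)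
  finally show ?thesis using assms by simp
qed

lemma emeasure_density_radial_density:
  assumes "R > 0" "n > 0"
  shows "emeasure (density lborel (\<lambda>r. ennreal (radial_density n R r))) {..a} =
    (if a > 0 then ennreal ((a / R) ^ n) else 0)"
proof (cases "a > 0")
  case True
  then show ?thesis using nn_integral_radial_density[OF assms(1) True assms(2)]
    by (simp add: emeasure_density)
next
  case False
  then have z: "ennreal (radial_density n R r) * indicator {..a} r = 0" for r
    by (simp add: radial_density_def indicator_def)
  have "emeasure (density lborel (\<lambda>r. ennreal (radial_density n R r))) {..a} =
      (\<integral>\<^sup>+r. ennreal (radial_density n R r) * indicator {..a} r \<partial>lborel)"
    by (rule emeasure_density) auto
  with False show ?thesis unfolding z by simp
qed

lemma sigma_finite_density_radial_density:
  assumes "R > 0" "n > 0"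
  shows "sigma_finite_measure (density lborel (\<lambda>r. ennreal (radial_density n R r)))" (is "sigma_finite_measure ?M")
proof
  show "\<exists>A. countable A \<and> A \<subseteq> sets ?M \<and> \<Union> A = space ?M \<and> (\<forall>a\<in>A. emeasure ?M a \<noteq> \<infinity>)"
    using real_arch_simple
    by (intro exI[of _ "range (\<lambda>k::nat. {..real k})"]) (auto simp: emeasure_density_radial_density[OF assms])
qed

text \<open>For a fixed set \<open>B\<close> of directions both sides are measures in the radius.
  They agree on \<open>{..a}\<close>, because the cone over \<open>B\<close> up to radius
  \<open>a\<close> is the one up to radius \<open>R\<close> scaled by \<open>a / R\<close>.\<close>

lemma distr_lborel_polar:
  assumes "R > 0"
  shows "density lborel (\<lambda>r. ennreal (radial_density DIM('a) R r)) \<Otimes>\<^sub>M polar_measure R =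
    distr (lborel :: 'a::euclidean_space measure) (borel \<Otimes>\<^sub>M borel) (\<lambda>x. (norm x, sphere_proj R x))"
proof (rule pair_measure_eqI)
  let ?M = "density lborel (\<lambda>r. ennreal (radial_density DIM('a) R r))"
  interpret P: finite_measure "polar_measure R :: 'a measure"
    by (rule finite_measure_polar_measure[OF assms])
  show "sigma_finite_measure (polar_measure R :: 'a measure)"
    by (rule P.sigma_finite_measure_axioms)
  have M: "emeasure ?M {..a} = (if a > 0 then ennreal ((a / R) ^ DIM('a)) else 0)" for a
    by (rule emeasure_density_radial_density[OF assms DIM_positive])
  show "sigma_finite_measure ?M"
    by (rule sigma_finite_density_radial_density[OF assms DIM_positive])
  show "sets (?M \<Otimes>\<^sub>M polar_measure R) = sets (distr (lborel :: 'a measure) (borel \<Otimes>\<^sub>M borel) (\<lambda>x. (norm x, sphere_proj R x)))"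
    by (simp cong: sets_pair_measure_cong)
  fix A :: "real set" and B :: "'a set" assume "A \<in> sets ?M" "B \<in> sets (polar_measure R)"
  then have [measurable]: "A \<in> sets borel" "B \<in> sets borel" by auto
  let ?N = "distr (density lborel (\<lambda>x. indicator B (sphere_proj R x))) borel (norm :: 'a \<Rightarrow> real)"
  have N: "emeasure ?N X = emeasure lborel {x. norm x \<in> X \<and> sphere_proj R x \<in> B}"
    if [measurable]: "X \<in> sets borel" for X
  proof -
    have "norm -` X \<in> sets (borel :: 'a measure)"
      by (rule measurable_sets_borel[OF _ that]) measurable
    then have "emeasure ?N X = (\<integral>\<^sup>+x. indicator B (sphere_proj R x) * indicator (norm -` X) x \<partial>lborel)"
      by (subst emeasure_distr) (auto simp: emeasure_density)
    also have "\<dots> = (\<integral>\<^sup>+x. indicator {x. norm x \<in> X \<and> sphere_proj R x \<in> B} x \<partial>lborel)"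
      by (intro nn_integral_cong) (auto simp: indicator_def)
    finally show ?thesis by simp
  qed
  have "scale_measure (emeasure (polar_measure R) B) ?M = ?N"
  proof (rule measure_eqI_generator_eq)
    let ?E = "range atMost :: real set set"
    show "Int_stable ?E" by (auto simp: Int_stable_def)
    show "sets (scale_measure (emeasure (polar_measure R) B) ?M) = sigma_sets UNIV ?E" "sets ?N = sigma_sets UNIV ?E"
      by (simp_all add: borel_eq_atMost)
    show "range (\<lambda>k::nat. {..real k}) \<subseteq> ?E" by auto
    show "(\<Union>k::nat. {..real k}) = UNIV" using real_arch_simple by auto
    show "emeasure (scale_measure (emeasure (polar_measure R) B) ?M) {..real k} \<noteq> \<infinity>" for k
      by (auto simp: M ennreal_mult_eq_top_iff)
    fix X assume "X \<in> ?E"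
    then obtain a where X: "X = {..a}" by auto
    have "emeasure lborel {x. norm x \<le> a \<and> sphere_proj R x \<in> B} = emeasure lborel (polar_cone R B a)"
    proof (rule emeasure_eq_AE)
      show "AE x in lborel. x \<in> {x. norm x \<le> a \<and> sphere_proj R x \<in> B} \<longleftrightarrow> x \<in> polar_cone R B a"
        using AE_lborel_singleton[of "0::'a"] by eventually_elim (auto simp: polar_cone_def)
    qed auto
    also have "\<dots> = emeasure (polar_measure R) B * (if a > 0 then ennreal ((a / R) ^ DIM('a)) else 0)"
    proof (cases "a > 0")
      case False
      then have "polar_cone R B a = {}" by (auto simp: polar_cone_def) (smt (verit) zero_less_norm_iff)
      with False show ?thesis by simp
    qed (simp add: emeasure_polar_cone[OF assms] mult.commute)
    finally show "emeasure (scale_measure (emeasure (polar_measure R) B) ?M) X = emeasure ?N X"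
      by (simp add: X M N)
  qed auto
  then have "emeasure ?M A * emeasure (polar_measure R) B = emeasure ?N A"
    by (metis emeasure_scale_measure mult.commute)
  also have "\<dots> = emeasure (distr lborel (borel \<Otimes>\<^sub>M borel) (\<lambda>x::'a. (norm x, sphere_proj R x))) (A \<times> B)"
    by (subst N) (auto simp: emeasure_distr intro!: arg_cong[where f = "emeasure lborel"])
  finally show "emeasure ?M A * emeasure (polar_measure R) B =
      emeasure (distr lborel (borel \<Otimes>\<^sub>M borel) (\<lambda>x::'a. (norm x, sphere_proj R x))) (A \<times> B)" .
qed

theorem nn_integral_polar:
  fixes F :: "'a::euclidean_space \<Rightarrow> ennreal"
  assumes "R > 0" and [measurable]: "F \<in> borel_measurable borel"
  shows "(\<integral>\<^sup>+x. F x \<partial>lborel) =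
    (\<integral>\<^sup>+\<xi>. (\<integral>\<^sup>+r. ennreal (radial_density DIM('a) R r) * F ((r / R) *\<^sub>R \<xi>) \<partial>lborel) \<partial>polar_measure R)"
proof -
  let ?M = "density lborel (\<lambda>r. ennreal (radial_density DIM('a) R r))"
  interpret P: finite_measure "polar_measure R :: 'a measure"
    by (rule finite_measure_polar_measure[OF assms(1)])
  interpret M: sigma_finite_measure ?M
    by (rule sigma_finite_density_radial_density[OF assms(1) DIM_positive])
  interpret pair_sigma_finite ?M "polar_measure R :: 'a measure" ..
  define G :: "real \<times> 'a \<Rightarrow> ennreal" where "G p = F ((fst p / R) *\<^sub>R snd p)" for p
  have [measurable]: "G \<in> borel_measurable (borel \<Otimes>\<^sub>M borel)"
    unfolding G_def[abs_def] by measurable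
  have F: "F x = G (norm x, sphere_proj R x)" for x
    using assms(1) by (simp add: G_def sphere_proj_def)
  have "(\<integral>\<^sup>+x. F x \<partial>lborel) = (\<integral>\<^sup>+x. G (norm x, sphere_proj R x) \<partial>lborel)"
    by (simp only: F)
  also have "\<dots> = (\<integral>\<^sup>+p. G p \<partial>distr lborel (borel \<Otimes>\<^sub>M borel) (\<lambda>x. (norm x, sphere_proj R x)))"
    by (subst nn_integral_distr) auto
  also have "\<dots> = (\<integral>\<^sup>+p. G p \<partial>(?M \<Otimes>\<^sub>M polar_measure R))"
    using distr_lborel_polar[OF assms(1), where ?'a = 'a] by simp
  also have "\<dots> = (\<integral>\<^sup>+\<xi>. (\<integral>\<^sup>+r. G (r, \<xi>) \<partial>?M) \<partial>polar_measure R)"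
    by (rule nn_integral_snd[symmetric]) measurable
  also have "\<dots> = (\<integral>\<^sup>+\<xi>. (\<integral>\<^sup>+r. ennreal (radial_density DIM('a) R r) * F ((r / R) *\<^sub>R \<xi>) \<partial>lborel) \<partial>polar_measure R)"
    by (simp add: nn_integral_density G_def)
  finally show ?thesis .
qed

section \<open>Hausdorff measure on a sphere\<close>

text \<open>A density on the whole space rather than a restriction, so that the measure lives on all
  Borel sets and can be compared with \<open>polar_measure\<close>.\<close>

definition sphere_measure :: "real \<Rightarrow> (real^'n) measure" where
  "sphere_measure R = density (hausdorff_measure (real CARD('n) - 1)) (indicator (sphere 0 R))"

lemma sets_sphere_measure [simp, measurable_cong]: "sets (sphere_measure R) = sets borel"
  by (simp add: sphere_measure_def)

lemma space_sphere_measure [simp]: "space (sphere_measure R) = UNIV"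
  by (simp add: sphere_measure_def)

lemma emeasure_sphere_measure:
  assumes "A \<in> sets borel"
  shows "emeasure (sphere_measure R :: (real^'n) measure) A =
    emeasure (hausdorff_measure (real CARD('n) - 1)) (A \<inter> sphere 0 R)"
proof -
  let ?H = "hausdorff_measure (real CARD('n) - 1) :: (real^'n) measure"
  have S: "sphere 0 R \<in> sets ?H" by (simp add: borel_closed)
  have "emeasure (sphere_measure R :: (real^'n) measure) A = (\<integral>\<^sup>+x. indicator (sphere 0 R) x * indicator A x \<partial>?H)"
    using assms unfolding sphere_measure_def
    by (intro emeasure_density borel_measurable_indicator[OF S]) auto
  also have "\<dots> = (\<integral>\<^sup>+x. indicator (A \<inter> sphere 0 R) x \<partial>?H)"
    by (intro nn_integral_cong) (auto split: split_indicator)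
  finally show ?thesis using assms S by simp
qed

lemma finite_measure_sphere_measure:
  assumes "R > 0"
  shows "finite_measure (sphere_measure R :: (real^'n) measure)"
proof (rule finite_measureI)
  have "emeasure (sphere_measure R :: (real^'n) measure) UNIV \<le> hausdorff_outer (real CARD('n) - 1) (sphere (0::real^'n) R)"
    using emeasure_hausdorff_measure_le by (subst emeasure_sphere_measure) auto
  also have "\<dots> < \<infinity>" by (rule hausdorff_outer_sphere_finite[OF assms])
  finally show "emeasure (sphere_measure R :: (real^'n) measure) (space (sphere_measure R)) \<noteq> \<infinity>" by simp
qed

lemma orthogonal_transformation_norm_eq: "orthogonal_transformation f \<Longrightarrow> norm (f x) = norm x"
  by (simp add: orthogonal_transformation)

text \<open>A rotation carries any point of the sphere to any other, so balls about them have equal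
  mass under both measures. The hypothesis \<open>nz\<close> identifies Hausdorff measure with its
  outer measure, to which the Lipschitz estimate applies.\<close>

theorem sphere_measure_eq_polar_measure:
  assumes R: "R > 0"
    and nz: "emeasure (sphere_measure R :: (real^'n) measure) UNIV \<noteq> 0"
  shows "scale_measure (emeasure (polar_measure R :: (real^'n) measure) UNIV) (sphere_measure R :: (real^'n) measure) =
    scale_measure (emeasure (sphere_measure R :: (real^'n) measure) UNIV) (polar_measure R)"
proof (rule uniformly_distributed_proportional)
  let ?S = "sphere (0::real^'n) R" and ?s = "real CARD('n) - 1"
  show "AE x in sphere_measure R. x \<in> ?S"
    unfolding sphere_measure_def
    by (subst AE_density) (auto intro!: AE_I2 borel_measurable_indicator borel_closed split: split_indicator_asm)
  have le: "hausdorff_outer ?s (ball y \<epsilon> \<inter> ?S) \<le> hausdorff_outer ?s (ball x \<epsilon> \<inter> ?S)"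
    "emeasure (polar_measure R) (ball y \<epsilon>) = emeasure (polar_measure R) (ball x \<epsilon>)"
    if "x \<in> ?S" "y \<in> ?S" for x y \<epsilon>
  proof -
    obtain f where f: "orthogonal_transformation f" "f x = y"
      using orthogonal_transformation_exists[of x y] \<open>x \<in> ?S\<close> \<open>y \<in> ?S\<close> by auto
    have iso: "dist (f u) (f v) = dist u v" for u v
      using f(1) by (metis orthogonal_transformation_isometry)
    have surj: "surj f" using f(1) by (rule orthogonal_transformation_surj)
    have "ball y \<epsilon> \<inter> ?S \<subseteq> f ` (ball x \<epsilon> \<inter> ?S)"
    proof
      fix z assume z: "z \<in> ball y \<epsilon> \<inter> ?S"
      obtain u where u: "z = f u" using surj by (metis surjD)
      then have "u \<in> ball x \<epsilon> \<inter> ?S"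
        using z f iso[of x u] orthogonal_transformation_norm_eq[OF f(1), of u] by auto
      with u show "z \<in> f ` (ball x \<epsilon> \<inter> ?S)" by blast
    qed
    then have "hausdorff_outer ?s (ball y \<epsilon> \<inter> ?S) \<le> hausdorff_outer ?s (f ` (ball x \<epsilon> \<inter> ?S))"
      by (rule hausdorff_outer_mono)
    also have "\<dots> \<le> ennreal (1 powr ?s) * hausdorff_outer ?s (ball x \<epsilon> \<inter> ?S)"
      by (rule hausdorff_outer_lipschitz_image) (auto simp: iso Suc_leI)
    finally show "hausdorff_outer ?s (ball y \<epsilon> \<inter> ?S) \<le> hausdorff_outer ?s (ball x \<epsilon> \<inter> ?S)" by simp
    note [measurable] = orthogonal_transformation_borel_measurable[OF f(1)]
    have proj: "sphere_proj R (f u) = f (sphere_proj R u)" for u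
      using f(1) by (simp add: sphere_proj_def orthogonal_transformation_norm_eq
          linear_scale[OF orthogonal_transformation_linear])
    have f0: "f u = 0 \<longleftrightarrow> u = 0" for u
      using orthogonal_transformation_norm_eq[OF f(1), of u] by (metis norm_eq_zero)
    have "dist y (f u) = dist x u" for u using iso[of x u] f(2) by simp
    then have "f -` polar_cone R (ball y \<epsilon>) R = polar_cone R (ball x \<epsilon>) R"
      by (auto simp: polar_cone_def proj f0 orthogonal_transformation_norm_eq[OF f(1)])
    then have "emeasure lborel (polar_cone R (ball x \<epsilon>) R) = emeasure (distr lborel borel f) (polar_cone R (ball y \<epsilon>) R)"
      by (simp add: emeasure_distr)
    then show "emeasure (polar_measure R) (ball y \<epsilon>) = emeasure (polar_measure R) (ball x \<epsilon>)"
      by (simp add: emeasure_polar_measure distr_lborel_orthogonal[OF f(1)])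
  qed
  fix x y \<epsilon> assume xy: "x \<in> ?S" "y \<in> ?S"
  show "emeasure (polar_measure R) (ball x \<epsilon>) = emeasure (polar_measure R) (ball y \<epsilon>)"
    using le(2) xy by blast
  have "emeasure (hausdorff_measure ?s) (?S :: (real^'n) set) \<noteq> 0"
    using nz by (simp add: emeasure_sphere_measure)
  then show "emeasure (sphere_measure R) (ball x \<epsilon>) = emeasure (sphere_measure R) (ball y \<epsilon>)"
    using antisym[OF le(1)[OF xy(2,1), of \<epsilon>] le(1)[OF xy, of \<epsilon>]]
    by (simp add: emeasure_sphere_measure emeasure_hausdorff_measure borel_closed sets.Int)
qed (use R finite_measure_sphere_measure finite_measure_polar_measure AE_polar_measure_sphere in auto)

section \<open>The radial profile\<close>

text \<open>The radial harmonic function that vanishes on the inner sphere, normalised to have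
  derivative \<open>1 / r ^ (n - 1)\<close>.\<close>

definition radial_profile :: "nat \<Rightarrow> real \<Rightarrow> real \<Rightarrow> real" where
  "radial_profile n R1 r =
     (if n = 2 then ln r - ln R1
      else (R1 powr (2 - real n) - r powr (2 - real n)) / (real n - 2))"

lemma radial_profile_self [simp]: "radial_profile n R1 R1 = 0"
  by (simp add: radial_profile_def)

lemma has_real_derivative_radial_profile:
  assumes "n \<ge> 2" "r > 0"
  shows "(radial_profile n R1 has_real_derivative 1 / r ^ (n - 1)) (at r)"
proof (cases "n = 2")
  case True
  then have "radial_profile n R1 = (\<lambda>r. ln r - ln R1)"
    by (auto simp: radial_profile_def)
  then show ?thesis
    using assms True by (auto intro!: derivative_eq_intros)
next
  case False
  then have eq: "radial_profile n R1 = (\<lambda>r. (R1 powr (2 - real n) - r powr (2 - real n)) / (real n - 2))"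
    by (auto simp: radial_profile_def)
  have n: "real n - 2 > 0" using assms(1) False by simp
  have "1 - real n = - real (n - 1)" using assms(1) by (simp add: of_nat_diff)
  then have p: "r powr (1 - real n) = 1 / r ^ (n - 1)"
    by (simp only: powr_minus powr_realpow[OF assms(2)] inverse_eq_divide)
  have "((\<lambda>r. (R1 powr (2 - real n) - r powr (2 - real n)) / (real n - 2)) has_real_derivative
      (0 - (2 - real n) * r powr (2 - real n - 1)) / (real n - 2)) (at r)"
    using assms by (intro DERIV_cdivide DERIV_diff DERIV_const has_real_derivative_powr)
  moreover have "(0 - (2 - real n) * r powr (2 - real n - 1)) / (real n - 2) = r powr (1 - real n)"
    using n by (simp add: field_simps)
  ultimately show ?thesis by (simp only: eq p)
qed

lemma radial_profile_strict_mono: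
  assumes "n \<ge> 2" "0 < a" "a < b"
  shows "radial_profile n R1 a < radial_profile n R1 b"
proof (rule DERIV_pos_imp_increasing[of a b "radial_profile n R1"])
  fix x assume "a \<le> x" "x \<le> b"
  then show "\<exists>y::real. (radial_profile n R1 has_real_derivative y) (at x) \<and> y > 0"
    using assms has_real_derivative_radial_profile[of n x R1]
    by (intro exI[of _ "1 / x ^ (n - 1)"]) auto
qed fact

lemma radial_profile_pos: "n \<ge> 2 \<Longrightarrow> 0 < R1 \<Longrightarrow> R1 < r \<Longrightarrow> 0 < radial_profile n R1 r"
  using radial_profile_strict_mono[of n R1 r R1] by simp

section \<open>The Steklov-Dirichlet quotient on the shell\<close>

text \<open>Equality holds for multiples of the profile: expand
  \<open>0 \<le> (g' r * r ^ (n - 1) - a)\<^sup>2 / r ^ (n - 1)\<close> with \<open>a = g R2 / W R2\<close> and integrate.\<close>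

lemma radial_steklov_inequality:
  assumes n: "n \<ge> 2" and R: "0 < R1" "R1 < R2"
    and g: "\<And>r. r \<in> {R1..R2} \<Longrightarrow> (g has_real_derivative g' r) (at r)" "continuous_on {R1..R2} g'" "g R1 = 0"
  shows "ennreal ((g R2)\<^sup>2 / radial_profile n R1 R2)
    \<le> (\<integral>\<^sup>+r. ennreal ((g' r)\<^sup>2 * r ^ (n - 1)) * indicator {R1..R2} r \<partial>lborel)"
proof -
  define W where "W = radial_profile n R1"
  have W: "W R2 > 0" using radial_profile_pos[OF n R] by (simp add: W_def)
  define a where "a = g R2 / W R2"
  define h' where "h' r = 2 * a * g' r - a\<^sup>2 * (1 / r ^ (n - 1))" for r
  define f where "f r = (g' r)\<^sup>2 * r ^ (n - 1)" for r
  have "continuous_on {R1..R2} f"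
    unfolding f_def[abs_def] by (intro continuous_intros g(2))
  then have f: "(f has_integral integral {R1..R2} f) {R1..R2}"
    by (intro integrable_integral integrable_continuous_real)
  have "(h' has_integral (2 * a * g R2 - a\<^sup>2 * W R2) - (2 * a * g R1 - a\<^sup>2 * W R1)) {R1..R2}"
  proof (rule fundamental_theorem_of_calculus)
    fix r assume r: "r \<in> {R1..R2}"
    have "((\<lambda>r. 2 * a * g r - a\<^sup>2 * W r) has_real_derivative h' r) (at r)"
      unfolding h'_def W_def
      using r R by (intro DERIV_diff DERIV_cmult g(1) has_real_derivative_radial_profile n) auto
    then show "((\<lambda>r. 2 * a * g r - a\<^sup>2 * W r) has_vector_derivative h' r) (at r within {R1..R2})"
      by (simp add: has_real_derivative_iff_has_vector_derivative has_vector_derivative_at_within)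
  qed (use R in simp)
  then have "(2 * a * g R2 - a\<^sup>2 * W R2) - (2 * a * g R1 - a\<^sup>2 * W R1) \<le> integral {R1..R2} f"
  proof (rule has_integral_le[OF _ f])
    fix r assume "r \<in> {R1..R2}"
    then have "r ^ (n - 1) > 0" using R by simp
    have "0 \<le> (x * p - a)\<^sup>2 / p" "(x * p - a)\<^sup>2 / p = x\<^sup>2 * p - (2 * a * x - a\<^sup>2 * (1 / p))"
      if "p > 0" for x p :: real
      using that by (simp, simp add: power2_eq_square field_simps)
    from this[OF \<open>r ^ (n - 1) > 0\<close>, of "g' r"] show "h' r \<le> f r"
      by (simp add: f_def h'_def)
  qed
  moreover have "(2 * a * g R2 - a\<^sup>2 * W R2) - (2 * a * g R1 - a\<^sup>2 * W R1) = (g R2)\<^sup>2 / W R2"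
    using W by (simp add: g(3) a_def W_def[THEN fun_cong] power2_eq_square field_simps)
  moreover have "(\<integral>\<^sup>+r. ennreal (f r) * indicator {R1..R2} r \<partial>lborel) = ennreal (integral {R1..R2} f)"
    using R by (intro nn_integral_has_integral_lebesgue'[OF _ f]) (auto simp: f_def)
  ultimately show ?thesis
    by (simp add: f_def W_def ennreal_leI)
qed

text \<open>\<open>radial_steklov_inequality\<close> integrated over all directions. The function
  \<open>g\<close> on a ray and the bound \<open>G\<close> for its squared derivative are left open
  for two uses: the sharp inequality for functions vanishing on the inner sphere, and a crude one
  for all smooth functions by means of a cutoff.\<close>

lemma polar_shell_inequality:
  fixes \<psi> :: "real^'n \<Rightarrow> real" and G :: "real^'n \<Rightarrow> real"
  assumes n: "CARD('n) \<ge> 2" and R: "0 < R1" "R1 < R2"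
    and [measurable]: "\<psi> \<in> borel_measurable borel" "G \<in> borel_measurable borel"
    and g: "\<And>\<xi>. norm \<xi> = R2 \<Longrightarrow> \<exists>g g'. g R1 = 0 \<and> g R2 = \<psi> \<xi> \<and> continuous_on {R1..R2} g' \<and>
      (\<forall>r\<in>{R1..R2}. (g has_real_derivative g' r) (at r)) \<and>
      (\<forall>r\<in>{R1<..<R2}. (g' r)\<^sup>2 \<le> G ((r / R2) *\<^sub>R \<xi>))"
  shows "ennreal (real CARD('n) / (R2 ^ CARD('n) * radial_profile CARD('n) R1 R2)) *
      (\<integral>\<^sup>+\<xi>. ennreal ((\<psi> \<xi>)\<^sup>2) \<partial>polar_measure R2)
    \<le> (\<integral>\<^sup>+x. ennreal (G x) * indicator (shell R1 R2) x \<partial>lborel)"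
proof -
  let ?I = "\<lambda>(\<xi> :: real^'n) r. ennreal (radial_density DIM(real^'n) R2 r) *
    (ennreal (G ((r / R2) *\<^sub>R \<xi>)) * indicator (shell R1 R2) ((r / R2) *\<^sub>R \<xi>))"
  let ?n = "CARD('n)" and ?W = "radial_profile CARD('n) R1 R2"
  have R2: "R2 > 0" using R by simp
  have shell [measurable]: "shell R1 R2 \<in> sets (borel :: (real^'n) measure)"
    by (simp add: shell_eq_ball_diff_cball)
  have W: "?W > 0" using radial_profile_pos[OF n R] .
  have "ennreal (real ?n / (R2 ^ ?n * ?W)) * (\<integral>\<^sup>+\<xi>. ennreal ((\<psi> \<xi>)\<^sup>2) \<partial>polar_measure R2) =
      (\<integral>\<^sup>+\<xi>. ennreal (real ?n / (R2 ^ ?n * ?W)) * ennreal ((\<psi> \<xi>)\<^sup>2) \<partial>polar_measure R2)"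
    by (intro nn_integral_cmult[symmetric]) measurable
  also have "\<dots> \<le> (\<integral>\<^sup>+\<xi>. (\<integral>\<^sup>+r. ?I \<xi> r \<partial>lborel) \<partial>polar_measure R2)"
  proof (rule nn_integral_mono_AE)
    show "AE \<xi> in polar_measure R2. ennreal (real ?n / (R2 ^ ?n * ?W)) * ennreal ((\<psi> \<xi>)\<^sup>2) \<le>
      (\<integral>\<^sup>+r. ?I \<xi> r \<partial>lborel)"
      using AE_polar_measure_sphere[OF R2]
    proof eventually_elim
      case (elim \<xi>)
      then have \<xi>: "norm \<xi> = R2" by simp
      from g[OF \<xi>] obtain g g' where g: "g R1 = 0" "g R2 = \<psi> \<xi>" "continuous_on {R1..R2} g'"
        "\<And>r. r \<in> {R1..R2} \<Longrightarrow> (g has_real_derivative g' r) (at r)"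
        "\<And>r. r \<in> {R1<..<R2} \<Longrightarrow> (g' r)\<^sup>2 \<le> G ((r / R2) *\<^sub>R \<xi>)"
        by blast
      have "ennreal (real ?n / (R2 ^ ?n * ?W)) * ennreal ((\<psi> \<xi>)\<^sup>2) =
          ennreal (real ?n / R2 ^ ?n) * ennreal ((g R2)\<^sup>2 / ?W)"
        using R2 W by (simp add: g(2) field_simps flip: ennreal_mult')
      also have "\<dots> \<le> ennreal (real ?n / R2 ^ ?n) *
          (\<integral>\<^sup>+r. ennreal ((g' r)\<^sup>2 * r ^ (?n - 1)) * indicator {R1..R2} r \<partial>lborel)"
        using radial_steklov_inequality[OF n R g(4,3,1)] by (intro mult_left_mono) auto
      also have "\<dots> = (\<integral>\<^sup>+r. ennreal (real ?n / R2 ^ ?n) * (ennreal ((g' r)\<^sup>2 * r ^ (?n - 1)) * indicator {R1..R2} r) \<partial>lborel)"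
      proof (rule nn_integral_cmult[symmetric])
        \<comment> \<open>\<open>g'\<close> is known to be continuous on the interval only, so
          measurability is obtained after multiplication by its indicator.\<close>
        have "(\<lambda>r. indicator {R1..R2} r *\<^sub>R ((g' r)\<^sup>2 * r ^ (?n - 1))) \<in> borel_measurable borel"
          by (intro borel_measurable_continuous_on_indicator continuous_intros g(3)) auto
        then have "(\<lambda>r. ennreal (indicator {R1..R2} r *\<^sub>R ((g' r)\<^sup>2 * r ^ (?n - 1)))) \<in> borel_measurable lborel"
          by simp
        moreover have "ennreal (indicator {R1..R2} r *\<^sub>R ((g' r)\<^sup>2 * r ^ (?n - 1))) =
            ennreal ((g' r)\<^sup>2 * r ^ (?n - 1)) * indicator {R1..R2} r" for r
          by (auto split: split_indicator)
        ultimately show "(\<lambda>r. ennreal ((g' r)\<^sup>2 * r ^ (?n - 1)) * indicator {R1..R2} r) \<in> borel_measurable lborel"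
          by simp
      qed
      also have "\<dots> \<le> (\<integral>\<^sup>+r. ?I \<xi> r \<partial>lborel)"
      proof (rule nn_integral_mono_AE)
        show "AE r in lborel. ennreal (real ?n / R2 ^ ?n) * (ennreal ((g' r)\<^sup>2 * r ^ (?n - 1)) * indicator {R1..R2} r)
          \<le> ?I \<xi> r"
          using AE_lborel_singleton[of R1] AE_lborel_singleton[of R2]
        proof eventually_elim
          case (elim r)
          show ?case
          proof (cases "r \<in> {R1<..<R2}")
            case True
            then have r: "0 < r" "(r / R2) *\<^sub>R \<xi> \<in> shell R1 R2"
              using R \<xi> by (auto simp: shell_def)
            have "ennreal (real ?n / R2 ^ ?n) * ennreal ((g' r)\<^sup>2 * r ^ (?n - 1)) =
                ennreal (radial_density DIM(real^'n) R2 r) * ennreal ((g' r)\<^sup>2)"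
              using r R2 by (simp add: radial_density_def field_simps flip: ennreal_mult')
            also have "\<dots> \<le> ennreal (radial_density DIM(real^'n) R2 r) * ennreal (G ((r / R2) *\<^sub>R \<xi>))"
              using g(5)[OF True] by (intro mult_left_mono ennreal_leI) auto
            finally show ?thesis using r True by simp
          next
            case False
            with elim have "r \<notin> {R1..R2}" by auto
            then show ?thesis by simp
          qed
        qed
      qed
      finally show ?case .
    qed
  qed
  also have "\<dots> = (\<integral>\<^sup>+x. ennreal (G x) * indicator (shell R1 R2) x \<partial>lborel)"
    by (rule nn_integral_polar[OF R2, symmetric]) measurable
  finally show ?thesis .
qed

section \<open>Integration over hypersurfaces\<close>

lemma nn_integral_surface_measure:
  "\<Gamma> \<in> sets borel \<Longrightarrow> (\<integral>\<^sup>+x. f x \<partial>surface_measure (\<Gamma> :: (real^'n) set)) =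
    (\<integral>\<^sup>+x. f x * indicator \<Gamma> x \<partial>hausdorff_measure (real CARD('n) - 1))"
  unfolding surface_measure_def by (rule nn_integral_restrict_space) simp

lemma nn_integral_surface_measure_sphere:
  assumes [measurable]: "f \<in> borel_measurable borel"
  shows "(\<integral>\<^sup>+x. f x \<partial>surface_measure (sphere (0::real^'n) R)) = (\<integral>\<^sup>+x. f x \<partial>sphere_measure R)"
proof -
  have S: "sphere (0::real^'n) R \<in> sets borel" by (simp add: borel_closed)
  have "(\<integral>\<^sup>+x. f x \<partial>sphere_measure R) =
      (\<integral>\<^sup>+x. indicator (sphere 0 R) x * f x \<partial>hausdorff_measure (real CARD('n) - 1))"
    unfolding sphere_measure_def
    by (rule nn_integral_density) (auto intro!: borel_measurable_indicator S)
  then show ?thesis by (simp add: nn_integral_surface_measure[OF S] mult.commute)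
qed

lemma space_surface_measure [simp]: "space (surface_measure \<Gamma>) = \<Gamma>"
  by (simp add: surface_measure_def space_restrict_space)

lemma finite_measure_surface_measure:
  fixes \<Gamma> :: "(real^'n) set"
  assumes "\<Gamma> \<in> sets borel" "hausdorff_outer (real CARD('n) - 1) \<Gamma> < \<infinity>"
  shows "finite_measure (surface_measure \<Gamma>)"
proof (rule finite_measureI)
  have "emeasure (surface_measure \<Gamma>) \<Gamma> = emeasure (hausdorff_measure (real CARD('n) - 1)) \<Gamma>"
    unfolding surface_measure_def using assms(1) by (subst emeasure_restrict_space) auto
  also have "\<dots> < \<infinity>"
    using emeasure_hausdorff_measure_le assms(2) by (rule le_less_trans)
  finally show "emeasure (surface_measure \<Gamma>) (space (surface_measure \<Gamma>)) \<noteq> \<infinity>" by simp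
qed

lemma borel_measurable_surface_measure:
  "f \<in> borel_measurable borel \<Longrightarrow> f \<in> borel_measurable (surface_measure \<Gamma>)"
  unfolding surface_measure_def by (intro measurable_restrict_space1) simp

lemma smooth_compact_borel_measurable:
  assumes "\<phi> \<in> smooth_compact U"
  shows "\<phi> \<in> borel_measurable borel" "gradient \<phi> \<in> borel_measurable borel"
  by (intro borel_measurable_continuous_onI smooth_on_continuous smooth_on_continuous_gradient
      smooth_compactD(1)[OF assms])+

lemma smooth_compact_L2_surface_measure:
  fixes \<Gamma> :: "(real^'n) set"
  assumes "finite_measure (surface_measure \<Gamma>)" "\<phi> \<in> smooth_compact U"
  shows "\<phi> \<in> L2 (surface_measure \<Gamma>)"
proof -
  obtain B where B: "0 \<le> B" "\<And>x. \<bar>\<phi> x\<bar> \<le> B"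
    using bounded_continuous_compact_support[OF smooth_on_continuous[OF smooth_compactD(1)[OF assms(2)]]
        smooth_compactD(2)[OF assms(2)] eq_0_outside_spt[of _ \<phi>]] by blast
  have meas [measurable]: "\<phi> \<in> borel_measurable (surface_measure \<Gamma>)"
    by (rule borel_measurable_surface_measure[OF smooth_compact_borel_measurable(1)[OF assms(2)]])
  have "integrable (surface_measure \<Gamma>) (\<lambda>x. (norm (\<phi> x))\<^sup>2)"
  proof (rule finite_measure.integrable_const_bound[OF assms(1)])
    show "AE x in surface_measure \<Gamma>. norm ((norm (\<phi> x))\<^sup>2) \<le> B\<^sup>2"
      using B power_mono[OF B(2) abs_ge_zero, where n = 2] by (intro AE_I2) simp
  qed measurable
  then show ?thesis using meas by (simp add: L2_def)
qed

lemma nn_integral_L2: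
  assumes "f \<in> L2 M"
  shows "(\<integral>\<^sup>+x. ennreal ((norm (f x))\<^sup>2) \<partial>M) = ennreal (LINT x|M. (norm (f x))\<^sup>2)"
  using assms by (intro nn_integral_eq_integral) (auto simp: L2_def)

lemma nn_integral_L2_lebesgue_on:
  fixes f :: "'a::euclidean_space \<Rightarrow> 'b::{real_normed_vector, second_countable_topology}"
  assumes "f \<in> L2 (lebesgue_on \<Omega>)" "f \<in> borel_measurable borel" "\<Omega> \<in> sets borel"
  shows "(\<integral>\<^sup>+x. ennreal ((norm (f x))\<^sup>2) * indicator \<Omega> x \<partial>lborel) =
    ennreal (LINT x|lebesgue_on \<Omega>. (norm (f x))\<^sup>2)"
proof -
  have "(\<integral>\<^sup>+x. ennreal ((norm (f x))\<^sup>2) * indicator \<Omega> x \<partial>lborel) =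
      (\<integral>\<^sup>+x. ennreal ((norm (f x))\<^sup>2) * indicator \<Omega> x \<partial>lebesgue)"
    by (simp add: nn_integral_completion)
  also have "\<dots> = (\<integral>\<^sup>+x. ennreal ((norm (f x))\<^sup>2) \<partial>lebesgue_on \<Omega>)"
    using assms(3) by (intro nn_integral_restrict_space[symmetric]) auto
  finally show ?thesis using nn_integral_L2[OF assms(1)] by simp
qed

text \<open>Proportionality replaces the polar integral by a Hausdorff integral at the price of the
  factor \<open>m / V\<close>. The powers of \<open>R2\<close> cancel, and the resulting constant is
  the reciprocal of the number with which both eigenvalues are compared.\<close>

lemma sphere_trace_inequality:
  fixes \<psi> :: "real^'n \<Rightarrow> real" and G :: "real^'n \<Rightarrow> real"
  assumes n: "CARD('n) \<ge> 2" and R: "0 < R1" "R1 < R2"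
    and nz: "emeasure (sphere_measure R2 :: (real^'n) measure) UNIV \<noteq> 0"
    and meas [measurable]: "\<psi> \<in> borel_measurable borel" "G \<in> borel_measurable borel"
    and g: "\<And>\<xi>. norm \<xi> = R2 \<Longrightarrow> \<exists>g g'. g R1 = 0 \<and> g R2 = \<psi> \<xi> \<and> continuous_on {R1..R2} g' \<and>
      (\<forall>r\<in>{R1..R2}. (g has_real_derivative g' r) (at r)) \<and>
      (\<forall>r\<in>{R1<..<R2}. (g' r)\<^sup>2 \<le> G ((r / R2) *\<^sub>R \<xi>))"
  shows "(\<integral>\<^sup>+x. ennreal ((\<psi> x)\<^sup>2) \<partial>surface_measure (sphere 0 R2)) \<le>
    ennreal (measure (sphere_measure R2 :: (real^'n) measure) UNIV * radial_profile CARD('n) R1 R2 /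
      (real CARD('n) * unit_ball_vol CARD('n))) *
    (\<integral>\<^sup>+x. ennreal (G x) * indicator (shell R1 R2) x \<partial>lborel)"
proof -
  let ?n = "CARD('n)" and ?W = "radial_profile CARD('n) R1 R2"
  define m where "m = measure (sphere_measure R2 :: (real^'n) measure) UNIV"
  define V where "V = unit_ball_vol (real ?n) * R2 ^ ?n"
  have R2: "R2 > 0" using R by simp
  have W: "?W > 0" using radial_profile_pos[OF n R] .
  have V: "V > 0" using R2 by (simp add: V_def)
  interpret S: finite_measure "sphere_measure R2 :: (real^'n) measure"
    by (rule finite_measure_sphere_measure[OF R2])
  let ?X = "\<integral>\<^sup>+x. ennreal ((\<psi> x)\<^sup>2) \<partial>sphere_measure R2"
  let ?P = "\<integral>\<^sup>+x. ennreal ((\<psi> x)\<^sup>2) \<partial>polar_measure R2"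
  have "ennreal V * ?X = ennreal m * ?P"
  proof -
    have "emeasure (polar_measure R2 :: (real^'n) measure) UNIV * ?X =
        emeasure (sphere_measure R2 :: (real^'n) measure) UNIV * ?P"
      using arg_cong[OF sphere_measure_eq_polar_measure[OF R2 nz], of "\<lambda>M. \<integral>\<^sup>+x. ennreal ((\<psi> x)\<^sup>2) \<partial>M"]
      by (simp add: nn_integral_scale_measure)
    then show ?thesis
      using emeasure_polar_measure_UNIV[OF R2, where ?'a = "real^'n"]
      by (simp add: V_def m_def S.emeasure_eq_measure)
  qed
  then have "ennreal (1 / V) * (ennreal V * ?X) = ennreal (1 / V) * (ennreal m * ?P)" by simp
  also have "ennreal (1 / V) * (ennreal V * ?X) = ?X"
    using V by (simp flip: mult.assoc ennreal_mult')
  also have "ennreal (1 / V) * (ennreal m * ?P) = ennreal (m / V) * ?P"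
    using V by (simp add: m_def flip: mult.assoc ennreal_mult')
  also have "m / V = (m * ?W / (real ?n * unit_ball_vol ?n)) * (real ?n / (R2 ^ ?n * ?W))"
    using W by (simp add: V_def)
  also have "ennreal \<dots> * ?P = ennreal (m * ?W / (real ?n * unit_ball_vol ?n)) *
      (ennreal (real ?n / (R2 ^ ?n * ?W)) * ?P)"
    using W R2 by (subst ennreal_mult'') (simp_all add: mult.assoc)
  also have "\<dots> \<le> ennreal (m * ?W / (real ?n * unit_ball_vol ?n)) *
      (\<integral>\<^sup>+x. ennreal (G x) * indicator (shell R1 R2) x \<partial>lborel)"
    using polar_shell_inequality[OF n R meas g] by (intro mult_left_mono) auto
  finally show ?thesis
    by (simp add: nn_integral_surface_measure_sphere m_def)
qed

lemma has_real_derivative_radial: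
  fixes \<phi> :: "real^'n \<Rightarrow> real"
  assumes "smooth_on UNIV \<phi>"
  shows "((\<lambda>r. \<phi> ((r / R) *\<^sub>R \<xi>)) has_real_derivative gradient \<phi> ((r / R) *\<^sub>R \<xi>) \<bullet> ((1 / R) *\<^sub>R \<xi>)) (at r)"
proof -
  have "((\<lambda>r. (r / R) *\<^sub>R \<xi>) has_derivative (\<lambda>s. (s / R) *\<^sub>R \<xi>)) (at r)"
    unfolding divide_inverse by (auto intro!: derivative_eq_intros)
  moreover have "(\<phi> has_derivative (\<lambda>h. gradient \<phi> ((r / R) *\<^sub>R \<xi>) \<bullet> h)) (at ((r / R) *\<^sub>R \<xi>))"
    using assms smooth_on_has_derivative by blast
  ultimately have "((\<lambda>r. \<phi> ((r / R) *\<^sub>R \<xi>)) has_derivative (\<lambda>s. gradient \<phi> ((r / R) *\<^sub>R \<xi>) \<bullet> ((s / R) *\<^sub>R \<xi>))) (at r)"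
    by (rule has_derivative_compose)
  moreover have "(\<lambda>s. gradient \<phi> ((r / R) *\<^sub>R \<xi>) \<bullet> ((s / R) *\<^sub>R \<xi>)) =
      (*) (gradient \<phi> ((r / R) *\<^sub>R \<xi>) \<bullet> ((1 / R) *\<^sub>R \<xi>))"
    by (rule ext) simp
  ultimately show ?thesis by (simp only: has_field_derivative_def)
qed

lemma continuous_on_radial:
  fixes F :: "'a::real_normed_vector \<Rightarrow> 'b::topological_space"
  assumes "continuous_on UNIV F"
  shows "continuous_on S (\<lambda>r. F ((r / R) *\<^sub>R \<xi>))"
proof (rule continuous_on_compose2[OF assms])
  show "continuous_on S (\<lambda>r. (r / R) *\<^sub>R \<xi>)"
    unfolding divide_inverse by (intro continuous_intros)
qed simp

lemma radial_derivative_le_gradient: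
  assumes "norm \<xi> = R" "R > 0"
  shows "(v \<bullet> ((1 / R) *\<^sub>R \<xi>))\<^sup>2 \<le> (norm v)\<^sup>2"
proof -
  have "\<bar>v \<bullet> ((1 / R) *\<^sub>R \<xi>)\<bar> \<le> norm v * norm ((1 / R) *\<^sub>R \<xi>)" by (rule Cauchy_Schwarz_ineq2)
  also have "\<dots> = norm v" using assms by simp
  finally show ?thesis unfolding abs_le_square_iff[symmetric] by simp
qed

section \<open>Sharp and crude trace inequalities on the shell\<close>

context
  fixes R1 R2 :: real and \<Omega> :: "(real^'n) set" and K :: real
  assumes n: "CARD('n) \<ge> 2" and R: "0 < R1" "R1 < R2"
    and nz: "emeasure (sphere_measure R2 :: (real^'n) measure) UNIV \<noteq> 0"
  defines "\<Omega> \<equiv> shell R1 R2"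
    and "K \<equiv> measure (sphere_measure R2 :: (real^'n) measure) UNIV * radial_profile CARD('n) R1 R2 /
      (real CARD('n) * unit_ball_vol CARD('n))"
begin

lemma shell_open_bounded: "open \<Omega>" "bounded \<Omega>" "\<Omega> \<in> sets borel"
  unfolding \<Omega>_def shell_eq_ball_diff_cball
  by (auto intro: open_Diff bounded_subset[OF bounded_ball])

lemma trace_constant_nonneg: "0 \<le> K"
  using radial_profile_pos[OF n R] by (simp add: K_def)

lemma finite_measure_surface_sphere: "finite_measure (surface_measure (sphere (0::real^'n) R2))"
  using R by (intro finite_measure_surface_measure hausdorff_outer_sphere_finite) (auto intro: borel_closed)

text \<open>On each ray \<open>\<psi>\<close> vanishes at \<open>R1\<close>, and its radial
  derivative is dominated by the gradient.\<close>

lemma smooth_steklov_inequality: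
  fixes \<psi> :: "real^'n \<Rightarrow> real"
  assumes \<psi>: "\<psi> \<in> smooth_compact UNIV" and vanish: "\<And>x. norm x = R1 \<Longrightarrow> \<psi> x = 0"
  shows "(LINT x|surface_measure (sphere 0 R2). (\<psi> x)\<^sup>2) \<le> K * dirichlet_energy \<Omega> \<psi>"
proof -
  note sm = smooth_compactD(1)[OF \<psi>, of UNIV]
  note \<Omega> = shell_open_bounded
  have "ennreal (LINT x|surface_measure (sphere 0 R2). (norm (\<psi> x))\<^sup>2) =
      (\<integral>\<^sup>+x. ennreal ((\<psi> x)\<^sup>2) \<partial>surface_measure (sphere 0 R2))"
    using nn_integral_L2[OF smooth_compact_L2_surface_measure[OF finite_measure_surface_sphere \<psi>]] by simp
  also have "\<dots> \<le> ennreal K * (\<integral>\<^sup>+x. ennreal ((norm (gradient \<psi> x))\<^sup>2) * indicator (shell R1 R2) x \<partial>lborel)"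
    unfolding K_def
  proof (rule sphere_trace_inequality[OF n R nz])
    show "\<psi> \<in> borel_measurable borel" "(\<lambda>x. (norm (gradient \<psi> x))\<^sup>2) \<in> borel_measurable borel"
      using smooth_compact_borel_measurable[OF \<psi>] by measurable
    fix \<xi> :: "real^'n" assume \<xi>: "norm \<xi> = R2"
    let ?g = "\<lambda>r. \<psi> ((r / R2) *\<^sub>R \<xi>)" and ?g' = "\<lambda>r. gradient \<psi> ((r / R2) *\<^sub>R \<xi>) \<bullet> ((1 / R2) *\<^sub>R \<xi>)"
    have "continuous_on {R1..R2} ?g'"
      by (rule continuous_on_inner[OF continuous_on_radial[OF smooth_on_continuous_gradient[OF sm]] continuous_on_const])
    moreover have "(?g' r)\<^sup>2 \<le> (norm (gradient \<psi> ((r / R2) *\<^sub>R \<xi>)))\<^sup>2" for r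
      using R by (intro radial_derivative_le_gradient \<xi>) auto
    moreover have "?g R1 = 0" using R \<xi> by (intro vanish) simp
    ultimately show "\<exists>g g'. g R1 = 0 \<and> g R2 = \<psi> \<xi> \<and> continuous_on {R1..R2} g' \<and>
      (\<forall>r\<in>{R1..R2}. (g has_real_derivative g' r) (at r)) \<and>
      (\<forall>r\<in>{R1<..<R2}. (g' r)\<^sup>2 \<le> (norm (gradient \<psi> ((r / R2) *\<^sub>R \<xi>)))\<^sup>2)"
      using has_real_derivative_radial[OF sm] R
      by (intro exI[of _ ?g] exI[of _ ?g']) auto
  qed
  also have "\<dots> = ennreal (K * dirichlet_energy \<Omega> \<psi>)"
    using nn_integral_L2_lebesgue_on[OF smooth_compact_L2(3)[OF \<psi> \<Omega>(1)] smooth_compact_borel_measurable(2)[OF \<psi>] \<Omega>(3)]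
    using smooth_compact_H1(2)[OF \<Omega>(1,2) \<psi>] trace_constant_nonneg
    by (simp add: \<Omega>_def ennreal_mult')
  finally show ?thesis
    using trace_constant_nonneg by (subst (asm) ennreal_le_iff) (auto simp: dirichlet_energy_def)
qed

text \<open>To treat functions that do not vanish on the inner sphere, multiply by
  \<open>(r - R1) / (R2 - R1)\<close>, which is zero there and one on the outer sphere. A crude
  constant suffices, as the estimate is applied to differences that tend to zero.\<close>

lemma smooth_trace_inequality:
  fixes \<phi> :: "real^'n \<Rightarrow> real"
  assumes \<phi>: "\<phi> \<in> smooth_compact UNIV"
  shows "(LINT x|surface_measure (sphere 0 R2). (\<phi> x)\<^sup>2) \<le> K * (2 + 2 / (R2 - R1)\<^sup>2) *
    ((LINT x|lebesgue_on \<Omega>. (\<phi> x)\<^sup>2) + (LINT x|lebesgue_on \<Omega>. (norm (gradient \<phi> x))\<^sup>2))"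
proof -
  note sm = smooth_compactD(1)[OF \<phi>, of UNIV]
  note \<Omega> = shell_open_bounded
  define L where "L = R2 - R1"
  \<comment> \<open>The factors two come from squaring a sum, \<open>1 / L\<^sup>2\<close> from the
    slope of the cutoff.\<close>
  define C where "C = 2 + 2 / L\<^sup>2"
  have L: "L > 0" using R by (simp add: L_def)
  then have C: "2 \<le> C" "2 / L\<^sup>2 \<le> C" by (auto simp: C_def)
  note [measurable] = smooth_compact_borel_measurable[OF \<phi>] \<Omega>(3)
  have "ennreal (LINT x|surface_measure (sphere 0 R2). (norm (\<phi> x))\<^sup>2) =
      (\<integral>\<^sup>+x. ennreal ((\<phi> x)\<^sup>2) \<partial>surface_measure (sphere 0 R2))"
    using nn_integral_L2[OF smooth_compact_L2_surface_measure[OF finite_measure_surface_sphere \<phi>]] by simp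
  also have "\<dots> \<le> ennreal K * (\<integral>\<^sup>+x. ennreal (C * ((\<phi> x)\<^sup>2 + (norm (gradient \<phi> x))\<^sup>2)) * indicator (shell R1 R2) x \<partial>lborel)"
    unfolding K_def
  proof (rule sphere_trace_inequality[OF n R nz])
    show "\<phi> \<in> borel_measurable borel" "(\<lambda>x. C * ((\<phi> x)\<^sup>2 + (norm (gradient \<phi> x))\<^sup>2)) \<in> borel_measurable borel"
      by measurable
    fix \<xi> :: "real^'n" assume \<xi>: "norm \<xi> = R2"
    let ?f = "\<lambda>r. \<phi> ((r / R2) *\<^sub>R \<xi>)" and ?f' = "\<lambda>r. gradient \<phi> ((r / R2) *\<^sub>R \<xi>) \<bullet> ((1 / R2) *\<^sub>R \<xi>)"
    let ?g = "\<lambda>r. ?f r * ((r - R1) / L)" and ?g' = "\<lambda>r. ?f' r * ((r - R1) / L) + 1 / L * ?f r"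
    have "continuous_on {R1..R2} ?g'"
      using L
      by (intro continuous_on_add continuous_on_mult continuous_on_const continuous_on_divide continuous_on_diff
          continuous_on_id continuous_on_radial[OF smooth_on_continuous[OF sm]]
          continuous_on_inner[OF continuous_on_radial[OF smooth_on_continuous_gradient[OF sm]]]) auto
    moreover have "(?g' r)\<^sup>2 \<le> C * ((\<phi> ((r / R2) *\<^sub>R \<xi>))\<^sup>2 + (norm (gradient \<phi> ((r / R2) *\<^sub>R \<xi>)))\<^sup>2)"
      if r: "r \<in> {R1<..<R2}" for r
    proof -
      have \<tau>: "0 \<le> (r - R1) / L" "(r - R1) / L \<le> 1" using r L by (auto simp: L_def)
      have f': "(?f' r)\<^sup>2 \<le> (norm (gradient \<phi> ((r / R2) *\<^sub>R \<xi>)))\<^sup>2"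
        using R by (intro radial_derivative_le_gradient \<xi>) auto
      have "(?g' r)\<^sup>2 \<le> (1 + 1) * (?f' r * ((r - R1) / L))\<^sup>2 + (1 + 1 / 1) * (1 / L * ?f r)\<^sup>2"
        using norm_square_add_le[of 1 "?f' r * ((r - R1) / L)" "1 / L * ?f r"]
        by (simp only: real_norm_def power2_abs zero_less_one)
      also have "(?f' r * ((r - R1) / L))\<^sup>2 = (?f' r)\<^sup>2 * ((r - R1) / L)\<^sup>2" by (rule power_mult_distrib)
      also have "\<dots> \<le> (?f' r)\<^sup>2 * 1"
        using \<tau> by (intro mult_left_mono power_le_one) auto
      also have "(1 + 1) * ((?f' r)\<^sup>2 * 1) + (1 + 1 / 1) * (1 / L * ?f r)\<^sup>2
          = 2 * (?f' r)\<^sup>2 + 2 / L\<^sup>2 * (?f r)\<^sup>2"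
        by (simp add: power_divide)
      also have "\<dots> \<le> C * (norm (gradient \<phi> ((r / R2) *\<^sub>R \<xi>)))\<^sup>2 + C * (?f r)\<^sup>2"
        using C f' by (intro add_mono mult_mono) auto
      finally show ?thesis by (simp add: algebra_simps)
    qed
    moreover have "(?g has_real_derivative ?g' r) (at r)" for r
    proof (rule DERIV_mult[OF has_real_derivative_radial[OF sm]])
      show "((\<lambda>r. (r - R1) / L) has_real_derivative 1 / L) (at r)"
        using L by (auto intro!: derivative_eq_intros)
    qed
    ultimately show "\<exists>g g'. g R1 = 0 \<and> g R2 = \<phi> \<xi> \<and> continuous_on {R1..R2} g' \<and>
      (\<forall>r\<in>{R1..R2}. (g has_real_derivative g' r) (at r)) \<and>
      (\<forall>r\<in>{R1<..<R2}. (g' r)\<^sup>2 \<le> C * ((\<phi> ((r / R2) *\<^sub>R \<xi>))\<^sup>2 + (norm (gradient \<phi> ((r / R2) *\<^sub>R \<xi>)))\<^sup>2))"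
      using R L by (intro exI[of _ ?g] exI[of _ ?g']) (auto simp: L_def)
  qed
  also have "(\<integral>\<^sup>+x. ennreal (C * ((\<phi> x)\<^sup>2 + (norm (gradient \<phi> x))\<^sup>2)) * indicator (shell R1 R2) x \<partial>lborel) =
      (\<integral>\<^sup>+x. ennreal C * (ennreal ((norm (\<phi> x))\<^sup>2) * indicator \<Omega> x + ennreal ((norm (gradient \<phi> x))\<^sup>2) * indicator \<Omega> x) \<partial>lborel)"
    using C by (intro nn_integral_cong) (auto simp: \<Omega>_def ennreal_mult' ennreal_plus split: split_indicator)
  also have "\<dots> = ennreal C * ((\<integral>\<^sup>+x. ennreal ((norm (\<phi> x))\<^sup>2) * indicator \<Omega> x \<partial>lborel)
      + (\<integral>\<^sup>+x. ennreal ((norm (gradient \<phi> x))\<^sup>2) * indicator \<Omega> x \<partial>lborel))"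
    by (subst nn_integral_cmult, measurable, subst nn_integral_add, measurable)
  also have "\<dots> = ennreal (C * ((LINT x|lebesgue_on \<Omega>. (norm (\<phi> x))\<^sup>2) + (LINT x|lebesgue_on \<Omega>. (norm (gradient \<phi> x))\<^sup>2)))"
    using nn_integral_L2_lebesgue_on[OF smooth_compact_L2(3)[OF \<phi> \<Omega>(1)] smooth_compact_borel_measurable(2)[OF \<phi>] \<Omega>(3)]
      nn_integral_L2_lebesgue_on[OF smooth_compact_L2(1)[OF \<phi> \<Omega>(1)] smooth_compact_borel_measurable(1)[OF \<phi>] \<Omega>(3)] C
    by (simp only: ennreal_mult' ennreal_plus[symmetric] integral_nonneg_AE) (simp add: ennreal_mult' ennreal_plus)
  also have "ennreal K * \<dots> = ennreal (K * C * ((LINT x|lebesgue_on \<Omega>. (norm (\<phi> x))\<^sup>2) + (LINT x|lebesgue_on \<Omega>. (norm (gradient \<phi> x))\<^sup>2)))"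
    using trace_constant_nonneg by (simp add: ennreal_mult' mult.assoc)
  finally show ?thesis
    using trace_constant_nonneg C
    by (subst (asm) ennreal_le_iff) (auto simp: C_def L_def)
qed

text \<open>The approximation \<open>\<psi>\<close> vanishing near the inner sphere and the
  approximation \<open>\<phi> k\<close> of the trace both approach \<open>v\<close>, so their
  difference is small in the Sobolev norm and, by \<open>smooth_trace_inequality\<close>, small on
  the outer sphere. Thus the sharp inequality for \<open>\<psi>\<close> passes to
  \<open>t\<close>.\<close>

theorem steklov_inequality_shell:
  assumes v: "v \<in> H1_vanishing \<Omega> (sphere 0 R1)" and tr: "has_trace \<Omega> (sphere 0 R2) v t"
  shows "(LINT x|surface_measure (sphere 0 R2). (t x)\<^sup>2) \<le> K * dirichlet_energy \<Omega> v"
proof -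
  note \<Omega> = shell_open_bounded
  let ?M = "surface_measure (sphere (0::real^'n) R2)"
  define T where "T = (LINT x|?M. (norm (t x))\<^sup>2)"
  define E where "E = dirichlet_energy \<Omega> v"
  define C where "C = K * (2 + 2 / (R2 - R1)\<^sup>2)"
  have C: "0 \<le> C" using trace_constant_nonneg by (simp add: C_def)
  have vH: "v \<in> H1 \<Omega>" using v by (simp add: H1_vanishing_def)
  have t: "t \<in> L2 ?M" using tr by (simp add: has_trace_def)
  obtain \<phi> where \<phi>: "\<And>k. \<phi> k \<in> smooth_compact UNIV"
    "(\<lambda>k. H1_norm \<Omega> (\<lambda>x. v x - \<phi> k x)) \<longlonglongrightarrow> 0"
    "(\<lambda>k. \<integral>\<^sup>+x. ennreal ((t x - \<phi> k x)\<^sup>2) \<partial>?M) \<longlonglongrightarrow> 0"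
    using tr by (auto simp: has_trace_def)
  have key: "T \<le> (1 + \<delta>) * (K * ((1 + \<delta>) * E + (1 + 1 / \<delta>) * \<epsilon>\<^sup>2)) + (1 + 1 / \<delta>) * (2 * \<epsilon> + 2 * (C * (4 * \<epsilon>\<^sup>2)))"
    if \<delta>: "\<delta> > 0" and \<epsilon>: "\<epsilon> > 0" for \<delta> \<epsilon>
  proof -
    obtain \<psi> where \<psi>: "\<psi> \<in> smooth_compact UNIV" "spt \<psi> \<inter> sphere 0 R1 = {}"
      "H1_norm \<Omega> (\<lambda>x. v x - \<psi> x) < \<epsilon>"
      using v \<epsilon> unfolding H1_vanishing_def by blast
    have "\<forall>\<^sub>F k in sequentially. H1_norm \<Omega> (\<lambda>x. v x - \<phi> k x) < \<epsilon>"
      using order_tendstoD(2)[OF \<phi>(2) \<epsilon>] .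
    moreover have "\<forall>\<^sub>F k in sequentially. (\<integral>\<^sup>+x. ennreal ((t x - \<phi> k x)\<^sup>2) \<partial>?M) < ennreal \<epsilon>"
      using order_tendstoD(2)[OF \<phi>(3), of "ennreal \<epsilon>"] \<epsilon> by simp
    ultimately have "\<forall>\<^sub>F k in sequentially. H1_norm \<Omega> (\<lambda>x. v x - \<phi> k x) < \<epsilon> \<and>
        (\<integral>\<^sup>+x. ennreal ((t x - \<phi> k x)\<^sup>2) \<partial>?M) < ennreal \<epsilon>"
      by eventually_elim simp
    then obtain k where k: "H1_norm \<Omega> (\<lambda>x. v x - \<phi> k x) < \<epsilon>"
      "(\<integral>\<^sup>+x. ennreal ((t x - \<phi> k x)\<^sup>2) \<partial>?M) < ennreal \<epsilon>"
      using eventually_happens'[OF sequentially_bot] by blast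
    have L2: "\<phi> k \<in> L2 ?M" "\<psi> \<in> L2 ?M"
      using smooth_compact_L2_surface_measure[OF finite_measure_surface_sphere] \<phi>(1) \<psi>(1) by auto
    have sq: "(H1_norm \<Omega> (\<lambda>x. v x - \<psi> x))\<^sup>2 \<le> \<epsilon>\<^sup>2" "(H1_norm \<Omega> (\<lambda>x. v x - \<phi> k x))\<^sup>2 \<le> \<epsilon>\<^sup>2"
      using \<psi>(3) k(1) by (auto intro!: power_mono H1_norm_nonneg)
    have 1: "(LINT x|?M. (norm (t x - \<phi> k x))\<^sup>2) \<le> \<epsilon>"
    proof -
      have "ennreal (LINT x|?M. (norm (t x - \<phi> k x))\<^sup>2) < ennreal \<epsilon>"
        using k(2) nn_integral_L2[OF L2_diff[OF t L2(1)]] by simp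
      then show ?thesis using \<epsilon> by (simp add: ennreal_less_iff)
    qed
    have 2: "(LINT x|?M. (norm (\<phi> k x - \<psi> x))\<^sup>2) \<le> C * (4 * \<epsilon>\<^sup>2)"
    proof -
      have "(LINT x|?M. (\<phi> k x - \<psi> x)\<^sup>2) \<le> C * ((LINT x|lebesgue_on \<Omega>. (\<phi> k x - \<psi> x)\<^sup>2) +
          (LINT x|lebesgue_on \<Omega>. (norm (gradient (\<lambda>x. \<phi> k x - \<psi> x) x))\<^sup>2))"
        unfolding C_def by (rule smooth_trace_inequality[OF smooth_compact_diff[OF \<phi>(1) \<psi>(1)]])
      also have "\<dots> \<le> C * (2 * (H1_norm \<Omega> (\<lambda>x. v x - \<phi> k x))\<^sup>2 + 2 * (H1_norm \<Omega> (\<lambda>x. v x - \<psi> x))\<^sup>2)"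
        by (intro mult_left_mono H1_norm_smooth_diff_le \<Omega> vH \<phi>(1) \<psi>(1) C)
      also have "\<dots> \<le> C * (4 * \<epsilon>\<^sup>2)"
        using sq C by (intro mult_left_mono) auto
      finally show ?thesis by simp
    qed
    have 3: "(LINT x|?M. (norm (t x - \<psi> x))\<^sup>2) \<le> 2 * \<epsilon> + 2 * (C * (4 * \<epsilon>\<^sup>2))"
      using L2_add(2)[OF L2_diff[OF t L2(1)] L2_diff[OF L2], of 1] 1 2 by simp
    have 4: "(LINT x|?M. (norm (\<psi> x))\<^sup>2) \<le> K * ((1 + \<delta>) * E + (1 + 1 / \<delta>) * \<epsilon>\<^sup>2)"
    proof -
      have "\<psi> x = 0" if "norm x = R1" for x
      proof (rule eq_0_outside_spt)
        have "x \<in> sphere 0 R1" using that by simp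
        then show "x \<notin> spt \<psi>" using \<psi>(2) by blast
      qed
      then have "(LINT x|?M. (\<psi> x)\<^sup>2) \<le> K * dirichlet_energy \<Omega> \<psi>"
        by (rule smooth_steklov_inequality[OF \<psi>(1)])
      also have "\<dots> \<le> K * ((1 + \<delta>) * E + (1 + 1 / \<delta>) * (H1_norm \<Omega> (\<lambda>x. v x - \<psi> x))\<^sup>2)"
        unfolding E_def
        by (intro mult_left_mono dirichlet_energy_smooth_le[OF \<Omega>(1,2) vH \<psi>(1) \<delta>] trace_constant_nonneg)
      also have "\<dots> \<le> K * ((1 + \<delta>) * E + (1 + 1 / \<delta>) * \<epsilon>\<^sup>2)"
        using sq \<delta> trace_constant_nonneg by (intro mult_left_mono add_left_mono) auto
      finally show ?thesis by simp
    qed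
    have "T \<le> (1 + \<delta>) * (LINT x|?M. (norm (\<psi> x))\<^sup>2) + (1 + 1 / \<delta>) * (LINT x|?M. (norm (t x - \<psi> x))\<^sup>2)"
      using L2_add(2)[OF L2(2) L2_diff[OF t L2(2)] \<delta>] by (simp add: T_def)
    also have "\<dots> \<le> (1 + \<delta>) * (K * ((1 + \<delta>) * E + (1 + 1 / \<delta>) * \<epsilon>\<^sup>2)) + (1 + 1 / \<delta>) * (2 * \<epsilon> + 2 * (C * (4 * \<epsilon>\<^sup>2)))"
      using 3 4 \<delta> by (intro add_mono mult_left_mono) auto
    finally show ?thesis .
  qed
  \<comment> \<open>For fixed \<open>\<delta>\<close> the limit in \<open>\<epsilon>\<close> is
    taken first, because the error terms carry the factor \<open>1 + 1 / \<delta>\<close>.\<close>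
  have step: "T \<le> (1 + \<delta>) * (K * ((1 + \<delta>) * E))" if \<delta>: "\<delta> > 0" for \<delta>
  proof (rule tendsto_lowerbound)
    show "((\<lambda>\<epsilon>. (1 + \<delta>) * (K * ((1 + \<delta>) * E + (1 + 1 / \<delta>) * \<epsilon>\<^sup>2)) + (1 + 1 / \<delta>) * (2 * \<epsilon> + 2 * (C * (4 * \<epsilon>\<^sup>2))))
        \<longlongrightarrow> (1 + \<delta>) * (K * ((1 + \<delta>) * E))) (at_right 0)"
      by (auto intro!: tendsto_eq_intros)
    show "\<forall>\<^sub>F \<epsilon> in at_right 0. T \<le> (1 + \<delta>) * (K * ((1 + \<delta>) * E + (1 + 1 / \<delta>) * \<epsilon>\<^sup>2)) + (1 + 1 / \<delta>) * (2 * \<epsilon> + 2 * (C * (4 * \<epsilon>\<^sup>2)))"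
      using eventually_at_right_less[of 0] by eventually_elim (rule key[OF \<delta>])
  qed simp
  have "T \<le> K * E"
  proof (rule tendsto_lowerbound)
    show "((\<lambda>\<delta>. (1 + \<delta>) * (K * ((1 + \<delta>) * E))) \<longlongrightarrow> K * E) (at_right 0)"
      by (auto intro!: tendsto_eq_intros)
    show "\<forall>\<^sub>F \<delta> in at_right 0. T \<le> (1 + \<delta>) * (K * ((1 + \<delta>) * E))"
      using eventually_at_right_less[of 0] by eventually_elim (rule step)
  qed simp
  then show ?thesis by (simp add: T_def E_def)
qed

end

section \<open>Convexity of the boundary weight below the critical radius\<close>

text \<open>The origin of the critical radius. For \<open>n > 2\<close> the product in the square is
  \<open>((r / R1) powr (n - 2) - 1) / (n - 2)\<close>, so the inequality bounds
  \<open>(r / R1) powr (n - 2)\<close> by exactly the quotient in \<open>critical_radius\<close>;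
  for \<open>n = 2\<close> it says that \<open>ln (r / R1)\<close> is at most
  \<open>sqrt 2\<close>.\<close>

lemma radial_profile_critical:
  assumes n: "n \<ge> 2" and "0 < R1" "R1 \<le> r" "r \<le> critical_radius n R1"
  shows "(real n - 1) * (radial_profile n R1 r * r ^ (n - 2))\<^sup>2 \<le> 2"
proof (cases "n = 2")
  case True
  have "ln r \<le> ln (R1 * exp (sqrt 2))"
    using assms True by (intro ln_mono) (auto simp: critical_radius_def)
  also have "\<dots> = ln R1 + sqrt 2" using assms(2) by (simp add: ln_mult)
  finally have "radial_profile n R1 r \<le> sqrt 2" using True by (simp add: radial_profile_def)
  moreover have "0 \<le> radial_profile n R1 r"
    using True assms by (simp add: radial_profile_def)
  ultimately have "(radial_profile n R1 r)\<^sup>2 \<le> (sqrt 2)\<^sup>2" by (intro power_mono)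
  then show ?thesis using True by simp
next
  case False
  define p where "p = real n - 2"
  have p: "p > 0" using n False by (simp add: p_def)
  have p': "real (n - 2) = p" using n by (simp add: p_def of_nat_diff)
  define X where "X = ((real n - 1) + (real n - 2) * sqrt (2 * (real n - 1))) / (real n - 1)"
  have n1: "real n - 1 > 0" using n by simp
  have X: "X = 1 + p * (sqrt (2 * (real n - 1)) / (real n - 1))"
    using n1 by (simp add: X_def p_def add_divide_distrib)
  then have "X > 0" using n1 p by (simp add: add_pos_nonneg)
  have r: "r > 0" using assms by simp
  have "r / R1 \<le> X powr (1 / p)"
    using assms False by (simp add: critical_radius_def X_def p_def divide_le_eq mult.commute)
  then have "(r / R1) powr p \<le> (X powr (1 / p)) powr p"
    using r assms(2) p by (intro powr_mono2) auto
  also have "\<dots> = X" using p \<open>X > 0\<close> by (simp add: powr_powr)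
  finally have le: "(r / R1) powr p \<le> X" .
  have pw: "radial_profile n R1 r * r ^ (n - 2) = ((r / R1) powr p - 1) / p"
  proof -
    have "2 - real n = - p" by (simp add: p_def)
    then have "radial_profile n R1 r = (R1 powr (- p) - r powr (- p)) / p"
      using False by (simp add: radial_profile_def p_def)
    moreover have "r ^ (n - 2) = r powr p"
      using r by (simp add: powr_realpow[symmetric] p')
    moreover have "(inverse B - inverse A) / p * A = (A / B - 1) / p" if "A > 0" "B > 0" for A B :: real
    proof -
      have "(inverse B - inverse A) * A = A / B - 1" using that by (simp add: field_simps)
      then show ?thesis by (metis times_divide_eq_left)
    qed
    ultimately show ?thesis
      using r assms(2) by (simp add: powr_minus powr_divide)
  qed
  have "0 \<le> ((r / R1) powr p - 1) / p"
    using assms p by (auto intro!: divide_nonneg_pos ge_one_powr_ge_zero)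
  moreover have "((r / R1) powr p - 1) / p \<le> sqrt (2 * (real n - 1)) / (real n - 1)"
    using le p by (simp add: X divide_le_eq mult.commute)
  ultimately have "(((r / R1) powr p - 1) / p)\<^sup>2 \<le> (sqrt (2 * (real n - 1)) / (real n - 1))\<^sup>2"
    by (intro power_mono)
  also have "\<dots> = 2 / (real n - 1)"
  proof -
    have "(sqrt (2 * m) / m)\<^sup>2 = 2 / m" if "m > 0" for m :: real
      using that by (simp add: power_divide power2_eq_square[of m])
    then show ?thesis using n1 by blast
  qed
  finally have "(radial_profile n R1 r * r ^ (n - 2))\<^sup>2 \<le> 2 / (real n - 1)" by (simp only: pw)
  then show ?thesis using n1 by (simp add: field_simps)
qed

text \<open>With \<open>V = r ^ n\<close> this is the tangent line inequality for the convex function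
  \<open>V \<mapsto> W\<^sup>2 r ^ (n - 1)\<close>, whose derivative is \<open>q / n\<close>; the radius is critical for \<open>q' \<ge> 0\<close>.\<close>

lemma boundary_weight_tangent_line:
  fixes R1 :: real
  assumes n: "n \<ge> 2" and R1: "0 < R1"
    and s: "R1 \<le> s" "s \<le> critical_radius n R1" and r: "R1 \<le> r" "r \<le> critical_radius n R1"
  obtains \<kappa> where "0 \<le> \<kappa>"
    "\<And>r. R1 \<le> r \<Longrightarrow> r \<le> critical_radius n R1 \<Longrightarrow>
      (radial_profile n R1 s)\<^sup>2 * s ^ (n - 1) + \<kappa> * (r ^ n - s ^ n) \<le> (radial_profile n R1 r)\<^sup>2 * r ^ (n - 1)"
proof -
  define W where "W = radial_profile n R1"
  define q where "q r = 2 * W r / r ^ (n - 1) + (real n - 1) * (W r)\<^sup>2 / r" for r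
  have W': "(W has_real_derivative 1 / r ^ (n - 1)) (at r)" if "r > 0" for r
    unfolding W_def by (rule has_real_derivative_radial_profile[OF n that])
  have Wnn: "0 \<le> W r" if "R1 \<le> r" for r
    using radial_profile_strict_mono[OF n R1, of r R1] that by (cases "r = R1") (auto simp: W_def)
  obtain m where m: "n = Suc (Suc m)" using n by (metis add_2_eq_Suc le_Suc_ex)
  have qmono: "q a \<le> q b" if "R1 \<le> a" "a \<le> b" "b \<le> critical_radius n R1" for a b
  proof (rule DERIV_nonneg_imp_nondecreasing[OF \<open>a \<le> b\<close>])
    fix x assume x: "a \<le> x" "x \<le> b"
    then have x0: "x > 0" using that R1 by simp
    have "(q has_real_derivative
      ((2 * (1 / x ^ (n - 1))) * x ^ (n - 1) - 2 * W x * (real (n - 1) * x ^ (n - 1 - 1))) / (x ^ (n - 1) * x ^ (n - 1))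
      + (((real n - 1) * (2 * (1 / x ^ (n - 1)) * W x)) * x - (real n - 1) * (W x)\<^sup>2 * 1) / (x * x)) (at x)"
      unfolding q_def using x0
      by (auto intro!: derivative_eq_intros W' simp: power2_eq_square)
    \<comment> \<open>The mixed terms cancel, and the remaining numerator is the one that
      \<open>radial_profile_critical\<close> keeps nonnegative.\<close>
    moreover have "((2 * (1 / x ^ (n - 1))) * x ^ (n - 1) - 2 * W x * (real (n - 1) * x ^ (n - 1 - 1))) / (x ^ (n - 1) * x ^ (n - 1))
      + (((real n - 1) * (2 * (1 / x ^ (n - 1)) * W x)) * x - (real n - 1) * (W x)\<^sup>2 * 1) / (x * x)
      = (2 - (real n - 1) * (W x * x ^ (n - 2))\<^sup>2) / (x ^ (n - 1))\<^sup>2"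
      using x0 by (simp add: m power2_eq_square field_simps)
    moreover have "(real n - 1) * (W x * x ^ (n - 2))\<^sup>2 \<le> 2"
      using radial_profile_critical[OF n R1, of x] x that by (simp add: W_def)
    ultimately show "\<exists>y. (q has_real_derivative y) (at x) \<and> 0 \<le> y" by auto
  qed
  \<comment> \<open>Up to a constant, the weight minus its tangent as a function of
    \<open>r ^ n\<close>. Since \<open>q\<close> increases, \<open>k\<close> decreases up to
    \<open>s\<close> and increases after it.\<close>
  define k where "k r = (W r)\<^sup>2 * r ^ (n - 1) - q s / real n * r ^ n" for r
  have k': "(k has_real_derivative x ^ (n - 1) * (q x - q s)) (at x)" if "x > 0" for x
  proof -
    have "(k has_real_derivative (2 * (1 / x ^ (n - 1)) * W x) * x ^ (n - 1) + (W x)\<^sup>2 * (real (n - 1) * x ^ (n - 1 - 1))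
        - q s / real n * (real n * x ^ (n - 1))) (at x)"
      unfolding k_def using that
      by (auto intro!: derivative_eq_intros W' simp: power2_eq_square)
    moreover have "(2 * (1 / x ^ (n - 1)) * W x) * x ^ (n - 1) + (W x)\<^sup>2 * (real (n - 1) * x ^ (n - 1 - 1))
        - q s / real n * (real n * x ^ (n - 1)) = x ^ (n - 1) * (q x - q s)"
      using that by (simp add: q_def[of x] m field_simps)
    ultimately show ?thesis by simp
  qed
  have min: "k s \<le> k r" if r: "R1 \<le> r" "r \<le> critical_radius n R1" for r
  proof (cases "s \<le> r")
    case True
    show ?thesis
    proof (rule DERIV_nonneg_imp_nondecreasing[OF True])
      fix x assume x: "s \<le> x" "x \<le> r"
      then have "x > 0" "q s \<le> q x" using R1 s r by (auto intro: qmono)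
      then show "\<exists>y. (k has_real_derivative y) (at x) \<and> 0 \<le> y" using k' by fastforce
    qed
  next
    case False
    show ?thesis
    proof (rule DERIV_nonpos_imp_nonincreasing[of r s k])
      show "r \<le> s" using False by simp
      fix x assume x: "r \<le> x" "x \<le> s"
      then have "x > 0" "q x \<le> q s" using R1 s r by (auto intro: qmono)
      then have "x ^ (n - 1) * (q x - q s) \<le> 0" by (intro mult_nonneg_nonpos) auto
      then show "\<exists>y. (k has_real_derivative y) (at x) \<and> y \<le> 0" using k'[OF \<open>x > 0\<close>] by blast
    qed
  qed
  show thesis
  proof (rule that[of "q s / real n"])
    show "0 \<le> q s / real n" using Wnn[OF s(1)] R1 s(1) n by (simp add: q_def)
    show "(radial_profile n R1 s)\<^sup>2 * s ^ (n - 1) + q s / real n * (r ^ n - s ^ n) \<le> (radial_profile n R1 r)\<^sup>2 * r ^ (n - 1)"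
      if "R1 \<le> r" "r \<le> critical_radius n R1" for r
      using min[OF that] unfolding k_def W_def right_diff_distrib by linarith
  qed
qed

section \<open>Radial functions of convex sets\<close>

text \<open>For \<open>norm \<xi> = R\<close> this is the distance from the origin to the boundary
  in the direction of \<open>\<xi>\<close>.\<close>

definition radial_function :: "real \<Rightarrow> 'a::real_normed_vector set \<Rightarrow> 'a \<Rightarrow> real" where
  "radial_function R \<Omega> \<xi> = Sup {t. 0 \<le> t \<and> (t / R) *\<^sub>R \<xi> \<in> \<Omega>}"

context
  fixes \<Omega> :: "'a::euclidean_space set" and R :: real
  assumes op: "open \<Omega>" and bd: "bounded \<Omega>" and cv: "convex \<Omega>" and zero: "0 \<in> \<Omega>" and R: "R > 0"
begin

text \<open>Every ray meets the boundary once: a point of the closure beyond the first boundary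
  point would put that point on an open segment lying in the interior.\<close>

lemma radial_function_properties:
  assumes "\<xi> \<noteq> 0"
  shows "0 < radial_function R \<Omega> \<xi>" "(radial_function R \<Omega> \<xi> / R) *\<^sub>R \<xi> \<in> frontier \<Omega>"
    "0 \<le> t \<Longrightarrow> (t / R) *\<^sub>R \<xi> \<in> \<Omega> \<longleftrightarrow> t < radial_function R \<Omega> \<xi>"
    "0 \<le> t \<Longrightarrow> (t / R) *\<^sub>R \<xi> \<in> frontier \<Omega> \<Longrightarrow> t = radial_function R \<Omega> \<xi>"
proof -
  define l where "l = (1 / R) *\<^sub>R \<xi>"
  have l: "l \<noteq> 0" "\<And>t. (t / R) *\<^sub>R \<xi> = t *\<^sub>R l" using assms R by (auto simp: l_def)
  have int: "interior \<Omega> = \<Omega>" "\<Omega> \<inter> frontier \<Omega> = {}"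
    using op by (auto simp: interior_open frontier_def)
  obtain d where d: "0 < d" "d *\<^sub>R l \<in> frontier \<Omega>" "\<And>e. 0 \<le> e \<Longrightarrow> e < d \<Longrightarrow> e *\<^sub>R l \<in> \<Omega>"
    using ray_to_frontier[OF bd, of 0 l] l(1) zero int(1) by auto
  have far: "e *\<^sub>R l \<notin> closure \<Omega>" if "e > d" for e
  proof
    assume "e *\<^sub>R l \<in> closure \<Omega>"
    then have "open_segment 0 (e *\<^sub>R l) \<subseteq> \<Omega>"
      using in_interior_closure_convex_segment[OF cv, of 0 "e *\<^sub>R l"] zero int(1) by simp
    moreover have "d *\<^sub>R l \<in> open_segment 0 (e *\<^sub>R l)"
      using that d(1) l(1) by (auto simp: in_segment intro!: exI[of _ "d / e"])
    ultimately show False using d(2) int(2) by blast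
  qed
  have mem: "e *\<^sub>R l \<in> \<Omega> \<longleftrightarrow> e < d" if "0 \<le> e" for e
  proof
    assume "e *\<^sub>R l \<in> \<Omega>"
    then show "e < d" using far[of e] closure_subset[of \<Omega>] d(2) int(2)
      by (cases "e < d"; cases "e = d") auto
  qed (use d(3) that in auto)
  then have "{t. 0 \<le> t \<and> (t / R) *\<^sub>R \<xi> \<in> \<Omega>} = {0..<d}" by (auto simp: l(2))
  then have rd: "radial_function R \<Omega> \<xi> = d"
    using d(1) by (simp add: radial_function_def)
  show "0 < radial_function R \<Omega> \<xi>" "(radial_function R \<Omega> \<xi> / R) *\<^sub>R \<xi> \<in> frontier \<Omega>"
    using d by (simp_all add: rd l(2))
  show "(t / R) *\<^sub>R \<xi> \<in> \<Omega> \<longleftrightarrow> t < radial_function R \<Omega> \<xi>" if "0 \<le> t"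
    using mem[OF that] by (simp add: rd l(2))
  show "t = radial_function R \<Omega> \<xi>" if "0 \<le> t" "(t / R) *\<^sub>R \<xi> \<in> frontier \<Omega>"
  proof -
    have "t *\<^sub>R l \<in> closure \<Omega>" "t *\<^sub>R l \<notin> \<Omega>"
      using that(2) int(2) by (auto simp: l(2) frontier_def)
    then show ?thesis using far[of t] mem[OF that(1)] by (cases "t > d") (auto simp: rd)
  qed
qed

lemma radial_function_frontier:
  assumes "x \<in> frontier \<Omega>"
  shows "x \<noteq> 0" "radial_function R \<Omega> (sphere_proj R x) = norm x"
proof -
  show x: "x \<noteq> 0" using assms zero op by (auto simp: frontier_def interior_open)
  have "(norm x / R) *\<^sub>R sphere_proj R x = x" using x R by (simp add: sphere_proj_def)
  moreover have "sphere_proj R x \<noteq> 0" using x R by (simp add: sphere_proj_def)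
  ultimately show "radial_function R \<Omega> (sphere_proj R x) = norm x"
    using radial_function_properties(4)[of "sphere_proj R x" "norm x"] assms by simp
qed

lemma measurable_radial_function: "radial_function R \<Omega> \<in> borel_measurable borel"
proof (rule borel_measurableI_greater)
  fix t
  have meas: "{\<xi>. (t / R) *\<^sub>R \<xi> \<in> \<Omega>} \<in> sets borel"
  proof -
    have "open ((\<lambda>\<xi>. (t / R) *\<^sub>R \<xi>) -` \<Omega>)"
      by (intro open_vimage op continuous_intros)
    then show ?thesis by (simp add: vimage_def borel_open)
  qed
  \<comment> \<open>At the origin the supremum runs over an unbounded set, so this point is split
    off; elsewhere, for \<open>t \<ge> 0\<close>, the condition is membership in an open
    set.\<close>
  have "{\<xi>. t < radial_function R \<Omega> \<xi>} = {\<xi> \<in> - {0}. t < 0 \<or> (t / R) *\<^sub>R \<xi> \<in> \<Omega>} \<union> {\<xi> \<in> {0}. t < radial_function R \<Omega> 0}"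
  proof -
    have key: "t < radial_function R \<Omega> \<xi> \<longleftrightarrow> t < 0 \<or> (t / R) *\<^sub>R \<xi> \<in> \<Omega>" if "\<xi> \<noteq> 0" for \<xi>
    proof (cases "t < 0")
      case True
      then show ?thesis using radial_function_properties(1)[OF that] by simp
    next
      case False
      then show ?thesis using radial_function_properties(3)[OF that, of t] by simp
    qed
    show ?thesis
    proof (rule set_eqI)
      fix \<xi>
      show "\<xi> \<in> {\<xi>. t < radial_function R \<Omega> \<xi>} \<longleftrightarrow>
        \<xi> \<in> {\<xi> \<in> - {0}. t < 0 \<or> (t / R) *\<^sub>R \<xi> \<in> \<Omega>} \<union> {\<xi> \<in> {0}. t < radial_function R \<Omega> 0}"
        using key[of \<xi>] by (cases "\<xi> = 0") simp_all
    qed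
  qed
  moreover have "{\<xi> \<in> - {0}. t < 0 \<or> (t / R) *\<^sub>R \<xi> \<in> \<Omega>} = (if t < 0 then - {0} else - {0} \<inter> {\<xi>. (t / R) *\<^sub>R \<xi> \<in> \<Omega>})"
    by auto
  moreover have "{\<xi> \<in> {0::'a}. t < radial_function R \<Omega> 0} \<in> sets borel"
    by (cases "t < radial_function R \<Omega> 0") auto
  ultimately have "{\<xi>. t < radial_function R \<Omega> \<xi>} \<in> sets borel"
    using meas by auto
  then show "{\<xi> \<in> space borel. t < radial_function R \<Omega> \<xi>} \<in> sets borel" by simp
qed

lemma nn_integral_radial_function_power:
  "(\<integral>\<^sup>+\<xi>. ennreal ((radial_function R \<Omega> \<xi> / R) ^ DIM('a)) \<partial>polar_measure R) = emeasure lborel \<Omega>"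
proof -
  have "emeasure lborel \<Omega> = (\<integral>\<^sup>+x. indicator \<Omega> x \<partial>lborel)"
    using op by (simp add: borel_open)
  also have "\<dots> = (\<integral>\<^sup>+\<xi>. (\<integral>\<^sup>+r. ennreal (radial_density DIM('a) R r) * indicator \<Omega> ((r / R) *\<^sub>R \<xi>) \<partial>lborel) \<partial>polar_measure R)"
    using op by (intro nn_integral_polar[OF R] borel_measurable_indicator) (auto simp: borel_open)
  also have "\<dots> = (\<integral>\<^sup>+\<xi>. ennreal ((radial_function R \<Omega> \<xi> / R) ^ DIM('a)) \<partial>polar_measure R)"
  proof (rule nn_integral_cong_AE)
    show "AE \<xi> in polar_measure R. (\<integral>\<^sup>+r. ennreal (radial_density DIM('a) R r) * indicator \<Omega> ((r / R) *\<^sub>R \<xi>) \<partial>lborel)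
        = ennreal ((radial_function R \<Omega> \<xi> / R) ^ DIM('a))"
      using AE_polar_measure_sphere[OF R]
    proof eventually_elim
      case (elim \<xi>)
      then have "\<xi> \<noteq> 0" using R by auto
      note \<rho> = radial_function_properties[OF this]
      have "(\<integral>\<^sup>+r. ennreal (radial_density DIM('a) R r) * indicator \<Omega> ((r / R) *\<^sub>R \<xi>) \<partial>lborel) =
          (\<integral>\<^sup>+r. ennreal (radial_density DIM('a) R r) * indicator {..radial_function R \<Omega> \<xi>} r \<partial>lborel)"
      proof (rule nn_integral_cong_AE)
        show "AE r in lborel. ennreal (radial_density DIM('a) R r) * indicator \<Omega> ((r / R) *\<^sub>R \<xi>) =
            ennreal (radial_density DIM('a) R r) * indicator {..radial_function R \<Omega> \<xi>} r"
          using AE_lborel_singleton[of "radial_function R \<Omega> \<xi>"]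
        proof eventually_elim
          case (elim r)
          then show ?case
            using \<rho>(3)[of r] by (cases "0 < r") (auto simp: radial_density_def indicator_def)
        qed
      qed
      also have "\<dots> = ennreal ((radial_function R \<Omega> \<xi> / R) ^ DIM('a))"
        by (rule nn_integral_radial_density[OF R \<rho>(1) DIM_positive])
      finally show ?case .
    qed
  qed
  finally show ?thesis by simp
qed

end

section \<open>The weighted perimeter of a convex set\<close>

text \<open>For the unit vectors \<open>u\<close> and \<open>v\<close> of \<open>x\<close> and
  \<open>y\<close>, the squared distance of \<open>x\<close> and \<open>y\<close> exceeds
  \<open>norm x * norm y\<close> times that of \<open>u\<close> and \<open>v\<close> by
  \<open>(norm x - norm y)\<^sup>2\<close>.\<close>

lemma sphere_proj_lipschitz:
  fixes x y :: "'a::real_inner"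
  assumes "0 < r" "r \<le> norm x" "r \<le> norm y" "0 \<le> R"
  shows "dist (sphere_proj R x) (sphere_proj R y) \<le> (R / r) * dist x y"
proof -
  define u v where "u = (1 / norm x) *\<^sub>R x" and "v = (1 / norm y) *\<^sub>R y"
  have n: "norm x > 0" "norm y > 0" using assms by auto
  have u: "u \<bullet> u = 1" "v \<bullet> v = 1" "x = norm x *\<^sub>R u" "y = norm y *\<^sub>R v"
    using n by (auto simp: u_def v_def simp flip: power2_norm_eq_inner power2_eq_square)
  have uv: "(norm (u - v))\<^sup>2 = 2 - 2 * (u \<bullet> v)"
    by (simp add: power2_norm_eq_inner inner_diff_left inner_diff_right u(1,2) inner_commute)
  have "(norm (norm x *\<^sub>R u - norm y *\<^sub>R v))\<^sup>2 = (norm x)\<^sup>2 + (norm y)\<^sup>2 - 2 * (norm x * norm y) * (u \<bullet> v)"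
    by (simp add: power2_norm_eq_inner[of "norm x *\<^sub>R u - norm y *\<^sub>R v"] inner_diff_left inner_diff_right u(1,2)
        inner_commute[of v u] power2_eq_square[of "norm x"] power2_eq_square[of "norm y"] algebra_simps)
  then have xy: "(norm (x - y))\<^sup>2 = (norm x)\<^sup>2 + (norm y)\<^sup>2 - 2 * (norm x * norm y) * (u \<bullet> v)"
    using u(3,4) by simp
  have "(r * norm (u - v))\<^sup>2 = (r * r) * (norm (u - v))\<^sup>2" by (simp add: power2_eq_square)
  also have "\<dots> \<le> (norm x * norm y) * (norm (u - v))\<^sup>2"
    using assms by (intro mult_right_mono mult_mono) auto
  also have "\<dots> \<le> (norm (x - y))\<^sup>2"
    using zero_le_power2[of "norm x - norm y"] unfolding uv xy by (simp add: power2_diff algebra_simps)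
  finally have "r * norm (u - v) \<le> norm (x - y)" by (rule power2_le_imp_le) simp
  then have "norm (u - v) \<le> norm (x - y) / r" using assms(1) by (simp add: pos_le_divide_eq mult.commute)
  then have "R * norm (u - v) \<le> R * (norm (x - y) / r)" using assms(4) by (rule mult_left_mono)
  moreover have "sphere_proj R x - sphere_proj R y = R *\<^sub>R (u - v)"
    by (simp add: sphere_proj_def u_def v_def scaleR_diff_right)
  ultimately show ?thesis using assms(4) by (simp add: dist_norm)
qed

context
  fixes \<Omega> :: "(real^'n) set" and R a :: real
  assumes op: "open \<Omega>" and bd: "bounded \<Omega>" and cv: "convex \<Omega>" and a: "0 < a" "cball 0 a \<subseteq> \<Omega>" and R: "R > 0"
    and nz: "emeasure (sphere_measure R :: (real^'n) measure) UNIV \<noteq> 0"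
begin

text \<open>The boundary measure pushed to the sphere, weighted by the largest factor by which
  projection can enlarge area at distance \<open>norm x\<close>. It encodes the local Lipschitz
  estimates in one inequality between measures.\<close>

definition projected_perimeter :: "(real^'n) measure" where
  "projected_perimeter = distr (density (hausdorff_measure (real CARD('n) - 1))
     (\<lambda>x. ennreal ((R / norm x) ^ (CARD('n) - 1)) * indicator (frontier \<Omega>) x)) borel (sphere_proj R)"

lemma zero_mem: "0 \<in> \<Omega>"
  using a by auto

lemma frontier_borel [measurable]: "frontier \<Omega> \<in> sets borel"
  by (simp add: borel_closed)

lemma frontier_norm_ge: "x \<in> frontier \<Omega> \<Longrightarrow> a \<le> norm x"
  using a(2) op by (force simp: frontier_def interior_open)

lemma nn_integral_projected_perimeter:
  assumes [measurable]: "f \<in> borel_measurable borel"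
  shows "(\<integral>\<^sup>+\<xi>. f \<xi> \<partial>projected_perimeter) =
    (\<integral>\<^sup>+x. ennreal ((R / norm x) ^ (CARD('n) - 1)) * indicator (frontier \<Omega>) x * f (sphere_proj R x)
      \<partial>hausdorff_measure (real CARD('n) - 1))"
proof -
  let ?H = "hausdorff_measure (real CARD('n) - 1) :: (real^'n) measure"
  have [measurable]: "indicator (frontier \<Omega>) \<in> borel_measurable ?H"
    by (intro borel_measurable_indicator) (simp add: frontier_borel)
  show ?thesis
    unfolding projected_perimeter_def
    by (subst nn_integral_distr, measurable, subst nn_integral_density) measurable
qed

text \<open>The Lipschitz constant of the projection depends on the distance, so directions are
  sliced by the radial function into geometric layers of ratio \<open>\<theta>\<close>. Within a
  layer, the area factor of the inner radius and the weight differ by at most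
  \<open>\<theta> ^ (n - 1)\<close>.\<close>

lemma sphere_measure_le_dilated_perimeter:
  assumes \<theta>: "1 < \<theta>" and [measurable]: "A \<in> sets borel"
  shows "emeasure (sphere_measure R) A \<le> ennreal (\<theta> ^ (CARD('n) - 1)) * emeasure projected_perimeter A"
proof -
  let ?s = "real CARD('n) - 1" and ?N = "CARD('n) - 1"
  have s: "?s = real ?N" "0 \<le> ?s" by (simp_all add: of_nat_diff Suc_leI)
  let ?H = "hausdorff_measure ?s :: (real^'n) measure"
  let ?\<rho> = "radial_function R \<Omega>"
  note [measurable] = measurable_radial_function[OF op bd cv zero_mem R]
  define S where "S = sphere (0::real^'n) R"
  have [measurable]: "S \<in> sets borel" by (simp add: S_def borel_closed)
  \<comment> \<open>The \<open>i\<close> with \<open>a * \<theta> ^ i \<le> ?\<rho> \<xi> < a *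
    \<theta> ^ (i + 1)\<close>; the logarithm is nonnegative on the sphere because the boundary
    stays at distance at least \<open>a\<close>.\<close>
  define idx where "idx \<xi> = nat \<lfloor>log \<theta> (?\<rho> \<xi> / a)\<rfloor>" for \<xi>
  have [measurable]: "idx \<in> borel \<rightarrow>\<^sub>M count_space UNIV"
    unfolding idx_def[abs_def] by measurable
  define B where "B i = {\<xi> \<in> A \<inter> S. idx \<xi> = i}" for i
  have [measurable]: "B i \<in> sets borel" for i unfolding B_def by measurable
  have nzH: "emeasure ?H S \<noteq> 0" using nz by (simp add: emeasure_sphere_measure S_def)
  have slice: "emeasure (sphere_measure R) (B i) \<le> ennreal (\<theta> ^ ?N) * emeasure projected_perimeter (B i)" for i
  proof -
    define r where "r = a * \<theta> ^ i"
    have r: "r > 0" using a \<theta> by (simp add: r_def)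
    define E where "E = {x \<in> frontier \<Omega>. sphere_proj R x \<in> B i}"
    have [measurable]: "E \<in> sets borel" unfolding E_def by measurable
    have \<rho>_bounds: "r \<le> ?\<rho> \<xi> \<and> ?\<rho> \<xi> < \<theta> * r" if \<xi>: "\<xi> \<in> B i" for \<xi>
    proof -
      have "norm \<xi> = R" "idx \<xi> = i" using \<xi> by (auto simp: B_def S_def)
      then have "\<xi> \<noteq> 0" using R by auto
      note \<rho> = radial_function_properties[OF op bd cv zero_mem R this]
      have "a \<le> norm ((?\<rho> \<xi> / R) *\<^sub>R \<xi>)" using \<rho>(2) by (rule frontier_norm_ge)
      then have a\<rho>: "1 \<le> ?\<rho> \<xi> / a" using \<rho>(1) R a(1) \<open>norm \<xi> = R\<close> by simp
      then have "0 \<le> log \<theta> (?\<rho> \<xi> / a)" using \<theta> by simp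
      then have fl: "real i \<le> log \<theta> (?\<rho> \<xi> / a)" "log \<theta> (?\<rho> \<xi> / a) < real i + 1"
        using \<open>idx \<xi> = i\<close> unfolding idx_def by linarith+
      have "\<theta> powr real i \<le> ?\<rho> \<xi> / a" using fl(1) \<theta> a\<rho> by (simp add: powr_le_iff)
      moreover have "?\<rho> \<xi> / a < \<theta> powr (real i + 1)" using fl(2) \<theta> a\<rho> by (simp add: less_powr_iff)
      ultimately show ?thesis
        using a(1) \<theta> by (simp add: r_def powr_add powr_realpow field_simps)
    qed
    have E_bounds: "r \<le> norm x \<and> norm x < \<theta> * r" if "x \<in> E" for x
      using \<rho>_bounds[of "sphere_proj R x"] that radial_function_frontier(2)[OF op bd cv zero_mem R, of x]
      by (auto simp: E_def)
    have "B i \<subseteq> sphere_proj R ` E"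
    proof
      fix \<xi> assume \<xi>: "\<xi> \<in> B i"
      then have "norm \<xi> = R" by (auto simp: B_def S_def)
      then have "\<xi> \<noteq> 0" using R by auto
      note \<rho> = radial_function_properties[OF op bd cv zero_mem R this]
      have "sphere_proj R ((?\<rho> \<xi> / R) *\<^sub>R \<xi>) = \<xi>"
        using \<rho>(1) R \<open>norm \<xi> = R\<close> by (simp add: sphere_proj_def)
      then show "\<xi> \<in> sphere_proj R ` E"
        using \<rho>(2) \<xi> by (intro image_eqI[of _ _ "(?\<rho> \<xi> / R) *\<^sub>R \<xi>"]) (auto simp: E_def)
    qed
    then have "hausdorff_outer ?s (B i) \<le> hausdorff_outer ?s (sphere_proj R ` E)"
      by (rule hausdorff_outer_mono)
    also have "\<dots> \<le> ennreal ((R / r) powr ?s) * hausdorff_outer ?s E"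
      using E_bounds r R s by (intro hausdorff_outer_lipschitz_image sphere_proj_lipschitz) auto
    also have "(R / r) powr ?s = (R / r) ^ ?N"
      using R r unfolding s(1) by (intro powr_realpow) simp
    also have "hausdorff_outer ?s E = emeasure ?H E"
      using emeasure_hausdorff_measure[OF nzH] by simp
    also have "ennreal ((R / r) ^ ?N) * emeasure ?H E = (\<integral>\<^sup>+x. ennreal ((R / r) ^ ?N) * indicator E x \<partial>?H)"
      by (simp add: nn_integral_cmult_indicator)
    also have "\<dots> \<le> (\<integral>\<^sup>+x. ennreal (\<theta> ^ ?N) *
        (ennreal ((R / norm x) ^ ?N) * indicator (frontier \<Omega>) x * indicator (B i) (sphere_proj R x)) \<partial>?H)"
    proof (rule nn_integral_mono)
      fix x
      show "ennreal ((R / r) ^ ?N) * indicator E x \<le> ennreal (\<theta> ^ ?N) *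
        (ennreal ((R / norm x) ^ ?N) * indicator (frontier \<Omega>) x * indicator (B i) (sphere_proj R x))"
      proof (cases "x \<in> E")
        case True
        then have "r \<le> norm x" "norm x \<le> \<theta> * r" using E_bounds by fastforce+
        then have "R * norm x \<le> R * (\<theta> * r)" "0 < norm x"
          using r R by (auto intro: mult_left_mono)
        then have "R / r \<le> \<theta> * (R / norm x)"
          using r by (simp add: field_simps)
        then have "(R / r) ^ ?N \<le> \<theta> ^ ?N * (R / norm x) ^ ?N"
          using R r \<theta> by (simp only: power_mult_distrib[symmetric], intro power_mono) auto
        then show ?thesis
          using True R \<theta> by (simp add: E_def ennreal_leI flip: ennreal_mult')
      qed simp
    qed
    also have "\<dots> = ennreal (\<theta> ^ ?N) * (\<integral>\<^sup>+\<xi>. indicator (B i) \<xi> \<partial>projected_perimeter)"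
    proof -
      have [measurable]: "indicator (frontier \<Omega>) \<in> borel_measurable ?H"
        by (intro borel_measurable_indicator) (simp add: frontier_borel)
      show ?thesis
        by (subst nn_integral_projected_perimeter, measurable, rule nn_integral_cmult) measurable
    qed
    also have "(\<integral>\<^sup>+\<xi>. indicator (B i) \<xi> \<partial>projected_perimeter) = emeasure projected_perimeter (B i)"
      by (simp add: projected_perimeter_def)
    finally have "hausdorff_outer ?s (B i) \<le> ennreal (\<theta> ^ ?N) * emeasure projected_perimeter (B i)" .
    moreover have "emeasure (sphere_measure R) (B i) = hausdorff_outer ?s (B i)"
    proof -
      have "B i \<inter> sphere 0 R = B i" by (auto simp: B_def S_def)
      then show ?thesis using emeasure_hausdorff_measure[OF nzH] by (simp add: emeasure_sphere_measure)
    qed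
    ultimately show ?thesis by simp
  qed
  have disj: "disjoint_family B" by (auto simp: disjoint_family_on_def B_def)
  have rB: "range B \<subseteq> sets borel" by auto
  have UB: "(\<Union>i. B i) = A \<inter> S" by (auto simp: B_def)
  have "emeasure (sphere_measure R) A = emeasure (sphere_measure R) (A \<inter> S)"
    by (simp add: emeasure_sphere_measure S_def)
  also have "\<dots> = (\<Sum>i. emeasure (sphere_measure R) (B i))"
    using suminf_emeasure[of B "sphere_measure R", OF _ disj] rB by (simp add: UB)
  also have "\<dots> \<le> (\<Sum>i. ennreal (\<theta> ^ ?N) * emeasure projected_perimeter (B i))"
    by (intro suminf_le slice) auto
  also have "\<dots> = ennreal (\<theta> ^ ?N) * emeasure projected_perimeter (A \<inter> S)"
    using suminf_emeasure[of B projected_perimeter, OF _ disj] rB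
    by (simp add: UB projected_perimeter_def)
  also have "\<dots> \<le> ennreal (\<theta> ^ ?N) * emeasure projected_perimeter A"
    by (intro mult_left_mono emeasure_mono) (auto simp: projected_perimeter_def)
  finally show ?thesis .
qed

text \<open>The ratio \<open>\<theta>\<close> of the layers tends to one.\<close>

lemma sphere_measure_le_projected_perimeter: "sphere_measure R \<le> projected_perimeter"
proof -
  have sets: "sets projected_perimeter = sets borel" "space projected_perimeter = UNIV"
    by (simp_all add: projected_perimeter_def)
  have "emeasure (sphere_measure R) A \<le> emeasure projected_perimeter A" for A
  proof (cases "A \<in> sets borel")
    case A: True
    show ?thesis
    proof (cases "emeasure projected_perimeter A = top")
      case False
      have "(\<lambda>k. emeasure projected_perimeter A * ennreal ((1 + inverse (real (Suc k))) ^ (CARD('n) - 1)))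
          \<longlonglongrightarrow> emeasure projected_perimeter A * ennreal ((1 + 0) ^ (CARD('n) - 1))"
        using False
        by (intro ennreal_tendsto_cmult tendsto_ennrealI tendsto_intros LIMSEQ_inverse_real_of_nat) (simp add: less_top)
      then have "emeasure (sphere_measure R) A \<le> emeasure projected_perimeter A * ennreal ((1 + 0) ^ (CARD('n) - 1))"
      proof (rule LIMSEQ_le_const)
        have "emeasure (sphere_measure R) A \<le> emeasure projected_perimeter A * ennreal ((1 + inverse (real (Suc k))) ^ (CARD('n) - 1))" for k
          using sphere_measure_le_dilated_perimeter[OF _ A, of "1 + inverse (real (Suc k))"]
          by (simp add: mult.commute del: of_nat_Suc)
        then show "\<exists>N. \<forall>k\<ge>N. emeasure (sphere_measure R) A \<le>
            emeasure projected_perimeter A * ennreal ((1 + inverse (real (Suc k))) ^ (CARD('n) - 1))"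
          by blast
      qed
      then show ?thesis by simp
    qed simp
  qed (simp add: emeasure_notin_sets)
  then show ?thesis
    by (simp add: le_measure_iff sets le_fun_def)
qed

text \<open>In the tangent line inequality the linear term integrates to zero, because the volume
  makes the mean of \<open>(?\<rho> \<xi> / R) ^ n\<close> over the sphere equal to one. On the
  boundary the weight of \<open>projected_perimeter\<close> then cancels the factor
  \<open>(?\<rho> \<xi> / R) ^ (n - 1)\<close>.\<close>

theorem weighted_perimeter_ge:
  fixes R1 :: real
  assumes n: "CARD('n) \<ge> 2" and R1: "0 < R1" "cball 0 R1 \<subseteq> \<Omega>" "R1 \<le> R" "R \<le> critical_radius CARD('n) R1"
    and crit: "\<Omega> \<subseteq> ball 0 (critical_radius CARD('n) R1)"
    and vol: "emeasure lborel \<Omega> = ennreal (unit_ball_vol CARD('n) * R ^ CARD('n))"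
  shows "emeasure (sphere_measure R :: (real^'n) measure) UNIV * ennreal ((radial_profile CARD('n) R1 R)\<^sup>2)
    \<le> (\<integral>\<^sup>+x. ennreal ((radial_profile CARD('n) R1 (norm x))\<^sup>2) \<partial>surface_measure (frontier \<Omega>))"
proof -
  let ?n = "CARD('n)" and ?S = "sphere_measure R :: (real^'n) measure" and ?\<rho> = "radial_function R \<Omega>"
  let ?b = "critical_radius ?n R1"
  define W where "W = radial_profile ?n R1"
  obtain N where N: "?n = Suc N" using n by (cases "CARD('n)") auto
  note [measurable] = measurable_radial_function[OF op bd cv zero_mem R]
  have [measurable]: "W \<in> borel_measurable borel"
    unfolding W_def radial_profile_def[abs_def] by measurable
  interpret S: finite_measure ?S by (rule finite_measure_sphere_measure[OF R])
  obtain \<kappa> where \<kappa>: "0 \<le> \<kappa>"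
    "\<And>r. R1 \<le> r \<Longrightarrow> r \<le> ?b \<Longrightarrow> (W R)\<^sup>2 * R ^ N + \<kappa> * (r ^ ?n - R ^ ?n) \<le> (W r)\<^sup>2 * r ^ N"
    using boundary_weight_tangent_line[OF n R1(1,3,4) R1(3,4)] unfolding W_def N by auto
  have AES: "AE \<xi> in ?S. \<xi> \<in> sphere 0 R"
    unfolding sphere_measure_def
    by (subst AE_density) (auto intro!: AE_I2 borel_measurable_indicator borel_closed split: split_indicator_asm)
  \<comment> \<open>Dividing the tangent line inequality by \<open>R ^ (n - 1)\<close> turns its
    linear term into \<open>\<kappa> * R\<close> times \<open>(?\<rho> \<xi> / R) ^ n - 1\<close>.
    The negative part is moved across, as the integrals are taken in \<open>ennreal\<close>.\<close>
  define c where "c = \<kappa> * R"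
  have c: "0 \<le> c" using \<kappa>(1) R by (simp add: c_def)
  have pointwise: "(W R)\<^sup>2 + c * (?\<rho> \<xi> / R) ^ ?n \<le> (W (?\<rho> \<xi>))\<^sup>2 * (?\<rho> \<xi> / R) ^ N + c"
    if "\<xi> \<in> sphere 0 R" for \<xi>
  proof -
    have \<xi>: "norm \<xi> = R" "\<xi> \<noteq> 0" using that R by auto
    note \<rho> = radial_function_properties[OF op bd cv zero_mem R \<xi>(2)]
    have "(R1 / R) *\<^sub>R \<xi> \<in> \<Omega>" using R1 R \<xi> by auto
    then have lo: "R1 \<le> ?\<rho> \<xi>" using \<rho>(3)[of R1] R1(1) by simp
    have hi: "?\<rho> \<xi> \<le> ?b"
    proof (rule dense_le)
      fix t assume t: "t < ?\<rho> \<xi>"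
      show "t \<le> ?b"
      proof (cases "t \<ge> 0")
        case True
        then have "(t / R) *\<^sub>R \<xi> \<in> ball 0 ?b" using \<rho>(3)[of t] t crit by blast
        then show ?thesis using True R \<xi> by simp
      qed (use R1 in simp)
    qed
    have "((W R)\<^sup>2 * R ^ N + \<kappa> * (?\<rho> \<xi> ^ ?n - R ^ ?n)) / R ^ N \<le> (W (?\<rho> \<xi>))\<^sup>2 * ?\<rho> \<xi> ^ N / R ^ N"
      using \<kappa>(2)[OF lo hi] R by (intro divide_right_mono) auto
    then show ?thesis
      using R by (simp add: N c_def power_divide field_simps)
  qed
  \<comment> \<open>In polar coordinates the integral is the volume of \<open>\<Omega>\<close>,
    which by \<open>vol\<close> is the total mass of \<open>polar_measure R\<close>; proportionality
    carries this mean over to the sphere.\<close>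
  have X: "(\<integral>\<^sup>+\<xi>. ennreal ((?\<rho> \<xi> / R) ^ ?n) \<partial>?S) = emeasure ?S UNIV"
  proof -
    let ?V = "emeasure (polar_measure R :: (real^'n) measure) UNIV"
    have "?V = ennreal (unit_ball_vol ?n * R ^ ?n)"
      using emeasure_polar_measure_UNIV[OF R, where ?'a = "real^'n"] by simp
    then have V: "?V \<noteq> 0" "?V \<noteq> top" "(\<integral>\<^sup>+\<xi>. ennreal ((?\<rho> \<xi> / R) ^ ?n) \<partial>polar_measure R) = ?V"
      using nn_integral_radial_function_power[OF op bd cv zero_mem R] vol R
      by (auto simp: less_imp_neq[OF unit_ball_vol_pos, symmetric] mult_eq_0_iff not_le ennreal_eq_0_iff)
    have "?V * (\<integral>\<^sup>+\<xi>. ennreal ((?\<rho> \<xi> / R) ^ ?n) \<partial>?S) = emeasure ?S UNIV * (\<integral>\<^sup>+\<xi>. ennreal ((?\<rho> \<xi> / R) ^ ?n) \<partial>polar_measure R)"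
      using arg_cong[OF sphere_measure_eq_polar_measure[OF R nz], of "\<lambda>M. \<integral>\<^sup>+\<xi>. ennreal ((?\<rho> \<xi> / R) ^ ?n) \<partial>M"]
      by (simp add: nn_integral_scale_measure)
    then have "?V * (\<integral>\<^sup>+\<xi>. ennreal ((?\<rho> \<xi> / R) ^ ?n) \<partial>?S) = ?V * emeasure ?S UNIV"
      by (simp add: V(3) mult.commute)
    then show ?thesis using V(1,2) by (simp add: ennreal_mult_cancel_left)
  qed
  define f where "f \<xi> = ennreal ((W (?\<rho> \<xi>))\<^sup>2 * (?\<rho> \<xi> / R) ^ N)" for \<xi>
  have [measurable]: "f \<in> borel_measurable borel" unfolding f_def[abs_def] by measurable
  have "ennreal c * emeasure ?S UNIV + emeasure ?S UNIV * ennreal ((W R)\<^sup>2) =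
      (\<integral>\<^sup>+\<xi>. ennreal c * ennreal ((?\<rho> \<xi> / R) ^ ?n) + ennreal ((W R)\<^sup>2) \<partial>?S)"
    by (subst nn_integral_add, measurable, subst nn_integral_cmult, measurable) (simp add: X mult.commute)
  also have "\<dots> \<le> (\<integral>\<^sup>+\<xi>. ennreal c + f \<xi> \<partial>?S)"
  proof (rule nn_integral_mono_AE)
    show "AE \<xi> in ?S. ennreal c * ennreal ((?\<rho> \<xi> / R) ^ ?n) + ennreal ((W R)\<^sup>2) \<le> ennreal c + f \<xi>"
      using AES
    proof eventually_elim
      case (elim \<xi>)
      then have "\<xi> \<noteq> 0" using R by auto
      then have \<rho>: "0 < ?\<rho> \<xi>" by (rule radial_function_properties(1)[OF op bd cv zero_mem R])
      have "ennreal c * ennreal ((?\<rho> \<xi> / R) ^ ?n) + ennreal ((W R)\<^sup>2) = ennreal ((W R)\<^sup>2 + c * (?\<rho> \<xi> / R) ^ ?n)"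
        using c \<rho> R by (simp add: ennreal_plus ennreal_mult' add.commute)
      also have "\<dots> \<le> ennreal ((W (?\<rho> \<xi>))\<^sup>2 * (?\<rho> \<xi> / R) ^ N + c)"
        by (rule ennreal_leI[OF pointwise[OF elim]])
      also have "\<dots> = ennreal c + f \<xi>"
        using c \<rho> R by (simp add: f_def ennreal_plus add.commute)
      finally show ?case .
    qed
  qed
  also have "\<dots> = ennreal c * emeasure ?S UNIV + (\<integral>\<^sup>+\<xi>. f \<xi> \<partial>?S)"
    by (subst nn_integral_add) auto
  finally have "emeasure ?S UNIV * ennreal ((W R)\<^sup>2) \<le> (\<integral>\<^sup>+\<xi>. f \<xi> \<partial>?S)"
    by (simp add: ennreal_add_left_cancel_le ennreal_mult_eq_top_iff S.emeasure_eq_measure)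
  also have "\<dots> \<le> (\<integral>\<^sup>+\<xi>. f \<xi> \<partial>projected_perimeter)"
    by (intro nn_integral_mono_measure sphere_measure_le_projected_perimeter) (simp add: projected_perimeter_def)
  also have "\<dots> = (\<integral>\<^sup>+x. ennreal ((R / norm x) ^ (?n - 1)) * indicator (frontier \<Omega>) x * f (sphere_proj R x)
      \<partial>hausdorff_measure (real ?n - 1))"
    by (rule nn_integral_projected_perimeter) measurable
  also have "\<dots> = (\<integral>\<^sup>+x. ennreal ((W (norm x))\<^sup>2) * indicator (frontier \<Omega>) x \<partial>hausdorff_measure (real ?n - 1))"
  proof (rule nn_integral_cong)
    fix x :: "real^'n"
    show "ennreal ((R / norm x) ^ (?n - 1)) * indicator (frontier \<Omega>) x * f (sphere_proj R x) =
        ennreal ((W (norm x))\<^sup>2) * indicator (frontier \<Omega>) x"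
    proof (cases "x \<in> frontier \<Omega>")
      case True
      note x = radial_function_frontier[OF op bd cv zero_mem R True]
      have "(R / norm x) ^ N * ((W (norm x))\<^sup>2 * (norm x / R) ^ N) = (W (norm x))\<^sup>2"
        using x(1) R by (simp add: power_divide)
      then show ?thesis
        using True R by (simp add: f_def x(2) N flip: ennreal_mult')
    qed simp
  qed
  also have "\<dots> = (\<integral>\<^sup>+x. ennreal ((W (norm x))\<^sup>2) \<partial>surface_measure (frontier \<Omega>))"
    by (rule nn_integral_surface_measure[symmetric]) (rule frontier_borel)
  finally show ?thesis by (simp add: W_def)
qed

end

section \<open>The energy of the radial profile\<close>

text \<open>The polar weight \<open>r ^ (n - 1)\<close> times the square of
  \<open>1 / r ^ (n - 1)\<close> is again the derivative of the profile, so the radial integral is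
  its increment.\<close>

lemma nn_integral_profile_energy_shell:
  assumes n: "CARD('n) \<ge> 2" and R: "0 < R1" "R1 < R2"
  shows "(\<integral>\<^sup>+x. ennreal ((1 / norm x ^ (CARD('n) - 1))\<^sup>2) * indicator (shell R1 R2) (x :: real^'n) \<partial>lborel) =
    ennreal (real CARD('n) * unit_ball_vol CARD('n) * radial_profile CARD('n) R1 R2)"
proof -
  let ?n = "CARD('n)" and ?W = "radial_profile CARD('n) R1"
  have R2: "R2 > 0" using R by simp
  have W: "?W R2 > 0" by (rule radial_profile_pos[OF n R])
  obtain N where N: "?n = Suc N" using n by (cases "CARD('n)") auto
  have [measurable]: "shell R1 R2 \<in> sets (borel :: (real^'n) measure)"
    by (simp add: shell_eq_ball_diff_cball)
  define c where "c = real ?n / R2 ^ ?n"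
  have c: "c \<ge> 0" using R2 by (simp add: c_def)
  let ?I = "\<lambda>(\<xi> :: real^'n) r. ennreal (radial_density DIM(real^'n) R2 r) *
    (ennreal ((1 / norm ((r / R2) *\<^sub>R \<xi>) ^ (?n - 1))\<^sup>2) * indicator (shell R1 R2) ((r / R2) *\<^sub>R \<xi>))"
  have inner: "(\<integral>\<^sup>+r. ?I \<xi> r \<partial>lborel) = ennreal (c * ?W R2)"
    if \<xi>: "norm \<xi> = R2" for \<xi> :: "real^'n"
  proof -
    have "(\<integral>\<^sup>+r. ?I \<xi> r \<partial>lborel) =
        (\<integral>\<^sup>+r. ennreal (c * (1 / r ^ (?n - 1))) * indicator {R1..R2} r \<partial>lborel)"
    proof (rule nn_integral_cong_AE)
      show "AE r in lborel. ?I \<xi> r =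
        ennreal (c * (1 / r ^ (?n - 1))) * indicator {R1..R2} r"
        using AE_lborel_singleton[of R1] AE_lborel_singleton[of R2]
      proof eventually_elim
        case (elim r)
        show ?case
        proof (cases "0 < r")
          case True
          have "norm ((r / R2) *\<^sub>R \<xi>) = r" using True R2 \<xi> by simp
          then have ind: "indicator (shell R1 R2) ((r / R2) *\<^sub>R \<xi>) = (indicator {R1..R2} r :: ennreal)"
            using elim by (auto simp: shell_def indicator_def)
          have "radial_density DIM(real^'n) R2 r * (1 / r ^ (?n - 1))\<^sup>2 = c * (1 / r ^ (?n - 1))"
            using True by (simp add: radial_density_def c_def N power2_eq_square)
          moreover have "radial_density DIM(real^'n) R2 r \<ge> 0" using True R2 by (simp add: radial_density_def)
          ultimately have "ennreal (radial_density DIM(real^'n) R2 r) * ennreal ((1 / r ^ (?n - 1))\<^sup>2) = ennreal (c * (1 / r ^ (?n - 1)))"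
            by (simp add: ennreal_mult'[symmetric])
          then show ?thesis
            unfolding ind \<open>norm ((r / R2) *\<^sub>R \<xi>) = r\<close> by (simp only: mult.assoc[symmetric])
        next
          case False
          then have "r \<notin> {R1..R2}" using R by auto
          with False show ?thesis by (simp add: radial_density_def)
        qed
      qed
    qed
    also have "\<dots> = ennreal (c * ?W R2 - c * ?W R1)"
    proof (rule nn_integral_FTC_Icc)
      fix r assume r: "r \<in> {R1..R2}"
      show "((\<lambda>r. c * ?W r) has_real_derivative c * (1 / r ^ (?n - 1))) (at r)"
        using r R by (intro DERIV_cmult has_real_derivative_radial_profile n) auto
      show "0 \<le> c * (1 / r ^ (?n - 1))" using r R c by simp
    qed (use R in auto)
    finally show ?thesis by simp
  qed
  have "(\<integral>\<^sup>+x. ennreal ((1 / norm x ^ (?n - 1))\<^sup>2) * indicator (shell R1 R2) (x :: real^'n) \<partial>lborel) =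
      (\<integral>\<^sup>+\<xi>. (\<integral>\<^sup>+r. ?I \<xi> r \<partial>lborel) \<partial>(polar_measure R2 :: (real^'n) measure))"
    by (rule nn_integral_polar[OF R2, of "\<lambda>x. ennreal ((1 / norm x ^ (?n - 1))\<^sup>2) * indicator (shell R1 R2) x"]) measurable
  also have "\<dots> = (\<integral>\<^sup>+\<xi>. ennreal (c * ?W R2) \<partial>(polar_measure R2 :: (real^'n) measure))"
  proof (rule nn_integral_cong_AE)
    show "AE \<xi> in (polar_measure R2 :: (real^'n) measure). (\<integral>\<^sup>+r. ?I \<xi> r \<partial>lborel) = ennreal (c * ?W R2)"
      using AE_polar_measure_sphere[OF R2] by eventually_elim (rule inner, simp)
  qed
  also have "\<dots> = ennreal (c * ?W R2) * ennreal (unit_ball_vol ?n * R2 ^ ?n)"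
    using emeasure_polar_measure_UNIV[OF R2, where ?'a = "real^'n"] by simp
  also have "\<dots> = ennreal (c * ?W R2 * (unit_ball_vol ?n * R2 ^ ?n))"
    using c W R2 by (simp add: ennreal_mult'')
  also have "c * ?W R2 * (unit_ball_vol ?n * R2 ^ ?n) = real ?n * unit_ball_vol ?n * ?W R2"
    using R2 by (simp add: c_def)
  finally show ?thesis .
qed

text \<open>Mass transplantation: the integrand is at least its value \<open>c\<close> on the outer sphere inside the shell and
  at most \<open>c\<close> outside.\<close>

lemma nn_integral_profile_energy_le:
  fixes \<Omega> :: "(real^'n) set"
  assumes R: "0 < R1" "R1 < R2" and \<Omega>: "\<Omega> \<in> sets borel" "\<Omega> \<inter> cball 0 R1 = {}"
    and vol: "emeasure lborel \<Omega> = emeasure lborel (shell R1 R2 :: (real^'n) set)"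
  shows "(\<integral>\<^sup>+x. ennreal ((1 / norm x ^ N)\<^sup>2) * indicator \<Omega> x \<partial>lborel)
    \<le> (\<integral>\<^sup>+x. ennreal ((1 / norm x ^ N)\<^sup>2) * indicator (shell R1 R2 :: (real^'n) set) x \<partial>lborel)"
proof -
  let ?A = "shell R1 R2 :: (real^'n) set"
  let ?f = "\<lambda>x::real^'n. ennreal ((1 / norm x ^ N)\<^sup>2)"
  define c where "c = ennreal ((1 / R2 ^ N)\<^sup>2)"
  have A [measurable]: "?A \<in> sets borel" by (simp add: shell_eq_ball_diff_cball)
  note [measurable] = \<Omega>(1)
  have "emeasure lborel ?A \<le> emeasure lborel (ball (0::real^'n) R2)"
    by (intro emeasure_mono) (auto simp: shell_def)
  then have fin: "emeasure lborel ?A \<noteq> top"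
    using emeasure_lborel_ball_neq_top by (metis top_unique)
  have "c * emeasure lborel ?A + (\<integral>\<^sup>+x. ?f x * indicator \<Omega> x \<partial>lborel) =
      (\<integral>\<^sup>+x. c * indicator ?A x + ?f x * indicator \<Omega> x \<partial>lborel)"
    by (subst nn_integral_add) (auto simp: nn_integral_cmult_indicator)
  also have "\<dots> \<le> (\<integral>\<^sup>+x. c * indicator \<Omega> x + ?f x * indicator ?A x \<partial>lborel)"
  proof (rule nn_integral_mono)
    fix x :: "real^'n"
    have mono: "ennreal ((1 / b ^ N)\<^sup>2) \<le> ennreal ((1 / a ^ N)\<^sup>2)" if "0 < a" "a \<le> b" for a b :: real
      using that by (intro ennreal_leI power_mono divide_left_mono) auto
    have out: "?f x \<le> c" if "norm x \<ge> R2"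
      unfolding c_def by (rule mono) (use R that in linarith)+
    have ins: "c \<le> ?f x" if "0 < norm x" "norm x \<le> R2"
      unfolding c_def by (rule mono[OF that])
    show "c * indicator ?A x + ?f x * indicator \<Omega> x \<le> c * indicator \<Omega> x + ?f x * indicator ?A x"
    proof (cases "x \<in> \<Omega>")
      case True
      then have "x \<notin> cball 0 R1" using \<Omega>(2) by blast
      then have "x \<in> ?A \<or> norm x \<ge> R2" by (auto simp: shell_def)
      then show ?thesis using True out by (cases "x \<in> ?A") auto
    next
      case False
      show ?thesis
      proof (cases "x \<in> ?A")
        case True
        then have "R1 < norm x" "norm x < R2" by (simp_all add: shell_def)
        then have "c \<le> ?f x" using R by (intro ins) auto
        then show ?thesis using True \<open>x \<notin> \<Omega>\<close> by simp
      qed (use \<open>x \<notin> \<Omega>\<close> in simp)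
    qed
  qed
  also have "\<dots> = c * emeasure lborel ?A + (\<integral>\<^sup>+x. ?f x * indicator ?A x \<partial>lborel)"
    by (subst nn_integral_add) (auto simp: nn_integral_cmult_indicator vol)
  finally show ?thesis
    using fin by (simp add: ennreal_add_left_cancel_le ennreal_mult_eq_top_iff c_def)
qed

section \<open>Test functions\<close>

text \<open>A smooth truncation at height zero; the bound on the derivative is \<open>1 + z \<le> exp z\<close>
  with \<open>z = \<epsilon> / y\<close>.\<close>

definition truncation :: "real \<Rightarrow> real \<Rightarrow> real" where
  "truncation \<epsilon> y = y * flat (y / \<epsilon>)"

lemma truncation_eq_0: "\<epsilon> > 0 \<Longrightarrow> y \<le> 0 \<Longrightarrow> truncation \<epsilon> y = 0"
  by (simp add: truncation_def flat_def divide_nonpos_pos)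

lemma truncation_nonneg: "\<epsilon> > 0 \<Longrightarrow> 0 \<le> truncation \<epsilon> y"
proof (cases "y \<le> 0")
  case False
  then show ?thesis by (simp add: truncation_def flat_nonneg)
qed (simp add: truncation_eq_0)

lemma truncation_ge:
  assumes "\<epsilon> > 0"
  shows "y - \<epsilon> \<le> truncation \<epsilon> y"
proof (cases "y \<le> 0")
  case False
  have "y * (1 + - (\<epsilon> / y)) \<le> y * exp (- (\<epsilon> / y))"
    using False by (intro mult_left_mono exp_ge_add_one_self) auto
  moreover have "y * (1 + - (\<epsilon> / y)) = y - \<epsilon>" using False by (simp add: field_simps)
  ultimately have "y - \<epsilon> \<le> y * exp (- (\<epsilon> / y))" by (simp only:)
  then show ?thesis using False assms by (simp add: truncation_def flat_def divide_le_0_iff)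
qed (use assms truncation_eq_0 in simp)

lemma truncation_derivative:
  assumes "\<epsilon> > 0"
  obtains D where "(truncation \<epsilon> has_real_derivative D) (at y)" "0 \<le> D" "D \<le> 1"
proof -
  obtain F where F: "F 0 = flat" "\<And>k y. (F k has_real_derivative F (Suc k) y) (at y)"
    using smooth_flat unfolding smooth_real_on_def by auto
  have fl: "(flat has_real_derivative F 1 u) (at u)" for u
    using F(2)[of 0 u] by (simp add: F(1))
  define u where "u = y / \<epsilon>"
  have "(truncation \<epsilon> has_real_derivative flat u + u * F 1 u) (at y)"
    unfolding truncation_def[abs_def] u_def using assms
    by (auto intro!: derivative_eq_intros DERIV_chain2[OF fl] simp: field_simps)
  moreover have "0 \<le> flat u + u * F 1 u \<and> flat u + u * F 1 u \<le> 1"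
  proof (cases "u > 0")
    case True
    have "((\<lambda>t. exp (- (1 / t))) has_real_derivative exp (- (1 / u)) * (1 / u\<^sup>2)) (at u)"
      using True by (auto intro!: derivative_eq_intros simp: power2_eq_square)
    then have "(flat has_real_derivative exp (- (1 / u)) * (1 / u\<^sup>2)) (at u)"
      by (rule has_field_derivative_transform_within_open[of _ _ _ "{0<..}"]) (use True in \<open>auto simp: flat_def\<close>)
    then have "F 1 u = exp (- (1 / u)) * (1 / u\<^sup>2)" using fl DERIV_unique by blast
    then have eq: "flat u + u * F 1 u = exp (- (1 / u)) * (1 + 1 / u)"
      using True by (simp add: flat_def power2_eq_square field_simps)
    have "exp (- (1 / u)) * (1 + 1 / u) \<le> exp (- (1 / u)) * exp (1 / u)"
      by (intro mult_left_mono exp_ge_add_one_self) auto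
    also have "\<dots> = 1" by (simp add: exp_minus)
    finally show ?thesis using True unfolding eq by simp
  next
    case False
    have "u * F 1 u = 0"
    proof (cases "u = 0")
      case False
      then have "u < 0" using \<open>\<not> u > 0\<close> by simp
      have "((\<lambda>t. 0) has_real_derivative 0) (at u)" by simp
      then have "(flat has_real_derivative 0) (at u)"
        by (rule has_field_derivative_transform_within_open[of _ _ _ "{..<0}"]) (use \<open>u < 0\<close> in \<open>auto simp: flat_def\<close>)
      then have "F 1 u = 0" using fl DERIV_unique by blast
      then show ?thesis by simp
    qed simp
    moreover have "flat u = 0" using False by (simp add: flat_def)
    ultimately show ?thesis by (simp only: add_0_left order_refl zero_le_one)
  qed
  ultimately show thesis using that by blast
qed

text \<open>The norm is replaced by its square, a polynomial in the coordinates. In this variable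
  the derivative of the profile is a multiple of a power.\<close>

lemma smooth_real_on_radial_profile_sqrt:
  assumes n: "n \<ge> 2"
  shows "smooth_real_on {0<..} (\<lambda>s. radial_profile n R1 (sqrt s))"
proof (rule smooth_real_on_antiderivative[OF _ smooth_real_on_powr])
  fix s :: real assume "s \<in> {0<..}"
  then have s: "s > 0" by simp
  obtain N where N: "n = Suc N" using n by (cases n) auto
  have d: "((\<lambda>s. radial_profile n R1 (sqrt s)) has_real_derivative 1 / sqrt s ^ (n - 1) * (inverse (sqrt s) / 2)) (at s)"
    by (rule DERIV_chain2[OF has_real_derivative_radial_profile[OF n] DERIV_real_sqrt]) (use s in auto)
  have eq: "1 / sqrt s ^ (n - 1) * (inverse (sqrt s) / 2) = 1 / 2 * s powr (- (real n / 2))"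
  proof -
    have "s powr (real n / 2) = (s powr (1 / 2)) powr real n" by (simp add: powr_powr)
    also have "\<dots> = sqrt s ^ n" using s by (simp add: powr_half_sqrt powr_realpow)
    finally have "s powr (- (real n / 2)) = inverse (sqrt s ^ n)" by (simp only: powr_minus)
    moreover have "inverse (q ^ n) = inverse (q ^ (n - 1)) * inverse q" for q :: real
      by (simp add: N)
    ultimately show ?thesis by (simp only: divide_inverse mult_1_left mult_ac)
  qed
  show "((\<lambda>s. radial_profile n R1 (sqrt s)) has_real_derivative 1 / 2 * s powr (- (real n / 2))) (at s)"
    by (rule DERIV_cong[OF d eq])
qed

text \<open>Applying the derivative to the gradient itself gives the squared norm, and
  Cauchy-Schwarz cancels one factor.\<close>

lemma gradient_radial_le:
  fixes \<phi> :: "real^'n \<Rightarrow> real"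
  assumes "open U" "x \<in> U" "\<And>z. z \<in> U \<Longrightarrow> \<phi> z = h (norm z)" "x \<noteq> 0"
    and h: "(h has_real_derivative D) (at (norm x))" and "\<bar>D\<bar> \<le> b"
  shows "norm (gradient \<phi> x) \<le> b"
proof -
  have "(norm has_derivative (\<lambda>v. v \<bullet> sgn x)) (at x)"
    by (rule has_derivative_norm[OF assms(4)])
  then have "((\<lambda>z. h (norm z)) has_derivative (\<lambda>v. D * (v \<bullet> sgn x))) (at x)"
    using h unfolding has_field_derivative_def by (rule has_derivative_compose)
  then have d: "(\<phi> has_derivative (\<lambda>v. D * (v \<bullet> sgn x))) (at x)"
    using has_derivative_cong_open[OF assms(1-3)] by simp
  then have "\<phi> differentiable (at x)" by (auto simp: differentiable_def)
  from has_derivative_unique[OF has_derivative_gradient[OF this] d]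
  have "gradient \<phi> x \<bullet> v = D * (v \<bullet> sgn x)" for v by (rule fun_cong)
  from this[of "gradient \<phi> x"] have "(norm (gradient \<phi> x))\<^sup>2 = D * (gradient \<phi> x \<bullet> sgn x)"
    by (simp add: power2_norm_eq_inner)
  also have "\<dots> \<le> \<bar>D\<bar> * \<bar>gradient \<phi> x \<bullet> sgn x\<bar>" by (metis abs_ge_self abs_mult)
  also have "\<dots> \<le> b * (norm (gradient \<phi> x) * norm (sgn x))"
    using assms(6) by (intro mult_mono Cauchy_Schwarz_ineq2) auto
  also have "\<dots> = b * norm (gradient \<phi> x)" using assms(4) by (simp add: norm_sgn)
  finally have "norm (gradient \<phi> x) * norm (gradient \<phi> x) \<le> b * norm (gradient \<phi> x)"
    by (simp add: power2_eq_square)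
  moreover have "0 \<le> b" using assms(6) by simp
  ultimately show ?thesis
    by (cases "norm (gradient \<phi> x) = 0") (auto simp: mult_le_cancel_right)
qed

text \<open>Lowering the profile by \<open>\<epsilon>\<close> before truncation makes the function
  vanish on a neighbourhood of the inner sphere; the truncation loses another
  \<open>\<epsilon>\<close>. As its derivative stays between zero and one, the gradient does not
  exceed that of the profile.\<close>

lemma steklov_test_function:
  fixes R1 \<epsilon> b :: real
  assumes n: "CARD('n) \<ge> 2" and R1: "0 < R1" and \<epsilon>: "\<epsilon> > 0" and b: "b > 0"
  obtains \<phi> :: "real^'n \<Rightarrow> real" where
    "\<phi> \<in> smooth_compact (- sphere 0 R1)"
    "\<And>x. R1 \<le> norm x \<Longrightarrow> norm x \<le> b \<Longrightarrow> 0 \<le> \<phi> x \<and> radial_profile CARD('n) R1 (norm x) - 2 * \<epsilon> \<le> \<phi> x"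
    "\<And>x. R1 < norm x \<Longrightarrow> norm x < b \<Longrightarrow> norm (gradient \<phi> x) \<le> 1 / norm x ^ (CARD('n) - 1)"
proof -
  let ?n = "CARD('n)"
  define W where "W = radial_profile ?n R1"
  have Wd: "(W has_real_derivative 1 / r ^ (?n - 1)) (at r)" if "r > 0" for r
    unfolding W_def by (rule has_real_derivative_radial_profile[OF n that])
  define T where "T r = truncation \<epsilon> (W r - \<epsilon>)" for r
  define \<phi>0 where "\<phi>0 x = (if norm x \<le> R1 then 0 else T (norm x))" for x :: "real^'n"
  \<comment> \<open>Equal to one for \<open>norm x \<le> b\<close> and to zero once
    \<open>(norm x)\<^sup>2 \<ge> b\<^sup>2 + 1\<close>; using the square of the norm keeps it
    smooth at the origin.\<close>
  define cut where "cut x = smooth_step (b\<^sup>2 + 1 - (norm x)\<^sup>2)" for x :: "real^'n"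
  define \<phi> where "\<phi> x = \<phi>0 x * cut x" for x
  have "isCont W R1" using Wd[OF R1] by (rule DERIV_isCont)
  then have "\<forall>\<^sub>F r in at R1. W r < \<epsilon>"
    using order_tendstoD(2)[of W 0 "at R1" \<epsilon>] \<epsilon> by (simp add: isCont_def W_def)
  then obtain c where c: "c > R1" "\<And>r. R1 < r \<Longrightarrow> r < c \<Longrightarrow> W r < \<epsilon>"
    using eventually_at_right[of R1 "R1 + 1"] by (auto simp: eventually_at_split)
  have \<phi>0_zero: "\<phi>0 x = 0" if "norm x < c" for x
    using c(2)[of "norm x"] that \<epsilon> by (auto simp: \<phi>0_def T_def truncation_eq_0)
  have sm1: "smooth_on (ball 0 c) \<phi>0"
    using smooth_on_cong[of "ball 0 c" \<phi>0 "\<lambda>x. 0"] \<phi>0_zero by (simp add: smooth_on_const)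
  have sm2: "smooth_on (- cball 0 R1) \<phi>0"
  proof (subst smooth_on_cong)
    show op: "open (- cball 0 R1 :: (real^'n) set)" by (simp add: open_Compl)
    let ?y = "\<lambda>x::real^'n. radial_profile ?n R1 (sqrt ((norm x)\<^sup>2)) - \<epsilon>"
    show "\<phi>0 x = ?y x * flat (?y x * (1 / \<epsilon>))" if "x \<in> - cball 0 R1" for x
      using that by (simp add: \<phi>0_def T_def truncation_def W_def)
    have "smooth_on (- cball 0 R1) (\<lambda>x::real^'n. radial_profile ?n R1 (sqrt ((norm x)\<^sup>2)))"
    proof (rule smooth_on_compose[OF op smooth_real_on_radial_profile_sqrt[OF n] smooth_on_norm_square[OF op]])
      fix x :: "real^'n" assume "x \<in> - cball 0 R1"
      then have "norm x > 0" using R1 by auto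
      then show "(norm x)\<^sup>2 \<in> {0<..}" by simp
    qed
    then have y: "smooth_on (- cball 0 R1) ?y"
      by (intro smooth_on_diff op smooth_on_const)
    show "smooth_on (- cball 0 R1) (\<lambda>x. ?y x * flat (?y x * (1 / \<epsilon>)))"
      by (intro smooth_on_mult op y smooth_on_compose[OF op smooth_flat] smooth_on_const UNIV_I)
  qed
  \<comment> \<open>The ball where \<open>\<phi>0\<close> vanishes and the exterior region where it
    is given by the formula overlap, since \<open>R1 < c\<close>.\<close>
  have "ball 0 c \<union> - cball 0 R1 = (UNIV :: (real^'n) set)" using c(1) by auto
  then have "smooth_on UNIV \<phi>0"
    using smooth_on_Un[OF _ _ sm1 sm2] by (simp add: open_Compl)
  moreover have "smooth_on UNIV cut"
    unfolding cut_def by (intro smooth_on_smooth_step smooth_on_diff smooth_on_const smooth_on_norm_square open_UNIV)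
  ultimately have sm: "smooth_on UNIV \<phi>"
    unfolding \<phi>_def by (intro smooth_on_mult) auto
  have "\<phi> \<in> smooth_compact (- sphere 0 R1)"
  proof (rule smooth_compactI[OF sm])
    let ?K = "cball 0 (sqrt (b\<^sup>2 + 1)) \<inter> (- ball 0 c) :: (real^'n) set"
    show "compact ?K" by (intro compact_Int_closed) (auto simp: closed_Compl)
    show "x \<in> ?K" if "\<phi> x \<noteq> 0" for x
    proof -
      have "\<not> norm x < c" using that \<phi>0_zero[of x] by (auto simp: \<phi>_def)
      moreover have "\<not> b\<^sup>2 + 1 - (norm x)\<^sup>2 \<le> 0"
        using that smooth_step_eq_0 by (auto simp: \<phi>_def cut_def)
      then have "norm x \<le> sqrt (b\<^sup>2 + 1)" by (intro real_le_rsqrt) simp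
      ultimately show ?thesis by simp
    qed
    show "?K \<subseteq> - sphere 0 R1" using c(1) by auto
  qed
  moreover have "0 \<le> \<phi> x \<and> W (norm x) - 2 * \<epsilon> \<le> \<phi> x" if x: "R1 \<le> norm x" "norm x \<le> b" for x
  proof -
    have "(norm x)\<^sup>2 \<le> b\<^sup>2" using x by (intro power_mono) auto
    then have "cut x = 1" by (simp add: cut_def smooth_step_eq_1)
    moreover have "0 \<le> \<phi>0 x" using truncation_nonneg[OF \<epsilon>] by (simp add: \<phi>0_def T_def)
    moreover have "W (norm x) - 2 * \<epsilon> \<le> \<phi>0 x"
      using truncation_ge[OF \<epsilon>, of "W (norm x) - \<epsilon>"] x \<epsilon> by (auto simp: \<phi>0_def T_def W_def)
    ultimately show ?thesis by (simp add: \<phi>_def)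
  qed
  moreover have "norm (gradient \<phi> x) \<le> 1 / norm x ^ (?n - 1)" if x: "R1 < norm x" "norm x < b" for x
  proof -
    have x0: "norm x > 0" using x R1 by linarith
    let ?U = "ball 0 b - cball 0 R1 :: (real^'n) set"
    obtain D where D: "(truncation \<epsilon> has_real_derivative D) (at (W (norm x) - \<epsilon>))" "0 \<le> D" "D \<le> 1"
      using truncation_derivative[OF \<epsilon>] by blast
    have "((\<lambda>r. W r - \<epsilon>) has_real_derivative 1 / norm x ^ (?n - 1)) (at (norm x))"
      using DERIV_diff[OF Wd[OF x0] DERIV_const[of \<epsilon>]] by simp
    from DERIV_chain2[OF D(1) this]
    have TD: "(T has_real_derivative D * (1 / norm x ^ (?n - 1))) (at (norm x))"
      by (simp add: T_def[abs_def])
    show ?thesis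
    proof (rule gradient_radial_le[OF _ _ _ _ TD])
      show "open ?U" by (intro open_Diff) auto
      show "x \<in> ?U" using x by simp
      show "x \<noteq> 0" using x0 by (rule zero_less_norm_iff[THEN iffD1])
      show "\<phi> z = T (norm z)" if "z \<in> ?U" for z
      proof -
        have "(norm z)\<^sup>2 \<le> b\<^sup>2" using that by (intro power_mono) auto
        then have "cut z = 1" by (simp add: cut_def smooth_step_eq_1)
        then show ?thesis using that by (simp add: \<phi>_def \<phi>0_def)
      qed
      have "D * (1 / norm x ^ (?n - 1)) \<le> 1 * (1 / norm x ^ (?n - 1))"
        using D x0 by (intro mult_right_mono) auto
      then show "\<bar>D * (1 / norm x ^ (?n - 1))\<bar> \<le> 1 / norm x ^ (?n - 1)"
        using D x0 by simp
    qed
  qed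
  ultimately show thesis using that by (simp add: W_def)
qed

section \<open>Smooth functions as competitors\<close>

lemma smooth_compact_H1_vanishing:
  assumes "open \<Omega>" "bounded \<Omega>" and \<phi>: "\<phi> \<in> smooth_compact UNIV" and "spt \<phi> \<inter> K = {}"
    and "finite_measure (surface_measure \<Gamma>)"
  shows "\<phi> \<in> H1_vanishing \<Omega> K" "has_trace \<Omega> \<Gamma> \<phi> \<phi>"
proof -
  have z: "partial_deriv i (\<lambda>x. 0) x = 0" for i :: 'a and x
    by (subst partial_derivI[OF has_derivative_const]) simp
  have "dirichlet_energy \<Omega> (\<lambda>x. \<phi> x - \<phi> x) = 0"
    using smooth_compact_H1(2)[OF assms(1,2) smooth_compact_diff[OF \<phi> \<phi>]] 
    by (simp add: gradient_def z zero_vec_def[symmetric])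
  then have 0: "H1_norm \<Omega> (\<lambda>x. \<phi> x - \<phi> x) = 0"
    by (simp add: H1_norm_def)
  show "\<phi> \<in> H1_vanishing \<Omega> K"
    unfolding H1_vanishing_def using smooth_compact_H1(1)[OF assms(1,2) \<phi>] assms(4) \<phi> 0 by force
  show "has_trace \<Omega> \<Gamma> \<phi> \<phi>"
    unfolding has_trace_def
    using smooth_compact_L2_surface_measure[OF assms(5) \<phi>] \<phi> 0
    by (intro conjI exI[of _ "\<lambda>k. \<phi>"]) auto
qed

section \<open>The isoperimetric inequality\<close>

text \<open>\<open>K\<close> bounds the squared trace by the energy, so its reciprocal bounds every
  quotient from below; a vanishing denominator counts as \<open>\<infinity>\<close>.\<close>

lemma steklov_dirichlet_eigenvalue_ball_ge:
  fixes R1 R2 :: real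
  assumes n: "CARD('n) \<ge> 2" and R: "0 < R1" "R1 < R2"
    and m: "measure (sphere_measure R2 :: (real^'n) measure) UNIV > 0"
  shows "ennreal (real CARD('n) * unit_ball_vol CARD('n) /
      (measure (sphere_measure R2 :: (real^'n) measure) UNIV * radial_profile CARD('n) R1 R2))
    \<le> steklov_dirichlet_eigenvalue R1 (ball 0 R2 :: (real^'n) set)"
proof -
  let ?m = "measure (sphere_measure R2 :: (real^'n) measure) UNIV"
  define K where "K = ?m * radial_profile CARD('n) R1 R2 / (real CARD('n) * unit_ball_vol CARD('n))"
  have K: "K > 0" using m radial_profile_pos[OF n R] n by (simp add: K_def)
  have nz: "emeasure (sphere_measure R2 :: (real^'n) measure) UNIV \<noteq> 0"
    using m by (auto simp: measure_def)
  have \<Gamma>: "frontier (ball 0 R2 :: (real^'n) set) = sphere 0 R2" using R by (simp add: frontier_ball)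
  have "ennreal (1 / K) \<le> steklov_dirichlet_quotient (shell R1 R2) (sphere 0 R2) v t"
    if "v \<in> H1_vanishing (shell R1 R2) (sphere 0 R1)" "has_trace (shell R1 R2) (sphere (0::real^'n) R2) v t" for v t
  proof -
    define d where "d = (LINT x|surface_measure (sphere 0 R2). (t x)\<^sup>2)"
    have "d \<le> K * dirichlet_energy (shell R1 R2) v"
      using steklov_inequality_shell[OF n R nz that] by (simp add: d_def K_def)
    moreover have "0 \<le> d" by (simp add: d_def)
    ultimately have "1 / K \<le> dirichlet_energy (shell R1 R2) v / d" if "d \<noteq> 0"
      using K that by (simp add: field_simps)
    then show ?thesis
      by (auto simp: steklov_dirichlet_quotient_def Let_def ennreal_leI simp flip: d_def)
  qed
  then have "ennreal (1 / K) \<le> steklov_dirichlet_eigenvalue R1 (ball 0 R2 :: (real^'n) set)"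
    unfolding steklov_dirichlet_eigenvalue_def Let_def \<Gamma> shell_eq_ball_diff_cball[symmetric]
    by (intro INF_greatest) auto
  then show ?thesis by (simp add: K_def)
qed

text \<open>If the surface measure of the sphere vanished, every denominator would vanish.\<close>

lemma steklov_dirichlet_eigenvalue_ball_degenerate:
  fixes R1 R2 :: real
  assumes "0 < R2" and m: "measure (sphere_measure R2 :: (real^'n) measure) UNIV = 0"
  shows "steklov_dirichlet_eigenvalue R1 (ball 0 R2 :: (real^'n) set) = \<infinity>"
proof -
  let ?M = "surface_measure (sphere (0::real^'n) R2)"
  have "emeasure ?M (space ?M) = (\<integral>\<^sup>+x. 1 \<partial>(sphere_measure R2 :: (real^'n) measure))"
    using nn_integral_surface_measure_sphere[where f = "\<lambda>x. 1" and R = R2 and 'n = 'n] by simp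
  also have "\<dots> = 0"
    using m finite_measure.emeasure_eq_measure[OF finite_measure_sphere_measure[OF assms(1), where 'n = 'n]] by simp
  finally have "space ?M \<in> null_sets ?M" by (intro null_setsI sets.top)
  then have "(LINT x|?M. (t x)\<^sup>2) = 0" for t
    by (intro integral_eq_zero_AE AE_I'[of "space ?M"]) auto
  then have "steklov_dirichlet_quotient \<Omega> (sphere (0::real^'n) R2) v t = \<infinity>" for \<Omega> v t
    by (simp add: steklov_dirichlet_quotient_def Let_def)
  then show ?thesis
    using assms(1) unfolding steklov_dirichlet_eigenvalue_def Let_def
    by (intro antisym INF_greatest) (auto simp: frontier_ball)
qed

text \<open>The point to check is that \<open>\<phi>\<close> does not vanish almost everywhere: a
  positive boundary integral yields a boundary point where it is nonzero, and by continuity it is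
  nonzero on a nonempty open part of the domain.\<close>

lemma steklov_dirichlet_eigenvalue_le_test:
  fixes \<Omega>0 :: "(real^'n) set"
  assumes op: "open \<Omega>0" and bd: "bounded \<Omega>0" and \<phi>: "\<phi> \<in> smooth_compact UNIV" "spt \<phi> \<inter> sphere 0 R1 = {}"
    and fin: "finite_measure (surface_measure (frontier \<Omega>0))" and cb: "cball 0 R1 \<subseteq> \<Omega>0"
    and pos: "(LINT x|surface_measure (frontier \<Omega>0). (\<phi> x)\<^sup>2) > 0"
  shows "steklov_dirichlet_eigenvalue R1 \<Omega>0 \<le>
    ennreal (dirichlet_energy (\<Omega>0 - cball 0 R1) \<phi> / (LINT x|surface_measure (frontier \<Omega>0). (\<phi> x)\<^sup>2))"
proof -
  define \<Omega> where "\<Omega> = \<Omega>0 - cball 0 R1"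
  have \<Omega>: "open \<Omega>" "bounded \<Omega>" using op bd by (auto simp: \<Omega>_def intro: bounded_subset)
  have "\<not> (AE x in lebesgue_on \<Omega>. \<phi> x = 0)"
  proof
    assume AE: "AE x in lebesgue_on \<Omega>. \<phi> x = 0"
    have cont: "continuous_on UNIV \<phi>" by (rule smooth_on_continuous[OF smooth_compactD(1)[OF \<phi>(1)]])
    have opn: "open {x. \<phi> x \<noteq> 0}" using cont by (intro open_Collect_neq) auto
    have "\<exists>x\<in>frontier \<Omega>0. \<phi> x \<noteq> 0"
    proof (rule ccontr)
      assume "\<not> ?thesis"
      then have "(LINT x|surface_measure (frontier \<Omega>0). (\<phi> x)\<^sup>2) = (LINT x|surface_measure (frontier \<Omega>0). 0)"
        by (intro Bochner_Integration.integral_cong) auto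
      with pos show False by simp
    qed
    then obtain x where x: "x \<in> frontier \<Omega>0" "\<phi> x \<noteq> 0" by blast
    then have "x \<in> closure \<Omega>0" "x \<notin> cball 0 R1"
      using cb op by (auto simp: frontier_def interior_open)
    have "\<Omega>0 \<inter> ({x. \<phi> x \<noteq> 0} \<inter> - cball 0 R1) \<noteq> {}"
      using open_Int_closure_eq_empty[of "{x. \<phi> x \<noteq> 0} \<inter> - cball 0 R1" \<Omega>0] opn x(2)
        \<open>x \<in> closure \<Omega>0\<close> \<open>x \<notin> cball 0 R1\<close> by (auto simp: open_Int open_Compl)
    then have ne: "\<Omega> \<inter> {x. \<phi> x \<noteq> 0} \<noteq> {}" by (auto simp: \<Omega>_def)
    have "AE x in lebesgue. x \<in> \<Omega> \<longrightarrow> \<phi> x = 0"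
      using AE \<Omega>(1) by (simp add: AE_restrict_space_iff)
    then have "\<Omega> \<inter> {x. \<phi> x \<noteq> 0} \<in> null_sets lebesgue"
      using \<Omega>(1) opn by (subst AE_iff_null_sets) (auto elim!: eventually_mono)
    then have "negligible (\<Omega> \<inter> {x. \<phi> x \<noteq> 0})" by (simp add: negligible_iff_null_sets)
    then show False using open_not_negligible[of "\<Omega> \<inter> {x. \<phi> x \<noteq> 0}"] ne \<Omega>(1) opn by (simp add: open_Int)
  qed
  then have "steklov_dirichlet_eigenvalue R1 \<Omega>0 \<le> steklov_dirichlet_quotient \<Omega> (frontier \<Omega>0) \<phi> \<phi>"
    using smooth_compact_H1_vanishing[OF \<Omega> \<phi> fin]
    unfolding steklov_dirichlet_eigenvalue_def Let_def \<Omega>_def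
    by (intro INF_lower2[of "(\<phi>, \<phi>)"]) auto
  then show ?thesis using pos by (simp add: steklov_dirichlet_quotient_def \<Omega>_def Let_def)
qed

text \<open>For the truncated profile the energy is at most that of the shell, while the denominator
  loses at most a multiple of \<open>\<epsilon>\<close> against the weighted perimeter; then
  \<open>\<epsilon>\<close> tends to zero.\<close>

lemma steklov_dirichlet_eigenvalue_convex_le:
  fixes \<Omega>0 :: "(real^'n) set" and R1 R2 :: real
  assumes n: "CARD('n) \<ge> 2" and R1: "R1 > 0"
    and op: "open \<Omega>0" and bd: "bounded \<Omega>0" and cv: "convex \<Omega>0"
    and cb: "cball 0 R1 \<subseteq> \<Omega>0" and crit: "\<Omega>0 \<subseteq> ball 0 (critical_radius CARD('n) R1)"
    and R2: "R2 > R1"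
    and vol: "emeasure lborel \<Omega>0 = ennreal (unit_ball_vol CARD('n) * R2 ^ CARD('n))"
      "emeasure lborel (\<Omega>0 - cball 0 R1) = emeasure lborel (shell R1 R2 :: (real^'n) set)"
    and m: "measure (sphere_measure R2 :: (real^'n) measure) UNIV > 0"
  shows "steklov_dirichlet_eigenvalue R1 \<Omega>0 \<le> ennreal (real CARD('n) * unit_ball_vol CARD('n) /
      (measure (sphere_measure R2 :: (real^'n) measure) UNIV * radial_profile CARD('n) R1 R2))"
proof -
  let ?n = "CARD('n)" and ?b = "critical_radius CARD('n) R1"
  let ?M = "surface_measure (frontier \<Omega>0)"
  define W where "W = radial_profile ?n R1"
  define mS where "mS = measure (sphere_measure R2 :: (real^'n) measure) UNIV"
  define \<Omega> where "\<Omega> = \<Omega>0 - cball 0 R1"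
  have \<Omega>: "open \<Omega>" "bounded \<Omega>" "\<Omega> \<in> sets borel"
    using op bd by (auto simp: \<Omega>_def intro: bounded_subset)
  have R: "R2 > 0" using R1 R2 by simp
  have W: "W R2 > 0" unfolding W_def by (rule radial_profile_pos[OF n R1 R2])
  have Wmono: "W r \<le> W s" if "R1 \<le> r" "r \<le> s" for r s
    using radial_profile_strict_mono[OF n, of r s R1] that R1 by (cases "r = s") (auto simp: W_def)
  have [measurable]: "W \<in> borel_measurable borel"
    unfolding W_def radial_profile_def[abs_def] by measurable
  have b: "R1 < ?b"
  proof -
    obtain v :: "real^'n" where v: "norm v = R1" using vector_choose_size[of R1] R1 by auto
    then have "v \<in> cball 0 R1" by simp
    then have "v \<in> ball 0 ?b" using cb crit by blast
    then have "norm v < ?b" by simp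
    then show ?thesis by (simp only: v)
  qed
  \<comment> \<open>The ball of radius \<open>R2\<close> has the volume of \<open>\<Omega>0\<close>,
    which lies in the critical ball.\<close>
  have R2b: "R2 \<le> ?b"
  proof -
    have "ennreal (unit_ball_vol ?n * R2 ^ ?n) \<le> emeasure lborel (ball (0::real^'n) ?b)"
      unfolding vol(1)[symmetric] using crit by (intro emeasure_mono) auto
    also have "\<dots> = ennreal (unit_ball_vol ?n * ?b ^ ?n)"
      using b R1 by (simp add: emeasure_ball)
    finally have "R2 ^ ?n \<le> ?b ^ ?n"
      using b R1 by (simp add: ennreal_le_iff mult_le_cancel_left_pos)
    then show ?thesis using R b R1 by (intro power_le_imp_le_base[of R2 "?n - 1"]) auto
  qed
  have nz: "emeasure (sphere_measure R2 :: (real^'n) measure) UNIV \<noteq> 0"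
    using m by (auto simp: measure_def)
  interpret S: finite_measure "sphere_measure R2 :: (real^'n) measure"
    by (rule finite_measure_sphere_measure[OF R])
  have ne: "\<Omega>0 \<noteq> {}" using cb R1 by auto
  have fin: "finite_measure ?M"
    by (intro finite_measure_surface_measure hausdorff_outer_convex_frontier_finite op cv ne bd) (simp add: borel_closed)
  interpret M: finite_measure ?M by (rule fin)
  have \<Gamma>: "R1 \<le> norm x \<and> norm x \<le> ?b" if "x \<in> frontier \<Omega>0" for x
  proof -
    have "x \<notin> cball 0 R1" using that cb op by (auto simp: frontier_def interior_open)
    moreover have "x \<in> cball 0 ?b"
      using that closure_mono[OF order_trans[OF crit ball_subset_cball]] by (auto simp: frontier_def)
    ultimately show ?thesis by simp
  qed
  have Wnn: "0 \<le> W (norm x) \<and> W (norm x) \<le> W ?b" if "x \<in> frontier \<Omega>0" for x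
    using Wmono[of R1 "norm x"] Wmono[of "norm x" ?b] \<Gamma>[OF that] by (simp add: W_def)
  have measN: "(\<lambda>x. W (norm x)) \<in> borel_measurable ?M"
    by (rule borel_measurable_surface_measure) measurable
  have intW: "integrable ?M (\<lambda>x. W (norm x))" "integrable ?M (\<lambda>x. (W (norm x))\<^sup>2)"
  proof -
    show "integrable ?M (\<lambda>x. W (norm x))"
      using Wnn measN by (intro M.integrable_const_bound[of _ "W ?b"]) (auto intro!: AE_I2)
    show "integrable ?M (\<lambda>x. (W (norm x))\<^sup>2)"
      using Wnn measN by (intro M.integrable_const_bound[of _ "(W ?b)\<^sup>2"]) (auto intro!: AE_I2 power_mono)
  qed
  have perimeter: "mS * (W R2)\<^sup>2 \<le> (LINT x|?M. (W (norm x))\<^sup>2)"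
  proof -
    have "ennreal (mS * (W R2)\<^sup>2) \<le> (\<integral>\<^sup>+x. ennreal ((W (norm x))\<^sup>2) \<partial>?M)"
      using weighted_perimeter_ge[OF op bd cv R1 cb R nz n R1 cb _ R2b crit vol(1)] R2
      by (simp add: W_def mS_def ennreal_mult' S.emeasure_eq_measure)
    also have "\<dots> = ennreal (LINT x|?M. (W (norm x))\<^sup>2)"
      using intW(2) by (intro nn_integral_eq_integral) auto
    finally show ?thesis by (subst (asm) ennreal_le_iff) auto
  qed
  define E where "E = real ?n * unit_ball_vol ?n * W R2"
  have E: "E \<ge> 0" using W by (simp add: E_def)
  \<comment> \<open>The factor four comes from \<open>(w - 2 * \<epsilon>)\<^sup>2 \<ge> w\<^sup>2 -
    4 * \<epsilon> * w\<close>.\<close>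
  define C where "C = 4 * (LINT x|?M. W (norm x))"
  have bound: "steklov_dirichlet_eigenvalue R1 \<Omega>0 \<le> ennreal (E / (mS * (W R2)\<^sup>2 - C * \<epsilon>))"
    if \<epsilon>: "\<epsilon> > 0" "C * \<epsilon> < mS * (W R2)\<^sup>2" for \<epsilon>
  proof -
    obtain \<phi> :: "real^'n \<Rightarrow> real" where \<phi>: "\<phi> \<in> smooth_compact (- sphere 0 R1)"
      "\<And>x. R1 \<le> norm x \<Longrightarrow> norm x \<le> ?b \<Longrightarrow> 0 \<le> \<phi> x \<and> W (norm x) - 2 * \<epsilon> \<le> \<phi> x"
      "\<And>x. R1 < norm x \<Longrightarrow> norm x < ?b \<Longrightarrow> norm (gradient \<phi> x) \<le> 1 / norm x ^ (?n - 1)"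
      using steklov_test_function[OF n R1 \<epsilon>(1), of ?b] b R1 unfolding W_def by auto
    have \<phi>U: "\<phi> \<in> smooth_compact UNIV" "spt \<phi> \<inter> sphere 0 R1 = {}"
      using smooth_compact_mono[OF \<phi>(1)] smooth_compactD(3)[OF \<phi>(1)] by auto
    define d where "d = (LINT x|?M. (\<phi> x)\<^sup>2)"
    have "mS * (W R2)\<^sup>2 - C * \<epsilon> \<le> (LINT x|?M. (W (norm x))\<^sup>2) - C * \<epsilon>"
      using perimeter by simp
    also have "\<dots> = (LINT x|?M. (W (norm x))\<^sup>2 - 4 * \<epsilon> * W (norm x))"
      using intW by (simp add: C_def)
    also have "\<dots> \<le> d"
      unfolding d_def
    proof (rule integral_mono)
      show "integrable ?M (\<lambda>x. (W (norm x))\<^sup>2 - 4 * \<epsilon> * W (norm x))" using intW by simp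
      show "integrable ?M (\<lambda>x. (\<phi> x)\<^sup>2)"
        using smooth_compact_L2_surface_measure[OF fin \<phi>U(1)] by (simp add: L2_def)
      fix x assume "x \<in> space ?M"
      then have x: "x \<in> frontier \<Omega>0" by simp
      \<comment> \<open>For \<open>w < 2 * \<epsilon>\<close> the lower bound for \<open>p\<close>
        is negative and cannot be squared, but then the left side is not positive.\<close>
      have *: "w\<^sup>2 - 4 * \<epsilon> * w \<le> p\<^sup>2" if "0 \<le> w" "0 \<le> p" "w - 2 * \<epsilon> \<le> p" for w p :: real
      proof (cases "w \<ge> 2 * \<epsilon>")
        case True
        then have "(w - 2 * \<epsilon>)\<^sup>2 \<le> p\<^sup>2" using that by (intro power_mono) auto
        moreover have "(w - 2 * \<epsilon>)\<^sup>2 = w\<^sup>2 - 4 * \<epsilon> * w + 4 * \<epsilon>\<^sup>2" by (simp add: power2_diff power_mult_distrib)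
        ultimately show ?thesis using zero_le_power2[of \<epsilon>] by linarith
      next
        case False
        then have "w * w \<le> (4 * \<epsilon>) * w" using that \<epsilon> by (intro mult_right_mono) auto
        then show ?thesis
          using zero_le_power2[of p] unfolding power2_eq_square[of w] by linarith
      qed
      show "(W (norm x))\<^sup>2 - 4 * \<epsilon> * W (norm x) \<le> (\<phi> x)\<^sup>2"
        using Wnn[OF x] \<phi>(2)[of x] \<Gamma>[OF x] by (intro *) auto
    qed
    finally have d: "mS * (W R2)\<^sup>2 - C * \<epsilon> \<le> d" .
    then have dpos: "d > 0" using \<epsilon>(2) by simp
    have energy: "dirichlet_energy \<Omega> \<phi> \<le> E"
    proof -
      have "ennreal (dirichlet_energy \<Omega> \<phi>) = (\<integral>\<^sup>+x. ennreal ((norm (gradient \<phi> x))\<^sup>2) * indicator \<Omega> x \<partial>lborel)"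
        using nn_integral_L2_lebesgue_on[OF smooth_compact_L2(3)[OF \<phi>U(1) \<Omega>(1)] smooth_compact_borel_measurable(2)[OF \<phi>U(1)] \<Omega>(3)]
          smooth_compact_H1(2)[OF \<Omega>(1,2) \<phi>U(1)] by simp
      also have "\<dots> \<le> (\<integral>\<^sup>+x. ennreal ((1 / norm x ^ (?n - 1))\<^sup>2) * indicator \<Omega> x \<partial>lborel)"
      proof (rule nn_integral_mono)
        fix x :: "real^'n"
        show "ennreal ((norm (gradient \<phi> x))\<^sup>2) * indicator \<Omega> x \<le> ennreal ((1 / norm x ^ (?n - 1))\<^sup>2) * indicator \<Omega> x"
        proof (cases "x \<in> \<Omega>")
          case True
          then have "x \<notin> cball 0 R1" "x \<in> ball 0 ?b" using crit by (auto simp: \<Omega>_def)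
          then have "norm (gradient \<phi> x) \<le> 1 / norm x ^ (?n - 1)" by (intro \<phi>(3)) auto
          then have "(norm (gradient \<phi> x))\<^sup>2 \<le> (1 / norm x ^ (?n - 1))\<^sup>2" by (intro power_mono) auto
          then show ?thesis by (intro mult_right_mono ennreal_leI) auto
        qed simp
      qed
      also have "\<dots> \<le> (\<integral>\<^sup>+x. ennreal ((1 / norm x ^ (?n - 1))\<^sup>2) * indicator (shell R1 R2) (x :: real^'n) \<partial>lborel)"
        using vol(2) by (intro nn_integral_profile_energy_le R1 R2 \<Omega>(3)) (auto simp: \<Omega>_def)
      also have "\<dots> = ennreal E"
        unfolding E_def W_def by (rule nn_integral_profile_energy_shell[OF n R1 R2])
      finally show ?thesis using E by (subst (asm) ennreal_le_iff)
    qed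
    have "steklov_dirichlet_eigenvalue R1 \<Omega>0 \<le> ennreal (dirichlet_energy \<Omega> \<phi> / d)"
      unfolding d_def \<Omega>_def
      using dpos by (intro steklov_dirichlet_eigenvalue_le_test op bd \<phi>U fin cb) (simp add: d_def)
    also have "\<dots> \<le> ennreal (E / (mS * (W R2)\<^sup>2 - C * \<epsilon>))"
      using d \<epsilon>(2) energy E by (intro ennreal_leI frac_le) auto
    finally show ?thesis .
  qed
  have pos: "mS * (W R2)\<^sup>2 > 0" using m W by (simp add: mS_def)
  have "steklov_dirichlet_eigenvalue R1 \<Omega>0 \<le> ennreal (E / (mS * (W R2)\<^sup>2 - C * 0))"
  proof (rule tendsto_lowerbound)
    show "((\<lambda>\<epsilon>. ennreal (E / (mS * (W R2)\<^sup>2 - C * \<epsilon>))) \<longlongrightarrow> ennreal (E / (mS * (W R2)\<^sup>2 - C * 0))) (at_right 0)"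
      using pos by (intro tendsto_intros) auto
    have "((\<lambda>\<epsilon>. C * \<epsilon>) \<longlongrightarrow> C * 0) (at_right 0)" by (intro tendsto_intros)
    then have "\<forall>\<^sub>F \<epsilon> in at_right 0. C * \<epsilon> < mS * (W R2)\<^sup>2"
      using pos by (intro order_tendstoD) auto
    then show "\<forall>\<^sub>F \<epsilon> in at_right 0. steklov_dirichlet_eigenvalue R1 \<Omega>0 \<le> ennreal (E / (mS * (W R2)\<^sup>2 - C * \<epsilon>))"
      using eventually_at_right_less[of 0] by eventually_elim (rule bound)
  qed simp
  \<comment> \<open>One factor \<open>W R2\<close> of the energy cancels, which leaves the bound
    found for the shell.\<close>
  also have "E / (mS * (W R2)\<^sup>2 - C * 0) = real ?n * unit_ball_vol ?n / (mS * W R2)"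
    using W by (simp add: E_def power2_eq_square)
  finally show ?thesis by (simp add: mS_def W_def)
qed

theorem theorem1p1:
  fixes \<Omega>0 :: "(real^'n) set" and R1 R2 :: real
  assumes "CARD('n) \<ge> 2"
    and "R1 > 0"
    and "open \<Omega>0" and "bounded \<Omega>0" and "convex \<Omega>0"
    and "cball 0 R1 \<subseteq> \<Omega>0" and "\<Omega>0 \<subseteq> ball 0 (critical_radius CARD('n) R1)"
    and "R2 > R1"
    and "measure lebesgue (shell R1 R2 :: (real^'n) set) = measure lebesgue (\<Omega>0 - cball 0 R1)"
  shows "steklov_dirichlet_eigenvalue R1 \<Omega>0
       \<le> steklov_dirichlet_eigenvalue R1 (ball 0 R2 :: (real^'n) set)"
proof (cases "measure (sphere_measure R2 :: (real^'n) measure) UNIV = 0")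
  case True
  have "steklov_dirichlet_eigenvalue R1 (ball 0 R2 :: (real^'n) set) = \<infinity>"
    by (rule steklov_dirichlet_eigenvalue_ball_degenerate[OF _ True]) (use assms(2,8) in simp)
  then show ?thesis by simp
next
  case False
  then have m: "measure (sphere_measure R2 :: (real^'n) measure) UNIV > 0"
    by (simp add: zero_less_measure_iff)
  have R: "R2 > 0" using assms by simp
  have fin: "emeasure lborel X \<noteq> top" if "bounded X" for X :: "(real^'n) set"
    using emeasure_bounded_finite[OF that] by simp
  have sets: "\<Omega>0 \<in> sets lborel" "cball (0::real^'n) R1 \<in> sets lborel" "ball (0::real^'n) R2 \<in> sets lborel"
    using assms(3) by auto
  have "emeasure lborel (\<Omega>0 - cball 0 R1) = emeasure lborel \<Omega>0 - emeasure lborel (cball (0::real^'n) R1)"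
    using assms fin[OF bounded_cball] sets by (intro emeasure_Diff) auto
  have shell_b: "bounded (shell R1 R2 :: (real^'n) set)"
    by (rule bounded_subset[OF bounded_ball[of 0 R2]]) (auto simp: shell_def)
  have diff_b: "bounded (\<Omega>0 - cball 0 R1)" using assms(4) by (rule bounded_subset) auto
  have m_lborel: "measure lborel (\<Omega>0 - cball 0 R1) = measure lborel (shell R1 R2 :: (real^'n) set)"
    using assms(9) sets by (simp add: shell_eq_ball_diff_cball measure_completion)
  \<comment> \<open>\<open>measure\<close> is zero by default on sets of infinite measure; as both
    sets are bounded, the equality carries over to \<open>emeasure\<close>.\<close>
  have eq: "emeasure lborel (\<Omega>0 - cball 0 R1) = emeasure lborel (shell R1 R2 :: (real^'n) set)"
    using m_lborel fin[OF shell_b] fin[OF diff_b] by (simp add: emeasure_eq_ennreal_measure)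
  \<comment> \<open>Adding the inner ball back to two sets of equal volume gives
    \<open>\<Omega>0\<close> the volume of the ball of radius \<open>R2\<close>.\<close>
  have "emeasure lborel \<Omega>0 = emeasure lborel (cball (0::real^'n) R1) + emeasure lborel (\<Omega>0 - cball 0 R1)"
    using assms(6) sets by (subst plus_emeasure) (auto intro!: arg_cong[where f = "emeasure lborel"])
  also have "\<dots> = emeasure lborel (cball (0::real^'n) R1) + emeasure lborel (ball 0 R2 - cball (0::real^'n) R1)"
    using eq by (simp add: shell_eq_ball_diff_cball)
  also have "\<dots> = emeasure lborel (ball (0::real^'n) R2)"
    using assms(8) sets by (subst plus_emeasure) (auto intro!: arg_cong[where f = "emeasure lborel"])
  also have "\<dots> = ennreal (unit_ball_vol CARD('n) * R2 ^ CARD('n))"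
    using R by (simp add: emeasure_ball)
  finally have "emeasure lborel \<Omega>0 = ennreal (unit_ball_vol CARD('n) * R2 ^ CARD('n))" .
  then have "steklov_dirichlet_eigenvalue R1 \<Omega>0 \<le> ennreal (real CARD('n) * unit_ball_vol CARD('n) /
      (measure (sphere_measure R2 :: (real^'n) measure) UNIV * radial_profile CARD('n) R1 R2))"
    using eq m by (intro steklov_dirichlet_eigenvalue_convex_le assms) auto
  also have "\<dots> \<le> steklov_dirichlet_eigenvalue R1 (ball 0 R2 :: (real^'n) set)"
    using assms m by (intro steklov_dirichlet_eigenvalue_ball_ge) auto
  finally show ?thesis .
qed

end
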